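(* Let $d>1$ be a squarefree integer and let $m,n$ be nonzero integers with $m^2-dn^2=4$, with the sign of $m$ chosen such that $\mathrm{ord}_3(m-2)\ge\mathrm{ord}_3 n$, where $\mathrm{ord}_3$ denotes the $3$-adic order. Let $p$ be a prime with $p\nmid n$ and $p=x^2+3dy^2$, where $x,y$ are integers with $3\nmid y$ and $x\equiv y\pmod 3$. Then $$U_{\frac{p-1}{3}}(m,1)\equiv \begin{cases} 0\pmod p & \text{if } m\equiv 2\pmod{27},\\ \big(\frac{(m-2)n/3}{3}\big)\frac{x}{dny}\pmod p & \text{if } m\equiv 5,8\pmod 9,\\ -\big(\frac{(m-2)n/27}{3}\big)\frac{x}{dny}\pmod p & \text{if } m\equiv 11,20\pmod{27},\\ \big(\frac{mn/3}{3}\big)\frac{x}{dny}\pmod p & \text{if } m\equiv 0\pmod 3,\\ \big(\frac{(m+2)n/3}{3}\big)\frac{x}{dny}\pmod p & \text{if } m\equiv 1\pmod 3,\end{cases}$$ where $\big(\frac{\cdot}{3}\big)$ is the Legendre symbol (equal to $0$ on multiples of $3$).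
   Context: $\{U_k(b,c)\}_{k\ge0}$ is the Lucas sequence defined by $U_0=0$, $U_1=1$, $U_{k+1}=bU_k-cU_{k-1}$ for $k\ge1$. The denominator $dny$ is prime to $p$ and is inverted modulo $p$. *)

theory Defs
  imports "HOL-Number_Theory.Number_Theory" "HOL-Computational_Algebra.Computational_Algebra"
begin

fun lucas_U :: "int \<Rightarrow> int \<Rightarrow> nat \<Rightarrow> int" where
  "lucas_U b c 0 = 0"
| "lucas_U b c (Suc 0) = 1"
| "lucas_U b c (Suc (Suc k)) = b * lucas_U b c (Suc k) - c * lucas_U b c k"

text \<open>
  The residue class of the fraction \<open>a / b\<close> modulo \<open>q\<close>. It is only meaningful when
  \<open>b\<close> is coprime to \<open>q\<close>; otherwise \<^const>\<open>modular_inverse\<close> is 0 by convention.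
\<close>

definition frac_mod :: "int \<Rightarrow> int \<Rightarrow> int \<Rightarrow> int" where
  "frac_mod q a b = a * modular_inverse q b"

text \<open>The only denominator to which \<^const>\<open>frac_mod\<close> is applied below is invertible:\<close>

lemma coprime_denominator:
  fixes d n x y :: int and p :: nat
  assumes "d > 1" "prime p" "\<not> int p dvd n" "int p = x^2 + 3 * d * y^2" "\<not> 3 dvd y"
  shows "coprime (d * n * y) (int p)"
proof -
  have y: "y \<noteq> 0"
    using assms(5) by auto
  then have y2: "y^2 \<ge> 1"
    by (simp add: int_one_le_iff_zero_less)
  have "d * 1 \<le> d * y^2"
    using assms(1) y2 by (intro mult_left_mono) auto
  moreover have "1 * y^2 \<le> d * y^2"
    using assms(1) by (intro mult_right_mono) auto
  moreover have "0 \<le> x^2" by simp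
  ultimately have *: "d < int p" "y^2 < int p"
    using assms(1,4) y2 by linarith+
  have "\<not> int p dvd d"
    using assms(1) *(1) zdvd_imp_le by fastforce
  moreover have "\<not> int p dvd y"
    using y2 *(2) zdvd_imp_le[of "int p" "y^2"] by (auto simp: power2_eq_square)
  moreover have "prime (int p)"
    using assms(2) by simp
  ultimately have "\<not> int p dvd d * n * y"
    using assms(3) by (simp add: prime_dvd_mult_iff)
  then show ?thesis
    using \<open>prime (int p)\<close> prime_imp_coprime coprime_commute by blast
qed

end

theory Submission
  imports Defs
begin

text \<open>
  Modulo \<open>p\<close> the square root of \<open>d\<close> is \<open>x / (y \<surd>-3)\<close>, so \<open>\<epsilon> = (m + n \<surd>d) / 2\<close> becomes
  \<open>(n x + m y \<surd>-3) / (2 y \<surd>-3)\<close>, and \<open>U\<^bsub>(p-1)/3\<^esub>(m, 1)\<close> is read off the cube root of unity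
  \<open>\<epsilon> ^ ((p - 1) / 3)\<close>. As \<open>\<epsilon>\<close> has norm 1, this is the cubic symbol of the numerator with respect to
  the rational prime \<open>p\<close>; up to units and powers of \<open>\<surd>-3\<close> it equals, by cubic reciprocity, the symbol
  of \<open>p\<close> modulo the primary part \<open>\<alpha>\<close> of the numerator. Now \<open>n\<^sup>2 p + 12 y\<^sup>2\<close> is the norm of the
  numerator, so \<open>p\<close> may be replaced by \<open>- 12 y\<^sup>2 / n\<^sup>2\<close>, and reciprocity applied backwards makes
  everything explicit except for a contribution of 3, which the supplementary law provides.
  The only reciprocity needed is the one between a rational prime \<open>l\<close> and \<open>\<alpha>\<close>. For \<open>\<alpha>\<close> a Jacobi sum
  it follows by raising the Gauss sum to the \<open>l\<close>-th power, and in general by multiplicativity.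
\<close>

section \<open>Eisenstein integers\<close>

text \<open>No factorization of \<open>l\<close> is needed to speak of the symbol of \<alpha> at a
  rational prime \<open>l\<close>. Put N = \<open>nrm \<alpha>\<close>, so that N \<alpha> =
  \<alpha>^2 \<open>cnj \<alpha>\<close>. Euler's criterion reads: for l = 3 n + 1 the power (N
  \<alpha>)^n is congruent modulo \<open>l\<close> to the conjugate of the symbol, and for l = 3 n +
  2 the number (N \<alpha>)^n \<alpha> is congruent to the symbol. These are exactly the expressions
  that the \<open>l\<close>-th power of a Gauss sum produces, N \<alpha> being the analogue of its
  cube. Going backwards is explicit for the following reason. Once gcd(n, y) is divided out, an odd
  prime other than 3 that divides n or y kills exactly one of the summands n x and m y
  \<open>rt\<close>. What is left is a rational integer times a power of \<open>rt\<close>, and such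
  numbers have trivial symbol at \<open>l\<close>. Hence only the power \<open>om ^ j\<close> split
  off to make \<alpha> primary is felt, and it contributes the exponent j (l^2 - 1) / 3. The prime 2
  needs a parity argument, and if 3 divides n a factor \<open>rt\<close> must come out of the
  numerator first, which is why the cases 3 | n and not 3 | n are computed separately.\<close>

datatype eis = Eis (ere: int) (eim: int)

instantiation eis :: idom
begin

definition zero_eis where "0 = Eis 0 0"
definition one_eis where "1 = Eis 1 0"
definition plus_eis where "x + y = Eis (ere x + ere y) (eim x + eim y)"
definition minus_eis where "x - y = Eis (ere x - ere y) (eim x - eim y)"
definition uminus_eis where "- x = Eis (- ere x) (- eim x)"
definition times_eis where
  "x * y = Eis (ere x * ere y - eim x * eim y) (ere x * eim y + eim x * ere y - eim x * eim y)"

lemma eis_sel [simp]: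
  "ere 0 = 0" "eim 0 = 0" "ere 1 = 1" "eim 1 = 0"
  "ere (x + y) = ere x + ere y" "eim (x + y) = eim x + eim y"
  "ere (x - y) = ere x - ere y" "eim (x - y) = eim x - eim y"
  "ere (- x) = - ere x" "eim (- x) = - eim x"
  "ere (x * y) = ere x * ere y - eim x * eim y"
  "eim (x * y) = ere x * eim y + eim x * ere y - eim x * eim y"
  by (simp_all add: zero_eis_def one_eis_def plus_eis_def minus_eis_def uminus_eis_def times_eis_def)

definition nrm :: "eis \<Rightarrow> int" where
  "nrm z = (ere z)\<^sup>2 - ere z * eim z + (eim z)\<^sup>2"

lemma nrm_mult: "nrm (x * y) = nrm x * nrm y"
  by (simp add: nrm_def algebra_simps power2_eq_square)

lemma nrm_4: "4 * nrm z = (2 * ere z - eim z)\<^sup>2 + 3 * (eim z)\<^sup>2"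
  by (simp add: nrm_def algebra_simps power2_eq_square)

lemma nrm_nonneg: "nrm z \<ge> 0"
  using nrm_4[of z] by (smt (verit) zero_le_power2)

lemma nrm_eq_0: "nrm z = 0 \<longleftrightarrow> z = 0"
proof
  assume "nrm z = 0"
  then have "(2 * ere z - eim z)\<^sup>2 + 3 * (eim z)\<^sup>2 = 0"
    using nrm_4[of z] by simp
  then have "(eim z)\<^sup>2 = 0" "(2 * ere z - eim z)\<^sup>2 = 0"
    by (smt (verit) zero_le_power2)+
  then show "z = 0"
    by (intro eis.expand) auto
qed (simp add: nrm_def)

instance
proof
  fix a b :: eis
  assume "a \<noteq> 0" "b \<noteq> 0"
  then show "a * b \<noteq> 0"
    by (metis nrm_eq_0 nrm_mult mult_eq_0_iff)
qed (auto intro!: eis.expand simp: algebra_simps dest: arg_cong[of _ _ ere])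

end

lemma eis_eqI: "ere x = ere y \<Longrightarrow> eim x = eim y \<Longrightarrow> x = y"
  by (simp add: eis.expand)

lemma eis_of_nat [simp]: "ere (of_nat k) = int k" "eim (of_nat k) = 0"
  by (induction k) auto

lemma eis_of_int [simp]: "ere (of_int k) = k" "eim (of_int k) = 0"
  by (cases k rule: int_cases2; simp)+

lemma eis_numeral [simp]: "ere (numeral k) = numeral k" "eim (numeral k) = 0"
  using eis_of_int[of "numeral k"] by simp_all

lemma of_int_dvd_eis: "(of_int k :: eis) dvd z \<longleftrightarrow> k dvd ere z \<and> k dvd eim z"
proof
  assume "of_int k dvd z"
  then obtain u where "z = of_int k * u" by blast
  then show "k dvd ere z \<and> k dvd eim z" by simp
next
  assume "k dvd ere z \<and> k dvd eim z"
  then obtain a b where "ere z = k * a" "eim z = k * b" by blast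
  then have "z = of_int k * Eis a b" by (intro eis_eqI) auto
  then show "of_int k dvd z" by simp
qed

definition cnj :: "eis \<Rightarrow> eis" where
  "cnj z = Eis (ere z - eim z) (- eim z)"

definition om :: eis where "om = Eis 0 1"

text \<open>The square root \<open>\<omega> - \<omega>\<^sup>2\<close> of \<open>- 3\<close>.\<close>

definition rt :: eis where "rt = Eis 1 2"

lemma om_sel [simp]: "ere om = 0" "eim om = 1" and rt_sel [simp]: "ere rt = 1" "eim rt = 2"
  by (simp_all add: om_def rt_def)

lemma cnj_sel [simp]: "ere (cnj z) = ere z - eim z" "eim (cnj z) = - eim z"
  by (simp_all add: cnj_def)

lemma cnj_hom [simp]:
  "cnj 0 = 0" "cnj 1 = 1" "cnj (x + y) = cnj x + cnj y" "cnj (x - y) = cnj x - cnj y"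
  "cnj (x * y) = cnj x * cnj y" "cnj (of_int k) = of_int k" "cnj (cnj x) = x" "cnj (- x) = - cnj x"
  by (auto intro!: eis_eqI simp: algebra_simps)

lemma cnj_power [simp]: "cnj (x ^ k) = cnj x ^ k"
  by (induction k) auto

lemma cnj_sum: "cnj (sum f A) = (\<Sum>x\<in>A. cnj (f x))"
  by (induction A rule: infinite_finite_induct) auto

lemma mult_cnj: "z * cnj z = of_int (nrm z)"
  by (intro eis_eqI) (auto simp: nrm_def algebra_simps power2_eq_square)

lemma nrm_simps [simp]: "nrm (of_int k) = k\<^sup>2" "nrm om = 1" "nrm rt = 3" "nrm 1 = 1"
  by (simp_all add: nrm_def)

lemma rt_square: "rt * rt = - 3" and cnj_rt: "cnj rt = - rt"
  by (auto intro!: eis_eqI)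

lemma om_cube: "om ^ 3 = 1" and cnj_om: "cnj om = om\<^sup>2"
  by (auto intro!: eis_eqI simp: power2_eq_square power3_eq_cube)

lemma om_power_mod: "om ^ (k mod 3) = om ^ k"
proof -
  have "om ^ k = om ^ (3 * (k div 3) + k mod 3)" by simp
  also have "\<dots> = om ^ (k mod 3)"
    by (simp only: power_add power_mult om_cube) simp
  finally show ?thesis ..
qed

lemma om_power_cong: "[i = j] (mod 3) \<Longrightarrow> om ^ i = om ^ j"
  by (metis cong_def om_power_mod)

lemma nat_mod3_cases:
  fixes k :: nat
  obtains "k mod 3 = 0" | "k mod 3 = 1" | "k mod 3 = 2"
  by linarith

text \<open>The difference of two distinct cube roots of unity always has a coordinate 1 or -1, so
  no rational integer other than a unit divides it. Congruences between roots of unity thus become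
  congruences of exponents.\<close>

lemma om_power_dvd:
  assumes "\<bar>l\<bar> > 1" "of_int l dvd om ^ i - om ^ j"
  shows "[i = j] (mod 3)"
proof -
  have d: "of_int l dvd om ^ (i mod 3) - om ^ (j mod 3)"
    using assms(2) by (simp add: om_power_mod)
  have "\<not> l dvd 1" "\<not> l dvd - 1"
    using assms(1) by auto
  then show ?thesis
    using d unfolding of_int_dvd_eis cong_def
    by (cases i rule: nat_mod3_cases; cases j rule: nat_mod3_cases)
       (auto simp: power2_eq_square)
qed

section \<open>Congruences modulo an ideal with two generators\<close>

text \<open>Gauss sums are compared modulo X^q - 1 and a rational prime simultaneously, hence two
  generators. Congruences between Eisenstein integers take the second one to be 0.\<close>

definition idcong :: "'a::comm_ring_1 \<Rightarrow> 'a \<Rightarrow> 'a \<Rightarrow> 'a \<Rightarrow> bool" where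
  "idcong a b x y \<longleftrightarrow> (\<exists>u v. x - y = a * u + b * v)"

abbreviation dcong :: "'a::comm_ring_1 \<Rightarrow> 'a \<Rightarrow> 'a \<Rightarrow> bool" where
  "dcong a \<equiv> idcong a 0"

lemma dcong_iff: "dcong a x y \<longleftrightarrow> a dvd x - y"
  by (auto simp: idcong_def dvd_def)

lemma idcong_left: "a dvd x - y \<Longrightarrow> idcong a b x y"
  unfolding idcong_def dvd_def by (metis add.right_neutral mult_zero_right)

lemma idcong_right: "b dvd x - y \<Longrightarrow> idcong a b x y"
  unfolding idcong_def dvd_def by (metis add.left_neutral mult_zero_right)

lemma idcong_refl [simp]: "idcong a b x x"
  by (intro idcong_left) simp

lemma idcong_sym: "idcong a b x y \<Longrightarrow> idcong a b y x"
proof -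
  assume "idcong a b x y"
  then obtain u v where "x - y = a * u + b * v" unfolding idcong_def by blast
  then have "y - x = a * (- u) + b * (- v)" by (simp add: algebra_simps)
  then show ?thesis unfolding idcong_def by blast
qed

lemma idcong_add: "idcong a b x y \<Longrightarrow> idcong a b x' y' \<Longrightarrow> idcong a b (x + x') (y + y')"
proof -
  assume "idcong a b x y" "idcong a b x' y'"
  then obtain u v u' v' where "x - y = a * u + b * v" "x' - y' = a * u' + b * v'"
    unfolding idcong_def by blast
  then have "(x + x') - (y + y') = a * (u + u') + b * (v + v')"
    by (simp add: algebra_simps)
  then show ?thesis unfolding idcong_def by blast
qed

lemma idcong_trans [trans]: "idcong a b x y \<Longrightarrow> idcong a b y z \<Longrightarrow> idcong a b x z"
  using idcong_add[of a b x y y z] by (auto simp: idcong_def)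

lemma idcong_mult_left: "idcong a b x y \<Longrightarrow> idcong a b (c * x) (c * y)"
proof -
  assume "idcong a b x y"
  then obtain u v where "x - y = a * u + b * v" unfolding idcong_def by blast
  then have "c * x - c * y = a * (c * u) + b * (c * v)"
    by (metis distrib_left mult.left_commute right_diff_distrib)
  then show ?thesis unfolding idcong_def by blast
qed

lemma idcong_mult: "idcong a b x y \<Longrightarrow> idcong a b x' y' \<Longrightarrow> idcong a b (x * x') (y * y')"
  by (metis idcong_mult_left idcong_trans mult.commute)

lemma idcong_power: "idcong a b x y \<Longrightarrow> idcong a b (x ^ k) (y ^ k)"
  by (induction k) (auto intro: idcong_mult)

lemma idcong_sum: "(\<And>i. i \<in> A \<Longrightarrow> idcong a b (f i) (g i)) \<Longrightarrow> idcong a b (sum f A) (sum g A)"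
  by (induction A rule: infinite_finite_induct) (auto intro: idcong_add)

section \<open>Frobenius congruences modulo a rational prime\<close>

lemma frobenius_add:
  fixes x y :: "'a::comm_ring_1"
  assumes "prime l"
  shows "dcong (of_nat l) ((x + y) ^ l) (x ^ l + y ^ l)"
proof -
  have l: "l > 0" using assms by (simp add: prime_gt_0_nat)
  have "(x + y) ^ l = (\<Sum>k\<le>l. of_nat (l choose k) * x ^ k * y ^ (l - k))"
    by (rule binomial_ring)
  also have "{..l} = insert 0 (insert l {0<..<l})" using l by auto
  also have "(\<Sum>k\<in>\<dots>. of_nat (l choose k) * x ^ k * y ^ (l - k)) =
      y ^ l + x ^ l + (\<Sum>k\<in>{0<..<l}. of_nat (l choose k) * x ^ k * y ^ (l - k))"
    using l by simp
  finally have "(x + y) ^ l - (x ^ l + y ^ l) =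
      (\<Sum>k\<in>{0<..<l}. of_nat (l choose k) * x ^ k * y ^ (l - k))"
    by simp
  also have "of_nat l dvd \<dots>"
  proof (intro dvd_sum)
    fix k assume "k \<in> {0<..<l}"
    then have "l dvd l choose k"
      using assms by (intro dvd_choose_prime) auto
    then have "(of_nat l :: 'a) dvd of_nat (l choose k)"
      by (auto simp: dvd_def)
    then show "of_nat l dvd of_nat (l choose k) * x ^ k * y ^ (l - k)"
      by simp
  qed
  finally show ?thesis by (simp add: dcong_iff)
qed

lemma frobenius_sum:
  fixes f :: "'b \<Rightarrow> 'a::comm_ring_1"
  assumes "prime l"
  shows "dcong (of_nat l) ((\<Sum>i\<in>A. f i) ^ l) (\<Sum>i\<in>A. f i ^ l)"
proof (induction A rule: infinite_finite_induct)
  case (insert i A)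
  then show ?case
    using idcong_trans[OF frobenius_add[OF assms] idcong_add[OF idcong_refl]] by simp
qed (use assms in \<open>auto simp: power_0_left\<close>)

lemma fermat_int:
  fixes k :: int
  assumes "prime l"
  shows "[k ^ l = k] (mod int l)"
proof -
  define a where "a = nat (k mod int l)"
  have l: "l > 0" using assms by (simp add: prime_gt_0_nat)
  have a: "[int a = k] (mod int l)"
    using l by (simp add: a_def cong_def)
  have "[a ^ l = a] (mod l)"
  proof (cases "l dvd a")
    case True
    then have "l dvd a ^ l" using l by (simp add: dvd_power_le[of l a 1 l, simplified] Suc_leI)
    then show ?thesis using True by (simp add: cong_def mod_eq_0_iff_dvd)
  next
    case False
    then have "[a * a ^ (l - 1) = a * 1] (mod l)"
      by (intro cong_mult fermat_theorem assms cong_refl)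
    then show ?thesis using l by (simp add: power_eq_if)
  qed
  then have "[int a ^ l = int a] (mod int l)"
    by (metis cong_int_iff of_nat_power)
  then show ?thesis
    using a by (meson cong_pow cong_sym cong_trans)
qed

lemma eis_expand: "z = of_int (ere z) + of_int (eim z) * om"
  by (intro eis_eqI) auto

text \<open>The \<open>l\<close>-th power fixes rational integers modulo \<open>l\<close>, so it
  acts through \<open>om\<close> alone: as the identity if l = 1 and as conjugation if l = 2 modulo
  3.\<close>

lemma eis_frobenius:
  assumes "prime l"
  shows "dcong (of_nat l) (z ^ l) (of_int (ere z) + of_int (eim z) * om ^ l)"
proof -
  have F: "dcong (of_nat l) ((of_int k :: eis) ^ l) (of_int k)" for k
  proof -
    have "int l dvd k ^ l - k"
      using fermat_int[OF assms] by (simp add: cong_iff_dvd_diff)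
    then have "of_int (int l) dvd (of_int (k ^ l - k) :: eis)"
      by (metis eis_of_int(1,2) of_int_dvd_eis dvd_0_right)
    then show ?thesis by (simp add: dcong_iff)
  qed
  have "dcong (of_nat l) (z ^ l) (of_int (ere z) ^ l + (of_int (eim z) * om) ^ l)"
    by (subst eis_expand) (rule frobenius_add[OF assms])
  also have "dcong (of_nat l) \<dots> (of_int (ere z) + of_int (eim z) * om ^ l)"
    unfolding power_mult_distrib by (intro idcong_add idcong_mult F idcong_refl)
  finally show ?thesis .
qed

section \<open>Cubic characters and Jacobi sums\<close>

text \<open>The integer \<open>w\<close> is the image of \<open>om\<close> in the field with
  \<open>q\<close> elements. Choosing it amounts to choosing one of the two primes above
  \<open>q\<close>, and its existence forces q = 1 modulo 3.\<close>

locale cubic_residues =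
  fixes q :: nat and w :: int
  assumes prime_q: "prime q" and q_ne_3: "q \<noteq> 3" and root: "int q dvd w\<^sup>2 + w + 1"
begin

abbreviation T :: "int set" where "T \<equiv> {0..<int q}"

lemma q_gt_1: "q > 1"
  using prime_q by (rule prime_gt_1_nat)

lemma prime_int_q: "prime (int q)"
  using prime_q by simp

lemma not_dvd_mult: "\<not> int q dvd s \<Longrightarrow> \<not> int q dvd t \<Longrightarrow> \<not> int q dvd s * t"
  using prime_int_q by (simp add: prime_dvd_mult_iff)

lemma not_dvd_3: "\<not> int q dvd 3"
proof
  assume "int q dvd 3"
  then have "q dvd 3" by presburger
  then show False
    using prime_q q_ne_3 primes_dvd_imp_eq[of q 3] by simp
qed

lemma w_cube: "[w ^ 3 = 1] (mod int q)"
proof -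
  have "w ^ 3 - 1 = (w - 1) * (w\<^sup>2 + w + 1)"
    by (simp add: algebra_simps power2_eq_square power3_eq_cube)
  then show ?thesis using root by (simp add: cong_iff_dvd_diff)
qed

lemma w_power_mod: "[w ^ (i mod 3) = w ^ i] (mod int q)"
proof -
  have "w ^ i = (w ^ 3) ^ (i div 3) * w ^ (i mod 3)"
    by (simp flip: power_mult power_add)
  moreover have "[(w ^ 3) ^ (i div 3) * w ^ (i mod 3) = 1 ^ (i div 3) * w ^ (i mod 3)] (mod int q)"
    by (intro cong_mult cong_pow w_cube cong_refl)
  ultimately show ?thesis by (simp add: cong_sym)
qed

lemma w_ne_1: "\<not> [w = 1] (mod int q)"
proof
  assume "[w = 1] (mod int q)"
  then have "[w\<^sup>2 + w + 1 = 1\<^sup>2 + 1 + 1] (mod int q)"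
    by (intro cong_add cong_pow) auto
  then have "[w\<^sup>2 + w + 1 = 3] (mod int q)" by simp
  then show False
    using root not_dvd_3 cong_dvd_iff by blast
qed

lemma coprime_w: "coprime w (int q)"
proof -
  have "\<not> int q dvd w"
  proof
    assume "int q dvd w"
    then have "int q dvd w * (w + 1)" by simp
    moreover have "w\<^sup>2 + w + 1 = w * (w + 1) + 1" by (simp add: power2_eq_square algebra_simps)
    ultimately have "int q dvd 1" using root by (simp add: dvd_add_right_iff)
    then show False using q_gt_1 by simp
  qed
  then show ?thesis
    using prime_imp_coprime[OF prime_int_q] by (simp add: coprime_commute)
qed

lemma w_power_cong: 
  assumes "[w ^ i = w ^ j] (mod int q)"
  shows "[i = j] (mod 3)"
proof -
  have w2: "\<not> [w ^ 2 = 1] (mod int q)"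
  proof
    assume "[w ^ 2 = 1] (mod int q)"
    then have "[w * w\<^sup>2 = w * 1] (mod int q)" by (rule cong_scalar_left)
    then have "[w = w ^ 3] (mod int q)" by (simp add: power2_eq_square power3_eq_cube cong_sym mult.assoc)
    then show False using w_cube w_ne_1 cong_trans by blast
  qed
  have w21: "\<not> [w ^ 2 = w] (mod int q)"
  proof
    assume "[w ^ 2 = w] (mod int q)"
    then have "[w * w = w * 1] (mod int q)" by (simp add: power2_eq_square)
    then show False using w_ne_1 coprime_w cong_mult_lcancel by blast
  qed
  have "[w ^ (i mod 3) = w ^ (j mod 3)] (mod int q)"
    using assms w_power_mod by (meson cong_sym cong_trans)
  then show ?thesis
    using w_ne_1 w2 w21 cong_sym[of 1 w "int q"] cong_sym[of 1 "w\<^sup>2" "int q"]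
      cong_sym[of w "w\<^sup>2" "int q"]
    by (cases i rule: nat_mod3_cases; cases j rule: nat_mod3_cases) (auto simp: cong_def[of i])
qed

text \<open>Fermat gives w^q = w modulo \<open>q\<close>, and \<open>w\<close> has order exactly
  3.\<close>

lemma q_mod_3: "q mod 3 = 1"
proof -
  have "[w ^ q = w] (mod int q)"
    by (rule fermat_int[OF prime_q])
  then have "[w ^ q = w ^ 1] (mod int q)" by simp
  then have "[q = 1] (mod 3)" by (rule w_power_cong)
  then show ?thesis by (simp add: cong_def)
qed

definition k where "k = (q - 1) div 3"

lemma q_eq: "q = 3 * k + 1"
  using q_mod_3 unfolding k_def by presburger

lemma k_pos: "k > 0"
  using q_eq q_gt_1 by simp

text \<open>A logarithm of t^k to the base \<open>w\<close>. The default 2 is also taken at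
  multiples of \<open>q\<close>, where \<open>chi\<close> is set to 0 separately.\<close>

definition idx :: "int \<Rightarrow> nat" where
  "idx t = (if [t ^ k = 1] (mod int q) then 0 else if [t ^ k = w] (mod int q) then 1 else 2)"

lemma cong_fermat: "\<not> int q dvd t \<Longrightarrow> [t ^ (3 * k) = 1] (mod int q)"
proof -
  assume "\<not> int q dvd t"
  then have "coprime t (int q)"
    using prime_imp_coprime[OF prime_int_q] by (simp add: coprime_commute)
  moreover have "[t * t ^ (3 * k) = t * 1] (mod int q)"
    using fermat_int[OF prime_q, of t] by (subst (asm) q_eq) simp
  ultimately show ?thesis using cong_mult_lcancel by blast
qed

lemma idx: "\<not> int q dvd t \<Longrightarrow> [t ^ k = w ^ idx t] (mod int q)"
proof -
  assume t: "\<not> int q dvd t"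
  define z where "z = t ^ k"
  have "z ^ 3 = t ^ (3 * k)"
    unfolding z_def by (simp only: power_mult[symmetric] mult.commute)
  then obtain c where c: "z ^ 3 - 1 = int q * c"
    using cong_fermat[OF t] by (auto simp: cong_iff_dvd_diff)
  obtain d where d: "w ^ 3 - 1 = int q * d"
    using w_cube by (auto simp: cong_iff_dvd_diff)
  obtain e where e: "w\<^sup>2 + w + 1 = int q * e"
    using root by auto
  \<comment> \<open>The factorization of z^3 - 1 by the cube roots of unity, with the error
    expressed by quantities already known to be multiples of \<open>q\<close>.\<close>
  have "(z - 1) * (z - w) * (z - w\<^sup>2) = (z ^ 3 - 1) + (w\<^sup>2 + w + 1) * (z * w - z\<^sup>2) - (w ^ 3 - 1)"
    by (simp add: algebra_simps power2_eq_square power3_eq_cube)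
  also have "\<dots> = int q * (c + e * (z * w - z\<^sup>2) - d)"
    unfolding c d e by (simp add: algebra_simps)
  finally have "int q dvd (z - 1) * (z - w) * (z - w\<^sup>2)"
    by simp
  then have "[z = 1] (mod int q) \<or> [z = w] (mod int q) \<or> [z = w\<^sup>2] (mod int q)"
    using prime_int_q by (simp only: prime_dvd_mult_iff cong_iff_dvd_diff) blast
  then show ?thesis by (auto simp: idx_def z_def)
qed

lemma idx_unique: "\<not> int q dvd t \<Longrightarrow> [t ^ k = w ^ i] (mod int q) \<Longrightarrow> [idx t = i] (mod 3)"
  using idx w_power_cong by (meson cong_sym cong_trans)

lemma idx_mult:
  assumes "\<not> int q dvd s" "\<not> int q dvd t"
  shows "[idx (s * t) = idx s + idx t] (mod 3)"
proof (rule idx_unique)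
  show "[(s * t) ^ k = w ^ (idx s + idx t)] (mod int q)"
    unfolding power_mult_distrib power_add by (intro cong_mult idx assms)
qed (use assms not_dvd_mult in blast)

lemma idx_cong: "[s = t] (mod int q) \<Longrightarrow> idx s = idx t"
proof -
  assume "[s = t] (mod int q)"
  then have "[s ^ k = t ^ k] (mod int q)" by (rule cong_pow)
  then show ?thesis by (simp add: idx_def cong_def)
qed

definition chi :: "int \<Rightarrow> eis" where
  "chi t = (if int q dvd t then 0 else om ^ idx t)"

lemma chi_mult: "chi (s * t) = chi s * chi t"
proof (cases "int q dvd s \<or> int q dvd t")
  case False
  then show ?thesis
    using idx_mult[of s t] not_dvd_mult[of s t] 
    by (simp add: chi_def om_power_cong flip: power_add)
qed (auto simp: chi_def)

lemma chi_cong: "[s = t] (mod int q) \<Longrightarrow> chi s = chi t"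
  using idx_cong[of s t] cong_dvd_iff[of s t] by (simp add: chi_def)

lemma chi_mod [simp]: "chi (t mod int q) = chi t"
  by (rule chi_cong) (simp add: cong_def)

lemma chi_1 [simp]: "chi 1 = 1"
  using q_gt_1 by (simp add: chi_def idx_def)

lemma chi_neg_1 [simp]: "chi (- 1) = 1"
proof -
  have u: "\<not> int q dvd - 1" using q_gt_1 by simp
  have "[idx ((- 1) * (- 1)) = idx (- 1) + idx (- 1)] (mod 3)"
    by (intro idx_mult u)
  moreover have "idx ((- 1) * (- 1)) = 0" by (simp add: idx_def)
  ultimately have "[idx (- 1) = 0] (mod 3)" unfolding cong_def by presburger
  then show ?thesis using u om_power_cong[of "idx (- 1)" 0] by (simp add: chi_def)
qed

lemma chi_neg: "chi (- t) = chi t"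
  using chi_mult[of "- 1" t] by simp

lemma chi_mult_cnj: "\<not> int q dvd t \<Longrightarrow> chi t * cnj (chi t) = 1"
  by (simp add: chi_def power_mult_distrib[symmetric] mult_cnj del: power_mult_distrib)

lemma chi_square: "chi t * chi t = cnj (chi t)"
  by (simp add: chi_def cnj_om mult_2 flip: power_add power_mult)

lemma chi_power_cong:
  assumes "i > 0" "j > 0" "[i = j] (mod 3)"
  shows "chi t ^ i = chi t ^ j"
proof (cases "int q dvd t")
  case False
  have "[idx t * i = idx t * j] (mod 3)" using assms(3) by (rule cong_scalar_left)
    then show ?thesis using False by (simp add: chi_def om_power_cong flip: power_mult)
qed (use assms in \<open>auto simp: chi_def power_0_left\<close>)

text \<open>A map that is injective on residues permutes them. Periodicity of \<open>F\<close>
  allows \<open>g\<close> to leave the interval \<open>T\<close>, so shifts, reflections and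
  scalings can be substituted directly.\<close>

lemma sum_residues:
  assumes "\<And>t. F (t mod int q) = F t" and "\<And>s t. int q dvd g s - g t \<Longrightarrow> int q dvd s - t"
  shows "(\<Sum>t\<in>T. F (g t)) = (\<Sum>t\<in>T. F t)"
proof -
  have "inj_on (\<lambda>t. g t mod int q) T"
  proof (rule inj_onI)
    fix s t assume st: "s \<in> T" "t \<in> T" "g s mod int q = g t mod int q"
    then have "s mod int q = t mod int q"
      using assms(2) by (metis mod_eq_dvd_iff)
    then show "s = t" using st by simp
  qed
  moreover have "(\<lambda>t. g t mod int q) ` T \<subseteq> T"
    using q_gt_1 by auto
  ultimately have "bij_betw (\<lambda>t. g t mod int q) T T"
    by (simp add: bij_betw_def endo_inj_surj)
  then have "(\<Sum>t\<in>T. F (g t mod int q)) = (\<Sum>t\<in>T. F t)"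
    by (rule sum.reindex_bij_betw)
  then show ?thesis by (simp add: assms(1))
qed

lemma sum_residues_mult:
  assumes "\<And>t. F (t mod int q) = F t" and "\<not> int q dvd c"
  shows "(\<Sum>t\<in>T. F (c * t)) = (\<Sum>t\<in>T. F t)"
proof (rule sum_residues)
  show "int q dvd s - t" if "int q dvd c * s - c * t" for s t
  proof -
    have "int q dvd c * (s - t)" using that by (simp add: algebra_simps)
    then show ?thesis using assms(2) prime_int_q by (simp add: prime_dvd_mult_iff)
  qed
qed (rule assms)

lemma exists_generator:
  obtains g :: int where "\<not> int q dvd g" "\<forall>i. 0 < i \<longrightarrow> i < 3 * k \<longrightarrow> \<not> [g ^ i = 1] (mod int q)"
proof -
  obtain g where g: "residue_primroot q g"
    using prime_primitive_root_exists[of q] prime_q q_gt_1 by auto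
  have o: "ord q g = 3 * k" and c: "coprime q g"
    using g prime_q q_eq by (auto simp: residue_primroot_def totient_prime)
  have "\<not> [int g ^ i = 1] (mod int q)" if "0 < i" "i < 3 * k" for i
  proof
    assume "[int g ^ i = 1] (mod int q)"
    then have "[g ^ i = 1] (mod q)" by (metis cong_int_iff of_nat_1 of_nat_power)
    then have "3 * k dvd i" using o by (metis ord_divides)
    then show False using that by (auto dest: dvd_imp_le)
  qed
  moreover have "\<not> int q dvd int g"
    using c q_gt_1 by (metis coprime_absorb_left int_dvd_int_iff nat_dvd_1_iff_1 less_irrefl)
  ultimately show ?thesis using that by blast
qed

lemma sum_chi: "(\<Sum>t\<in>T. chi t) = 0"
proof -
  obtain g where g: "\<not> int q dvd g" "\<forall>i. 0 < i \<longrightarrow> i < 3 * k \<longrightarrow> \<not> [g ^ i = 1] (mod int q)"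
    by (rule exists_generator)
  have "\<not> [g ^ k = 1] (mod int q)" using g(2) k_pos by simp
  then have "idx g \<in> {1, 2}" by (auto simp: idx_def)
  then have "chi g \<noteq> 1"
    using g(1) by (auto simp: chi_def power2_eq_square dest: arg_cong[of _ _ eim])
  moreover have "(\<Sum>t\<in>T. chi (g * t)) = (\<Sum>t\<in>T. chi t)"
    by (intro sum_residues_mult g chi_mod)
  then have "chi g * (\<Sum>t\<in>T. chi t) = (\<Sum>t\<in>T. chi t)"
    by (simp add: chi_mult sum_distrib_left)
  ultimately show ?thesis by (metis mult_cancel_right mult_1)
qed

text \<open>Substituting g t for t multiplies the sum by g^i, and a generator has g^i different from
  1 for 0 < i < q - 1. For i = 0 the sum is \<open>q\<close>, as 0^0 = 1.\<close>

lemma sum_powers: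
  assumes "i < 3 * k"
  shows "int q dvd (\<Sum>t\<in>T. t ^ i)"
proof (cases "i = 0")
  case False
  obtain g where g: "\<not> int q dvd g" "\<forall>i. 0 < i \<longrightarrow> i < 3 * k \<longrightarrow> \<not> [g ^ i = 1] (mod int q)"
    by (rule exists_generator)
  \<comment> \<open>The powers are reduced because \<open>sum_residues_mult\<close> asks for a
    function that is periodic, not merely periodic up to congruence.\<close>
  define F where "F t = t ^ i mod int q" for t
  have cF: "[(\<Sum>t\<in>T. F (h t)) = (\<Sum>t\<in>T. h t ^ i)] (mod int q)" for h
    unfolding F_def by (intro cong_sum) simp
  have "(\<Sum>t\<in>T. F (g * t)) = (\<Sum>t\<in>T. F t)"
    by (intro sum_residues_mult g) (simp add: F_def power_mod)
  then have "[(\<Sum>t\<in>T. (g * t) ^ i) = (\<Sum>t\<in>T. t ^ i)] (mod int q)"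
    using cF[of "\<lambda>t. g * t"] cF[of "\<lambda>t. t"] by (metis cong_sym cong_trans)
  then have "int q dvd (g ^ i - 1) * (\<Sum>t\<in>T. t ^ i)"
    by (simp add: cong_iff_dvd_diff power_mult_distrib sum_distrib_left left_diff_distrib
        sum_subtractf)
  moreover have "\<not> int q dvd g ^ i - 1"
    using g(2) assms False by (simp add: cong_iff_dvd_diff)
  ultimately show ?thesis using prime_int_q by (simp add: prime_dvd_mult_iff)
qed simp

end

section \<open>Gauss and Jacobi sums in the group algebra\<close>

context cubic_residues
begin

definition M :: "eis poly" where "M = monom 1 q - 1"

text \<open>
  A function on the residues modulo \<open>q\<close> is an element of the group algebra, represented by a
  polynomial modulo \<open>X ^ q - 1\<close>; thus \<open>P chi\<close> is the Gauss sum.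
\<close>

definition P :: "(int \<Rightarrow> eis) \<Rightarrow> eis poly" where
  "P f = (\<Sum>t\<in>T. monom (f t) (nat t))"

definition conv :: "(int \<Rightarrow> eis) \<Rightarrow> (int \<Rightarrow> eis) \<Rightarrow> int \<Rightarrow> eis" where
  "conv f h u = (\<Sum>t\<in>T. f t * h (u - t))"

lemma monom_mod: "idcong M b (monom c i) (monom c (i mod q))"
proof -
  have step: "idcong M b (monom c (j + q)) (monom c j)" for j
  proof (rule idcong_left)
    have "monom c (j + q) - monom c j = M * monom c j"
      by (simp add: M_def left_diff_distrib mult_monom add.commute)
    then show "M dvd monom c (j + q) - monom c j" by simp
  qed
  have "idcong M b (monom c (i mod q + q * n)) (monom c (i mod q))" for n
  proof (induction n)
    case (Suc n)
    have "idcong M b (monom c (i mod q + q * n + q)) (monom c (i mod q + q * n))"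
      by (rule step)
    then show ?case
      using Suc idcong_trans by (metis (no_types, lifting) add.assoc add.commute mult_Suc_right)
  qed simp
  from this[of "i div q"] show ?thesis by simp
qed

lemma nat_mod_cong: "a \<ge> 0 \<Longrightarrow> nat a mod q = nat (a mod int q)"
  by (simp add: nat_mod_distrib)

text \<open>Multiplication modulo X^q - 1 is cyclic convolution. In \<open>conv\<close> the function
  \<open>h\<close> is evaluated at differences u - t that leave \<open>T\<close>, whence its
  periodicity.\<close>

lemma P_mult:
  assumes "\<And>t. h (t mod int q) = h t"
  shows "idcong M b (P f * P h) (P (conv f h))"
proof -
  have "P f * P h = (\<Sum>t\<in>T. \<Sum>s\<in>T. monom (f t * h s) (nat t + nat s))"
    by (simp add: P_def sum_product mult_monom)
  also have "idcong M b \<dots> (\<Sum>t\<in>T. \<Sum>s\<in>T. monom (f t * h s) (nat ((t + s) mod int q)))"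
  proof (intro idcong_sum)
    fix t s assume "t \<in> T" "s \<in> T"
    then have "(nat t + nat s) mod q = nat ((t + s) mod int q)"
      by (simp add: nat_mod_cong[symmetric] nat_add_distrib)
    then show "idcong M b (monom (f t * h s) (nat t + nat s))
        (monom (f t * h s) (nat ((t + s) mod int q)))"
      using monom_mod by metis
  qed
  also have "(\<Sum>t\<in>T. \<Sum>s\<in>T. monom (f t * h s) (nat ((t + s) mod int q))) =
      (\<Sum>t\<in>T. \<Sum>u\<in>T. monom (f t * h (u - t)) (nat u))"
  proof (rule sum.cong[OF refl])
    fix t
    define F where "F u = monom (f t * h (u - t)) (nat (u mod int q))" for u
    have "F (u mod int q) = F u" for u
    proof -
      have "h (u mod int q - t) = h (u - t)"
        by (metis assms mod_diff_left_eq)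
      then show ?thesis by (simp add: F_def)
    qed
    then have "(\<Sum>s\<in>T. F (t + s)) = (\<Sum>u\<in>T. F u)"
      by (intro sum_residues[of F "\<lambda>s. t + s"]) auto
    then show "(\<Sum>s\<in>T. monom (f t * h s) (nat ((t + s) mod int q))) =
        (\<Sum>u\<in>T. monom (f t * h (u - t)) (nat u))"
      by (simp add: F_def)
  qed
  also have "\<dots> = P (conv f h)"
    unfolding P_def conv_def by (subst sum.swap) (simp add: monom_sum)
  finally show ?thesis .
qed

lemma P_smult: "P (\<lambda>t. c * f t) = smult c (P f)"
proof -
  have "smult c (sum F A) = (\<Sum>t\<in>A. smult c (F t))" for F :: "int \<Rightarrow> eis poly" and A
    by (induction A rule: infinite_finite_induct) (auto simp: smult_add_right)
  then show ?thesis by (simp add: P_def smult_monom)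
qed

lemma idcong_smult: "idcong M b x y \<Longrightarrow> idcong M b (smult c x) (smult c y)"
  using idcong_mult_left[of M b x y "[:c:]"] by simp

text \<open>Modulo \<open>l\<close> the power is taken term by term and moves X^t to X^(l t). As
  \<open>l\<close> is invertible modulo \<open>q\<close>, the exponents are only permuted, and
  \<open>h\<close> is the coefficient function after this permutation.\<close>

lemma P_frobenius:
  assumes "prime l" "l \<noteq> q" and "\<And>t. h (t mod int q) = h t" "\<And>t. h (int l * t) = f t ^ l"
  shows "idcong M [:of_nat l:] (P f ^ l) (P h)"
proof -
  have l: "\<not> int q dvd int l"
    using assms(1,2) prime_q by (auto dest: primes_dvd_imp_eq)
  have "dcong (of_nat l) (P f ^ l) (\<Sum>t\<in>T. monom (f t) (nat t) ^ l)"
    unfolding P_def by (rule frobenius_sum[OF assms(1)])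
  then have "idcong M [:of_nat l:] (P f ^ l) (\<Sum>t\<in>T. monom (f t) (nat t) ^ l)"
    unfolding dcong_iff of_nat_poly by (rule idcong_right)
  also have "(\<Sum>t\<in>T. monom (f t) (nat t) ^ l) = (\<Sum>t\<in>T. monom (h (int l * t)) (nat (int l * t)))"
    by (simp add: monom_power assms(4) nat_mult_distrib mult.commute[of "nat _"])
  also have "idcong M [:of_nat l:] \<dots> (\<Sum>t\<in>T. monom (h (int l * t)) (nat ((int l * t) mod int q)))"
  proof (rule idcong_sum)
    fix t assume "t \<in> T"
    then have "nat (int l * t) mod q = nat ((int l * t) mod int q)"
      by (intro nat_mod_cong) auto
    then show "idcong M [:of_nat l:] (monom (h (int l * t)) (nat (int l * t)))
        (monom (h (int l * t)) (nat ((int l * t) mod int q)))"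
      using monom_mod by metis
  qed
  also have "(\<Sum>t\<in>T. monom (h (int l * t)) (nat ((int l * t) mod int q))) =
      (\<Sum>t\<in>T. monom (h t) (nat (t mod int q)))"
    by (rule sum_residues_mult[OF _ l]) (simp add: assms(3))
  also have "\<dots> = P h"
    by (simp add: P_def)
  finally show ?thesis .
qed

lemma coeff_P_sum: "(\<Sum>j\<le>n. coeff (P f) (1 + j * q)) = f 1"
proof -
  have "coeff (P f) (1 + j * q) = (if j = 0 then f 1 else 0)" for j
  proof -
    have "coeff (P f) (1 + j * q) = (\<Sum>t\<in>T. if nat t = 1 + j * q then f t else 0)"
      by (simp add: P_def coeff_sum coeff_monom)
    also have "\<dots> = (\<Sum>t\<in>T. if t = 1 \<and> j = 0 then f t else 0)"
    proof (intro sum.cong refl if_cong)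
      fix t assume "t \<in> T"
      then show "(nat t = 1 + j * q) = (t = 1 \<and> j = 0)"
        by (cases j) auto
    qed
    also have "\<dots> = (if j = 0 then f 1 else 0)"
      using q_gt_1 by (auto simp: sum.delta)
    finally show ?thesis .
  qed
  then show ?thesis by simp
qed

text \<open>
  Coefficients are extracted with the functional that sums those at exponents congruent to 1
  modulo \<open>q\<close>; it vanishes on the multiples of \<open>X ^ q - 1\<close>.
\<close>

lemma idcong_P_D:
  assumes "idcong M [:c:] (P f) (P h)"
  shows "c dvd f 1 - h 1"
proof -
  obtain u v where uv: "P f - P h = M * u + [:c:] * v"
    using assms unfolding idcong_def by blast
  define n where "n = degree u"
  \<comment> \<open>The coefficient of (X^q - 1) u at 1 + j q is a difference of consecutive
    coefficients of \<open>u\<close>. With n = \<open>degree u\<close> the one surviving exponent, 1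
    + n q, lies beyond the degree.\<close>
  have tele: "(\<Sum>j\<le>m. coeff (M * u) (1 + j * q)) = - coeff u (1 + m * q)" for m
  proof (induction m)
    case 0
    then show ?case
      using q_gt_1 by (simp add: M_def left_diff_distrib coeff_monom_mult)
  next
    case (Suc m)
    have "coeff (M * u) (1 + Suc m * q) = coeff u (1 + m * q) - coeff u (1 + Suc m * q)"
      by (simp add: M_def left_diff_distrib coeff_monom_mult)
    then show ?case using Suc by simp
  qed
  have "1 * degree u \<le> degree u * q"
    using q_gt_1 by simp
  then have "degree u < 1 + n * q"
    unfolding n_def by linarith
  then have "coeff u (1 + n * q) = 0"
    by (rule coeff_eq_0)
  moreover have "f 1 - h 1 = (\<Sum>j\<le>n. coeff (P f - P h) (1 + j * q))"
    by (simp add: sum_subtractf coeff_P_sum[simplified])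
  moreover have "\<dots> = (\<Sum>j\<le>n. coeff (M * u) (1 + j * q)) + c * (\<Sum>j\<le>n. coeff v (1 + j * q))"
    unfolding uv by (simp add: sum.distrib sum_distrib_left)
  ultimately have "f 1 - h 1 = c * (\<Sum>j\<le>n. coeff v (1 + j * q))"
    using tele[of n] by simp
  then show ?thesis by simp
qed

definition jac :: eis where
  "jac = (\<Sum>t\<in>T. chi t * chi (1 - t))"

text \<open>The element q - (1 + X + ... + X^(q-1)). In the cyclotomic ring the two conjugate Gauss
  sums multiply to \<open>q\<close>; modulo X^q - 1 the trivial character of the group survives as
  well, and \<open>delta\<close> takes the place of \<open>q\<close>.\<close>

definition delta :: "int \<Rightarrow> eis" where
  "delta u = (if int q dvd u then of_nat q else 0) - 1"

lemma cnj_chi_mod [simp]: "cnj (chi (t mod int q)) = cnj (chi t)"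
  by simp

lemma sum_cnj_chi: "(\<Sum>t\<in>T. cnj (chi t)) = 0"
  using sum_chi cnj_sum by (metis cnj_hom(1))

lemma conv_scale:
  assumes "\<And>t. f (t mod int q) = f t" "\<And>t. h (t mod int q) = h t" "\<not> int q dvd u"
  shows "conv f h u = (\<Sum>t\<in>T. f (u * t) * h (u * (1 - t)))"
proof -
  define F where "F t = f t * h (u - t)" for t
  have "F (t mod int q) = F t" for t
    unfolding F_def using assms(1,2) by (metis mod_diff_right_eq)
  then have "(\<Sum>t\<in>T. F (u * t)) = (\<Sum>t\<in>T. F t)"
    by (intro sum_residues_mult assms(3))
  then show ?thesis by (simp add: F_def conv_def algebra_simps)
qed

lemma conv_chi_chi: "conv chi chi u = jac * cnj (chi u)"
proof (cases "int q dvd u")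
  case True
  have "conv chi chi u = (\<Sum>t\<in>T. cnj (chi t))"
    unfolding conv_def
  proof (intro sum.cong refl)
    fix t
    have "chi (u - t) = chi (- t)"
      using True by (intro chi_cong) (simp add: cong_iff_dvd_diff)
    then show "chi t * chi (u - t) = cnj (chi t)"
      by (simp add: chi_neg chi_square)
  qed
  moreover have "chi u = 0" using True by (simp add: chi_def)
  ultimately show ?thesis by (simp add: sum_cnj_chi)
next
  case False
  have "conv chi chi u = (\<Sum>t\<in>T. (chi u * chi u) * (chi t * chi (1 - t)))"
    by (subst conv_scale[OF _ _ False]) (simp_all add: chi_mult mult_ac)
  then show ?thesis
    by (simp add: jac_def chi_square sum_distrib_left mult.commute)
qed

text \<open>Scaling shows that the value at a nonzero \<open>u\<close> does not depend on
  \<open>u\<close>. The total over all \<open>u\<close> is 0 because the characters sum to 0, and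
  together with the value q - 1 at 0 this leaves -1.\<close>

lemma conv_chi_cnj: "conv chi (\<lambda>t. cnj (chi t)) u = delta u"
proof -
  let ?c = "conv chi (\<lambda>t. cnj (chi t))"
  have zero: "?c u = of_nat q - 1" if "int q dvd u" for u
  proof -
    have "?c u = (\<Sum>t\<in>T. if t = 0 then 0 else 1)"
      unfolding conv_def
    proof (intro sum.cong refl)
      fix t assume t: "t \<in> T"
      have "chi (u - t) = chi (- t)"
        using that by (intro chi_cong) (simp add: cong_iff_dvd_diff)
      moreover have "int q dvd t \<longleftrightarrow> t = 0"
        using t by (auto dest: zdvd_imp_le)
      ultimately show "chi t * cnj (chi (u - t)) = (if t = 0 then 0 else 1)"
        using chi_mult_cnj[of t] by (auto simp: chi_neg) (simp add: chi_def)
    qed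
    also have "\<dots> = (\<Sum>t\<in>T. 1 - (if t = 0 then 1 else 0))"
      by (intro sum.cong) auto
    also have "\<dots> = of_nat q - 1"
      using q_gt_1 by (simp add: sum_subtractf)
    finally show ?thesis .
  qed
  have scale: "?c u = ?c 1" if "\<not> int q dvd u" for u
  proof -
    have one: "\<not> int q dvd 1" using q_gt_1 by simp
    have "?c u = (\<Sum>t\<in>T. (chi u * cnj (chi u)) * (chi t * cnj (chi (1 - t))))"
      by (subst conv_scale[OF _ _ that]) (simp_all add: chi_mult mult_ac)
    also have "\<dots> = ?c 1"
      using chi_mult_cnj[OF that] by (simp add: conv_def)
    finally show ?thesis .
  qed
  have "(\<Sum>u\<in>T. ?c u) = (\<Sum>t\<in>T. chi t * (\<Sum>u\<in>T. cnj (chi (u - t))))"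
    unfolding conv_def by (subst sum.swap) (simp add: sum_distrib_left)
  also have "\<dots> = 0"
  proof (intro sum.neutral ballI)
    fix t
    have "(\<Sum>u\<in>T. cnj (chi (u - t))) = (\<Sum>u\<in>T. cnj (chi u))"
      by (rule sum_residues[of "\<lambda>u. cnj (chi u)" "\<lambda>u. u - t"]) auto
    then show "chi t * (\<Sum>u\<in>T. cnj (chi (u - t))) = 0"
      by (simp add: sum_cnj_chi)
  qed
  also have "(\<Sum>u\<in>T. ?c u) = (\<Sum>u\<in>T. (if u = 0 then of_nat q - 1 - ?c 1 else 0) + ?c 1)"
  proof (intro sum.cong refl)
    fix u assume u: "u \<in> T"
    have "int q dvd u \<longleftrightarrow> u = 0"
      using u by (auto dest: zdvd_imp_le)
    then show "?c u = (if u = 0 then of_nat q - 1 - ?c 1 else 0) + ?c 1"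
      using zero[of u] scale[of u] by auto
  qed
  also have "\<dots> = of_nat q - 1 - ?c 1 + of_nat q * ?c 1"
    using q_gt_1 by (simp add: sum.distrib)
  finally have "(of_nat q - 1) * (1 + ?c 1) = 0"
    by (simp add: algebra_simps)
  moreover have "(of_nat q - 1 :: eis) \<noteq> 0"
    using q_gt_1 by (auto dest: arg_cong[of _ _ ere])
  ultimately have "?c 1 = - 1"
    by (metis add_eq_0_iff mult_eq_0_iff)
  then show ?thesis
    using zero[of u] scale[of u] by (auto simp: delta_def)
qed

text \<open>The constant part of \<open>delta\<close> only sees the sum of \<open>h\<close>; on
  functions with sum 0, among them both characters, \<open>delta\<close> therefore acts as
  multiplication by \<open>q\<close>.\<close>

lemma conv_delta:
  assumes "\<And>t. h (t mod int q) = h t" "(\<Sum>t\<in>T. h t) = 0"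
  shows "conv delta h u = of_nat q * h u"
proof -
  have "conv delta h u = (\<Sum>t\<in>T. (if t = 0 then of_nat q * h u else 0) - h (u - t))"
    unfolding conv_def
  proof (intro sum.cong refl)
    fix t assume t: "t \<in> T"
    have "int q dvd t \<longleftrightarrow> t = 0"
      using t by (auto dest: zdvd_imp_le)
    then show "delta t * h (u - t) = (if t = 0 then of_nat q * h u else 0) - h (u - t)"
      by (simp add: delta_def algebra_simps)
  qed
  also have "\<dots> = of_nat q * h u - (\<Sum>t\<in>T. h (u - t))"
    using q_gt_1 by (simp add: sum_subtractf)
  also have "(\<Sum>t\<in>T. h (u - t)) = (\<Sum>t\<in>T. h t)"
    by (rule sum_residues[of h "\<lambda>t. u - t"]) (simp_all add: assms(1) dvd_diff_commute)
  finally show ?thesis using assms(2) by simp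
qed

abbreviation G where "G \<equiv> P chi"
abbreviation G' where "G' \<equiv> P (\<lambda>t. cnj (chi t))"

lemma G_G: "idcong M b (G * G) (smult jac G')"
proof -
  have "conv chi chi = (\<lambda>u. jac * cnj (chi u))"
    by (simp add: conv_chi_chi fun_eq_iff)
  then show ?thesis
    using P_mult[of chi b chi] by (simp add: P_smult)
qed

lemma G_G': "idcong M b (G * G') (P delta)"
proof -
  have "conv chi (\<lambda>t. cnj (chi t)) = delta"
    by (simp add: conv_chi_cnj fun_eq_iff)
  then show ?thesis
    using P_mult[of "\<lambda>t. cnj (chi t)" b chi] by simp
qed

lemma P_delta_mult:
  assumes "\<And>t. h (t mod int q) = h t" "(\<Sum>t\<in>T. h t) = 0"
  shows "idcong M b (P delta * P h) (smult (of_nat q) (P h))"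
proof -
  have "conv delta h = (\<lambda>u. of_nat q * h u)"
    using conv_delta[OF assms] by (simp add: fun_eq_iff)
  then show ?thesis
    using P_mult[of h b delta] assms(1) by (simp add: P_smult)
qed

lemmas delta_G = P_delta_mult[of chi, OF chi_mod sum_chi]
  and delta_G' = P_delta_mult[of "\<lambda>t. cnj (chi t)", OF cnj_chi_mod sum_cnj_chi]

lemma G'_G': "idcong M b (G' * G') (smult (cnj jac) G)"
proof -
  have "conv (\<lambda>t. cnj (chi t)) (\<lambda>t. cnj (chi t)) u = cnj (conv chi chi u)" for u
    by (simp add: conv_def cnj_sum)
  then have "conv (\<lambda>t. cnj (chi t)) (\<lambda>t. cnj (chi t)) = (\<lambda>u. cnj jac * chi u)"
    by (simp add: conv_chi_chi fun_eq_iff)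
  then show ?thesis
    using P_mult[of "\<lambda>t. cnj (chi t)" b "\<lambda>t. cnj (chi t)"] by (simp add: P_smult)
qed

lemma G_cubed: "idcong M b (G ^ 3) (smult jac (P delta))"
proof -
  have "idcong M b (G * (G * G)) (G * smult jac G')"
    by (intro idcong_mult G_G idcong_refl)
  also have "G * smult jac G' = smult jac (G * G')" by simp
  also have "idcong M b \<dots> (smult jac (P delta))"
    by (intro idcong_smult G_G')
  finally show ?thesis by (simp add: power3_eq_cube mult.assoc)
qed

text \<open>The spare factor \<open>G\<close> comes from a function with sum 0, so it turns each
  \<open>P delta\<close> supplied by \<open>G_cubed\<close> into the scalar
  \<open>q\<close>.\<close>

lemma G_power: "idcong M b (G ^ (3 * n) * G) (smult ((of_nat q * jac) ^ n) G)"
proof (induction n)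
  case (Suc n)
  have "G ^ (3 * Suc n) * G = G ^ 3 * (G ^ (3 * n) * G)"
    by (simp add: power_add)
  also have "idcong M b \<dots> (smult jac (P delta) * smult ((of_nat q * jac) ^ n) G)"
    by (intro idcong_mult G_cubed Suc)
  also have "\<dots> = smult (jac * (of_nat q * jac) ^ n) (P delta * G)"
    by (simp add: mult.commute)
  also have "idcong M b \<dots> (smult (jac * (of_nat q * jac) ^ n) (smult (of_nat q) G))"
    by (intro idcong_smult delta_G)
  finally show ?case by (simp add: mult_ac)
qed simp

text \<open>Grouping the factors of \<open>G * G * G' * G'\<close> in two ways yields
  \<open>jac * cnj jac\<close> and \<open>q\<close> as multiples of \<open>P delta\<close>. Taking 0
  as second generator makes the comparison at exponent 1 an equality.\<close>

lemma jac_norm: "nrm jac = int q"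
proof -
  have "idcong M [:0:] ((G * G) * (G' * G')) (smult jac G' * smult (cnj jac) G)"
    by (intro idcong_mult G_G G'_G')
  also have "\<dots> = smult (jac * cnj jac) (G * G')" by (simp add: mult_ac)
  also have "idcong M [:0:] \<dots> (smult (jac * cnj jac) (P delta))"
    by (intro idcong_smult G_G')
  finally have 1: "idcong M [:0:] ((G * G) * (G' * G')) (P (\<lambda>t. jac * cnj jac * delta t))"
    by (simp add: P_smult)
  have "(G * G) * (G' * G') = G * G' * G' * G" by (simp add: mult_ac)
  also have "idcong M [:0:] \<dots> (P delta * G' * G)"
    by (intro idcong_mult G_G' idcong_refl)
  also have "idcong M [:0:] \<dots> (smult (of_nat q) G' * G)"
    by (intro idcong_mult delta_G' idcong_refl)
  also have "smult (of_nat q) G' * G = smult (of_nat q) (G * G')" by (simp add: mult.commute)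
  also have "idcong M [:0:] \<dots> (smult (of_nat q) (P delta))"
    by (intro idcong_smult G_G')
  finally have 2: "idcong M [:0:] ((G * G) * (G' * G')) (P (\<lambda>t. of_nat q * delta t))"
    by (simp add: P_smult)
  have "idcong M [:0:] (P (\<lambda>t. jac * cnj jac * delta t)) (P (\<lambda>t. of_nat q * delta t))"
    by (rule idcong_trans[OF idcong_sym[OF 1] 2])
  then have "0 dvd jac * cnj jac * delta 1 - of_nat q * delta 1"
    by (rule idcong_P_D)
  moreover have "delta 1 = - 1" using q_gt_1 by (simp add: delta_def)
  ultimately have "of_int (nrm jac) = (of_nat q :: eis)"
    by (simp add: mult_cnj)
  then show ?thesis by (auto dest: arg_cong[of _ _ ere])
qed

text \<open>Modulo 3 the cube of the Gauss sum belongs to chi^3, the trivial character, whereas it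
  also equals \<open>jac\<close> times \<open>P delta\<close>. At exponent 1 this says that
  \<open>jac\<close> is -1 modulo 3.\<close>

lemma jac_primary: "3 dvd eim jac"
proof -
  have om_cubes: "(om ^ i) ^ 3 = 1" for i
    by (metis mult.commute om_cube power_mult power_one)
  have "idcong M [:of_nat 3:] (G ^ 3) (P (\<lambda>t. if int q dvd t then 0 else 1))"
  proof (rule P_frobenius)
    show "(if int q dvd int 3 * t then 0 else 1) = chi t ^ 3" for t
    proof -
      have "int q dvd 3 * t \<longleftrightarrow> int q dvd t"
        using not_dvd_3 prime_int_q by (simp add: prime_dvd_mult_iff)
      then show ?thesis
        by (simp add: chi_def om_cubes)
    qed
  qed (use q_ne_3 in \<open>auto simp: dvd_mod_iff\<close>)
  moreover have "idcong M [:of_nat 3:] (G ^ 3) (P (\<lambda>t. jac * delta t))"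
    using G_cubed by (simp add: P_smult)
  ultimately have "idcong M [:of_nat 3:] (P (\<lambda>t. jac * delta t)) (P (\<lambda>t. if int q dvd t then 0 else 1))"
    by (meson idcong_sym idcong_trans)
  from idcong_P_D[OF this] have "of_nat 3 dvd - jac - 1"
    using q_gt_1 by (simp add: delta_def)
  then have "of_int 3 dvd - jac - 1" by simp
  then show ?thesis unfolding of_int_dvd_eis by simp
qed

text \<open>Two evaluations of \<open>G ^ l\<close>: Frobenius reproduces \<open>G\<close> twisted
  by \<open>cnj (chi l)\<close>, while \<open>G_power\<close> produces the scalar (q jac)^n.\<close>

lemma jac_law_1:
  assumes "prime l" "l \<noteq> q" "l = 3 * n + 1"
  shows "of_nat l dvd (of_nat q * jac) ^ n - cnj (chi (int l))"
proof -
  have l: "\<not> int q dvd int l"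
    using assms(1,2) prime_q by (auto dest: primes_dvd_imp_eq)
  have "idcong M [:of_nat l:] (G ^ l) (P (\<lambda>t. cnj (chi (int l)) * chi t))"
  proof (rule P_frobenius)
    fix t
    have "cnj (chi (int l)) * chi (int l * t) = chi t"
      using chi_mult_cnj[OF l] by (simp add: chi_mult mult_ac)
    also have "\<dots> = chi t ^ l"
      using chi_power_cong[of 1 l t] assms(3) by (simp add: cong_def)
    finally show "cnj (chi (int l)) * chi (int l * t) = chi t ^ l" .
  qed (use assms in auto)
  moreover have "idcong M [:of_nat l:] (G ^ l) (P (\<lambda>t. (of_nat q * jac) ^ n * chi t))"
  proof -
    have "G ^ l = G ^ (3 * n) * G"
      using assms(3) by (simp add: mult.commute)
    then show ?thesis
      using G_power[of "[:of_nat l:]" n] by (simp only: P_smult)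
  qed
  ultimately have "idcong M [:of_nat l:] (P (\<lambda>t. (of_nat q * jac) ^ n * chi t))
      (P (\<lambda>t. cnj (chi (int l)) * chi t))"
    by (meson idcong_sym idcong_trans)
  from idcong_P_D[OF this] show ?thesis by simp
qed

text \<open>Now Frobenius replaces the character by its conjugate, so the comparison is made against
  \<open>G'\<close>; the two factors \<open>G\<close> left over from \<open>G ^ (3 * n)\<close>
  combine to \<open>jac\<close> times \<open>G'\<close>.\<close>

lemma jac_law_2:
  assumes "prime l" "l \<noteq> q" "l = 3 * n + 2"
  shows "of_nat l dvd (of_nat q * jac) ^ n * jac - chi (int l)"
proof -
  have l: "\<not> int q dvd int l"
    using assms(1,2) prime_q by (auto dest: primes_dvd_imp_eq)
  have "idcong M [:of_nat l:] (G ^ l) (P (\<lambda>t. chi (int l) * cnj (chi t)))"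
  proof (rule P_frobenius)
    fix t
    have "chi (int l) * cnj (chi (int l * t)) = cnj (chi t)"
      using chi_mult_cnj[OF l] by (simp add: chi_mult flip: mult.assoc)
    also have "\<dots> = chi t ^ 2"
      by (simp add: power2_eq_square chi_square)
    also have "\<dots> = chi t ^ l"
      using assms(3) by (intro chi_power_cong) (auto simp: cong_def mod_Suc)
    finally show "chi (int l) * cnj (chi (int l * t)) = chi t ^ l" .
  qed (use assms in auto)
  moreover have "idcong M [:of_nat l:] (G ^ l) (P (\<lambda>t. (of_nat q * jac) ^ n * jac * cnj (chi t)))"
  proof -
    have "G ^ l = G ^ (3 * n) * G * G"
      using assms(3) by (simp add: power2_eq_square mult_ac)
    also have "idcong M [:of_nat l:] \<dots> (smult ((of_nat q * jac) ^ n) G * G)"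
      by (intro idcong_mult G_power idcong_refl)
    also have "\<dots> = smult ((of_nat q * jac) ^ n) (G * G)" by simp
    also have "idcong M [:of_nat l:] \<dots> (smult ((of_nat q * jac) ^ n) (smult jac G'))"
      by (intro idcong_smult G_G)
    finally show ?thesis by (simp add: P_smult)
  qed
  ultimately have "idcong M [:of_nat l:] (P (\<lambda>t. (of_nat q * jac) ^ n * jac * cnj (chi t)))
      (P (\<lambda>t. chi (int l) * cnj (chi t)))"
    by (meson idcong_sym idcong_trans)
  from idcong_P_D[OF this] show ?thesis by simp
qed

text \<open>This decides which of the two primes above \<open>q\<close> contains \<open>jac\<close>.
  Replacing \<open>om\<close> by \<open>w\<close> turns \<open>chi t\<close> into t^k, hence
  \<open>jac\<close> into the sum of t^k (1 - t)^k. The exponents that occur are at most 2 k < q -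
  1, so every power sum vanishes modulo \<open>q\<close>.\<close>

lemma jac_root: "int q dvd ere jac + eim jac * w"
proof -
  define ev where "ev z = ere z + eim z * w" for z
  have ev_add: "ev (sum f A) = (\<Sum>t\<in>A. ev (f t))" for f and A :: "int set"
    by (induction A rule: infinite_finite_induct) (auto simp: ev_def algebra_simps)
  have ev_mult: "[ev (x * y) = ev x * ev y] (mod int q)" for x y
  proof -
    have "ev x * ev y - ev (x * y) = (w\<^sup>2 + w + 1) * (eim x * eim y)"
      by (simp add: ev_def algebra_simps power2_eq_square)
    then show ?thesis using root by (metis cong_iff_dvd_diff cong_sym dvd_mult2)
  qed
  have "[ev (om ^ i) = w ^ i] (mod int q)" for i
  proof (induction i)
    case (Suc i)
    have "[ev (om * om ^ i) = ev om * ev (om ^ i)] (mod int q)" by (rule ev_mult)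
    moreover have "[ev om * ev (om ^ i) = w * w ^ i] (mod int q)"
      using Suc by (intro cong_mult) (simp_all add: ev_def)
    ultimately show ?case by (metis cong_trans power_Suc)
  qed (simp add: ev_def)
  note ev_om = this
  have ev_chi: "[ev (chi t) = t ^ k] (mod int q)" for t
  proof (cases "int q dvd t")
    case True
    then have "int q dvd t ^ k" using k_pos by (simp add: dvd_power_iff_le dvd_trans[OF True dvd_power])
    then show ?thesis using True by (simp add: chi_def ev_def cong_iff_dvd_diff)
  next
    case False
    then have "[ev (chi t) = w ^ idx t] (mod int q)"
      using ev_om by (simp add: chi_def)
    then show ?thesis using idx[OF False] cong_sym cong_trans by blast
  qed
  have "[ev jac = (\<Sum>t\<in>T. t ^ k * (1 - t) ^ k)] (mod int q)"
    unfolding jac_def ev_add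
    by (intro cong_sum cong_trans[OF ev_mult] cong_mult ev_chi)
  also have "(\<Sum>t\<in>T. t ^ k * (1 - t) ^ k) =
      (\<Sum>t\<in>T. \<Sum>i\<le>k. (int (k choose i) * (- 1) ^ i) * t ^ (k + i))"
  proof (intro sum.cong refl)
    fix t :: int
    have "(1 - t) ^ k = (\<Sum>i\<le>k. of_nat (k choose i) * (- t) ^ i * 1 ^ (k - i))"
      using binomial_ring[of "- t" 1 k] by simp
    then show "t ^ k * (1 - t) ^ k = (\<Sum>i\<le>k. (int (k choose i) * (- 1) ^ i) * t ^ (k + i))"
      by (simp add: sum_distrib_left power_add power_minus[of t] mult_ac)
  qed
  also have "\<dots> = (\<Sum>i\<le>k. (int (k choose i) * (- 1) ^ i) * (\<Sum>t\<in>T. t ^ (k + i)))"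
    by (subst sum.swap) (simp add: sum_distrib_left)
  also have "[\<dots> = 0] (mod int q)"
    unfolding cong_0_iff
    by (intro dvd_sum dvd_mult sum_powers) (use k_pos in auto)
  finally show ?thesis by (simp add: cong_0_iff ev_def)
qed

end

section \<open>The cubic residue symbol of an Eisenstein integer\<close>

text \<open>Here \<open>\<omega> ^ f t\<close> is the cubic residue symbol of the rational integer \<open>t\<close> modulo \<open>\<alpha>\<close>.\<close>

locale cubic_index =
  fixes \<alpha> :: eis and f :: "int \<Rightarrow> nat"
  assumes mult: "coprime s (nrm \<alpha>) \<Longrightarrow> coprime t (nrm \<alpha>) \<Longrightarrow> [f (s * t) = f s + f t] (mod 3)"
    and periodic: "[s = t] (mod nrm \<alpha>) \<Longrightarrow> f s = f t"
    and omega: "nrm \<alpha> dvd ere \<alpha> + eim \<alpha> * w \<Longrightarrow> [f w = nat ((nrm \<alpha> - 1) div 3)] (mod 3)"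
    and law_1: "prime l \<Longrightarrow> \<not> int l dvd nrm \<alpha> \<Longrightarrow> l = 3 * n + 1 \<Longrightarrow>
      dcong (of_nat l) ((of_int (nrm \<alpha>) * \<alpha>) ^ n) (om ^ (2 * f (int l)))"
    and law_2: "prime l \<Longrightarrow> \<not> int l dvd nrm \<alpha> \<Longrightarrow> l = 3 * n + 2 \<Longrightarrow>
      dcong (of_nat l) ((of_int (nrm \<alpha>) * \<alpha>) ^ n * \<alpha>) (om ^ f (int l))"

text \<open>The sign stays free, as -1 is a cube. Coprime coordinates exclude rational factors, so
  every class modulo \<alpha> contains a rational integer and a function on integers can represent
  the symbol.\<close>

definition primary :: "eis \<Rightarrow> bool" where
  "primary \<alpha> \<longleftrightarrow> 3 dvd eim \<alpha> \<and> coprime (ere \<alpha>) (eim \<alpha>)"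

lemma primary_not_3_dvd: "primary \<alpha> \<Longrightarrow> \<not> 3 dvd ere \<alpha>"
  unfolding primary_def using coprime_common_divisor[of "ere \<alpha>" "eim \<alpha>" 3] by auto

lemma primary_nrm_pos: "primary \<alpha> \<Longrightarrow> nrm \<alpha> > 0"
proof -
  assume "primary \<alpha>"
  then have "\<alpha> \<noteq> 0" using primary_not_3_dvd by fastforce
  then show ?thesis using nrm_nonneg nrm_eq_0 by (metis order_le_less)
qed

lemma primary_nrm_not_3_dvd: "primary \<alpha> \<Longrightarrow> \<not> 3 dvd nrm \<alpha>"
proof
  assume \<alpha>: "primary \<alpha>" and 1: "3 dvd nrm \<alpha>"
  have 2: "3 dvd ere \<alpha> * eim \<alpha> - (eim \<alpha>)\<^sup>2"
    using \<alpha> by (simp add: primary_def power2_eq_square)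
  have "3 dvd nrm \<alpha> + (ere \<alpha> * eim \<alpha> - (eim \<alpha>)\<^sup>2)" by (rule dvd_add[OF 1 2])
  then have "3 dvd (ere \<alpha>)\<^sup>2" by (simp add: nrm_def)
  moreover have "prime (3::int)" by simp
  ultimately have "3 dvd ere \<alpha>" using prime_dvd_power by blast
  then show False using primary_not_3_dvd[OF \<alpha>] by simp
qed

lemma dvd_nrm_not_dvd_eim:
  assumes "coprime (ere \<alpha>) (eim \<alpha>)" "prime q" "q dvd nrm \<alpha>"
  shows "\<not> q dvd eim \<alpha>"
proof
  assume e: "q dvd eim \<alpha>"
  have "q dvd nrm \<alpha> + (ere \<alpha> * eim \<alpha> - (eim \<alpha>)\<^sup>2)"
    using assms(3) e by (intro dvd_add dvd_diff) (auto simp: power2_eq_square)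
  then have "q dvd (ere \<alpha>)\<^sup>2" by (simp add: nrm_def)
  then have "q dvd ere \<alpha>" using assms(2) prime_dvd_power by blast
  then have "is_unit q" using e assms(1) coprime_common_divisor by blast
  then show False using assms(2) not_prime_unit by blast
qed

lemma coprime_eim_nrm:
  assumes "coprime (ere \<alpha>) (eim \<alpha>)"
  shows "coprime (eim \<alpha>) (nrm \<alpha>)"
proof (rule coprimeI)
  fix r assume r: "r dvd eim \<alpha>" "r dvd nrm \<alpha>"
  have "r dvd nrm \<alpha> + eim \<alpha> * (ere \<alpha> - eim \<alpha>)"
    using r by (intro dvd_add dvd_mult2)
  then have "r dvd (ere \<alpha>)\<^sup>2" by (simp add: nrm_def algebra_simps power2_eq_square)
  moreover have "coprime ((ere \<alpha>)\<^sup>2) (eim \<alpha>)" using assms by simp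
  ultimately show "is_unit r" using r(1) coprime_common_divisor by blast
qed

lemma root_exists:
  assumes "coprime (eim \<alpha>) n"
  obtains w where "n dvd ere \<alpha> + eim \<alpha> * w"
proof -
  obtain c where c: "[eim \<alpha> * c = 1] (mod n)"
    using assms cong_solve_coprime_int by blast
  then have "[ere \<alpha> + eim \<alpha> * (- ere \<alpha> * c) = ere \<alpha> - ere \<alpha> * 1] (mod n)"
    using cong_diff[OF cong_refl cong_scalar_left[OF c, of "ere \<alpha>"], of "ere \<alpha>"] by (simp add: mult_ac)
  then show ?thesis using that[of "- ere \<alpha> * c"] by (simp add: cong_0_iff)
qed

lemma root_quadratic:
  assumes "n dvd ere \<alpha> + eim \<alpha> * w" "n dvd nrm \<alpha>" "coprime (eim \<alpha>) n"
  shows "n dvd w\<^sup>2 + w + 1"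
proof -
  obtain c where c: "ere \<alpha> + eim \<alpha> * w = n * c" using assms(1) by blast
  have "(eim \<alpha>)\<^sup>2 * (w\<^sup>2 + w + 1) =
      (ere \<alpha> + eim \<alpha> * w) * (eim \<alpha> * w + eim \<alpha> - ere \<alpha>) + nrm \<alpha>"
    by (simp add: nrm_def algebra_simps power2_eq_square)
  then have "n dvd (eim \<alpha>)\<^sup>2 * (w\<^sup>2 + w + 1)"
    using assms(1,2) by (metis dvd_add dvd_mult2)
  moreover have "coprime n ((eim \<alpha>)\<^sup>2)" using assms(3) by (simp add: coprime_commute)
  ultimately show ?thesis using coprime_dvd_mult_right_iff by blast
qed

lemma om_power_eq_1: "[i = 0] (mod 3) \<Longrightarrow> om ^ i = 1"
  using om_power_cong[of i 0] by simp

text \<open>The sign of \<alpha> is invisible: for odd \<open>l\<close> the total exponent of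
  \<alpha> in either law is even, and for l = 2 the signs coincide modulo \<open>l\<close>.\<close>

lemma cubic_index_unit:
  assumes "ere \<alpha> = 1 \<or> ere \<alpha> = - 1" "eim \<alpha> = 0"
  shows "cubic_index \<alpha> (\<lambda>_. 0)"
proof -
  have \<alpha>: "\<alpha> = 1 \<or> \<alpha> = - 1"
    using assms by (auto intro: eis_eqI)
  have even_power: "\<alpha> ^ n = 1" if "even n" for n
    using \<alpha> that by auto
  have nrm: "nrm \<alpha> = 1" using assms by (auto simp: nrm_def)
  show ?thesis
  proof
    fix l n :: nat assume l: "prime l" "l = 3 * n + 1"
    have "l \<noteq> 2" using l(2) by presburger
    then have "odd l" using l(1) primes_dvd_imp_eq[of 2 l] by auto
    then have "even n" using l(2) by simp
    then show "dcong (of_nat l) ((of_int (nrm \<alpha>) * \<alpha>) ^ n) (om ^ (2 * 0))"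
      by (simp add: nrm even_power)
  next
    fix l n :: nat assume l: "prime l" "l = 3 * n + 2"
    show "dcong (of_nat l) ((of_int (nrm \<alpha>) * \<alpha>) ^ n * \<alpha>) (om ^ 0)"
    proof (cases "l = 2")
      case True
      then have "n = 0" using l by simp
      moreover have "of_int 2 dvd \<alpha> - 1" unfolding of_int_dvd_eis using assms by auto
      ultimately show ?thesis using True by (simp add: dcong_iff)
    next
      case False
      then have "odd l" using l(1) primes_dvd_imp_eq[of 2 l] by auto
      then have "even (n + 1)" using l(2) by simp
      then have "\<alpha> ^ (n + 1) = 1" by (rule even_power)
      then show ?thesis by (simp add: nrm mult.commute)
    qed
  qed (simp_all add: nrm)
qed

lemma nrm_one_cases:
  assumes "nrm \<alpha> = 1" "3 dvd eim \<alpha>"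
  shows "ere \<alpha> = 1 \<or> ere \<alpha> = - 1" "eim \<alpha> = 0"
proof -
  obtain b where b: "eim \<alpha> = 3 * b" using assms(2) by blast
  have "27 * b\<^sup>2 \<le> 4"
    using nrm_4[of \<alpha>] assms(1) b by (simp add: power_mult_distrib) (smt (verit) zero_le_power2)
  then have "b\<^sup>2 \<le> 0" by linarith
  then have b0: "b = 0" by simp
  then show "eim \<alpha> = 0" using b by simp
  then have "(ere \<alpha>)\<^sup>2 = 1" using assms(1) by (simp add: nrm_def)
  then show "ere \<alpha> = 1 \<or> ere \<alpha> = - 1" by (simp add: power2_eq_1_iff)
qed

text \<open>
  Jacobi sums are primary primes, so splitting one off at a time replaces unique factorization.
\<close>

lemma cubic_index_mult:
  assumes "cubic_residues q w" "primary \<alpha>" "\<alpha> = cubic_residues.jac q w * \<beta>"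
    and "cubic_index \<beta> f" "int q dvd ere \<alpha> + eim \<alpha> * w"
  shows "cubic_index \<alpha> (\<lambda>t. cubic_residues.idx q w t + f t)"
proof -
  interpret cubic_residues q w by fact
  interpret \<beta>: cubic_index \<beta> f by fact
  have nrm: "nrm \<alpha> = int q * nrm \<beta>"
    by (simp add: assms(3) nrm_mult jac_norm)
  have cop: "\<not> int q dvd s" if "coprime s (nrm \<alpha>)" for s
    using that prime_int_q coprime_common_divisor[of s "nrm \<alpha>" "int q"] unfolding nrm by auto
  have cop': "coprime s (nrm \<beta>)" if "coprime s (nrm \<alpha>)" for s
    using that unfolding nrm by simp
  have qeim: "\<not> int q dvd eim \<alpha>"
    using dvd_nrm_not_dvd_eim[of \<alpha> "int q"] assms(2) prime_int_q by (simp add: primary_def nrm)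
  show ?thesis
  proof
    fix s t assume "coprime s (nrm \<alpha>)" "coprime t (nrm \<alpha>)"
    then have "[idx (s * t) + f (s * t) = (idx s + idx t) + (f s + f t)] (mod 3)"
      by (intro cong_add idx_mult \<beta>.mult cop cop')
    then show "[idx (s * t) + f (s * t) = idx s + f s + (idx t + f t)] (mod 3)"
      by (simp add: add_ac)
  next
    fix s t assume st: "[s = t] (mod nrm \<alpha>)"
    then have "[s = t] (mod int q)" "[s = t] (mod nrm \<beta>)"
      unfolding nrm cong_iff_dvd_diff by (rule dvd_mult_left, rule dvd_mult_right)
    then show "idx s + f s = idx t + f t"
      using idx_cong \<beta>.periodic by auto
  next
    fix v assume v: "nrm \<alpha> dvd ere \<alpha> + eim \<alpha> * v"
    have cn: "coprime (eim \<alpha>) (nrm \<alpha>)"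
      using assms(2) by (intro coprime_eim_nrm) (simp add: primary_def)
    have quad: "nrm \<alpha> dvd v\<^sup>2 + v + 1"
      by (rule root_quadratic[OF v dvd_refl cn])
    have "int q dvd ere \<alpha> + eim \<alpha> * v"
      using v unfolding nrm by (rule dvd_mult_left)
    then have "int q dvd (ere \<alpha> + eim \<alpha> * v) - (ere \<alpha> + eim \<alpha> * w)"
      using assms(5) by (rule dvd_diff)
    then have "int q dvd eim \<alpha> * (v - w)" by (simp add: algebra_simps)
    then have vw: "[v = w] (mod int q)"
      using qeim prime_int_q by (simp add: prime_dvd_mult_iff cong_iff_dvd_diff)
    \<comment> \<open>For t = w the defining relation t^k = w^(idx t) holds with exponent
      \<open>k\<close> itself.\<close>
    have "[idx w = k] (mod 3)"
    proof (rule idx_unique)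
      show "\<not> int q dvd w"
        using coprime_w prime_int_q coprime_common_divisor[of w "int q" "int q"] by auto
    qed simp
    then have 1: "[idx v = k] (mod 3)" using idx_cong[OF vw] by simp
    \<comment> \<open>As q = \<open>jac * cnj jac\<close>, q \<beta> is
      \<open>cnj jac * \<alpha>\<close>. Replacing \<open>om\<close> by \<open>v\<close> is
      multiplicative up to multiples of v^2 + v + 1, which \<open>nrm \<alpha>\<close> divides; so
      the relation for \<alpha> passes to q \<beta>, and \<open>q\<close> cancels from
      \<open>nrm \<alpha>\<close>.\<close>
    have "int q * nrm \<beta> dvd int q * (ere \<beta> + eim \<beta> * v)"
    proof -
      define ev where "ev z = ere z + eim z * v" for z
      have "of_nat q * \<beta> = cnj jac * \<alpha>"
        using mult_cnj[of jac] by (simp add: assms(3) jac_norm mult_ac)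
      moreover have "ev (of_nat q * \<beta>) = int q * (ere \<beta> + eim \<beta> * v)"
        by (simp add: ev_def algebra_simps)
      moreover have "ev (cnj jac * \<alpha>) = ev (cnj jac) * ev \<alpha> - (v\<^sup>2 + v + 1) * (eim (cnj jac) * eim \<alpha>)"
        by (simp add: ev_def algebra_simps power2_eq_square)
      moreover have "nrm \<alpha> dvd ev (cnj jac) * ev \<alpha> - (v\<^sup>2 + v + 1) * (eim (cnj jac) * eim \<alpha>)"
        using dvd_mult[OF v] dvd_mult2[OF quad] unfolding ev_def by (intro dvd_diff)
      ultimately show ?thesis unfolding nrm[symmetric] by simp
    qed
    then have "nrm \<beta> dvd ere \<beta> + eim \<beta> * v"
      using q_gt_1 by simp
    then have 2: "[f v = nat ((nrm \<beta> - 1) div 3)] (mod 3)" by (rule \<beta>.omega)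
    have b: "nrm \<beta> mod 3 = 1"
    proof -
      have "(ere \<alpha>)\<^sup>2 mod 3 = 1"
      proof -
        have "ere \<alpha> mod 3 = 1 \<or> ere \<alpha> mod 3 = 2"
          using primary_not_3_dvd[OF assms(2)] by presburger
        then show ?thesis
          using mod_mult_eq[of "ere \<alpha>" 3 "ere \<alpha>"] by (auto simp: power2_eq_square)
      qed
      moreover have "nrm \<alpha> mod 3 = (ere \<alpha>)\<^sup>2 mod 3"
      proof -
        have "nrm \<alpha> - (ere \<alpha>)\<^sup>2 = eim \<alpha> * (eim \<alpha> - ere \<alpha>)"
          by (simp add: nrm_def algebra_simps power2_eq_square)
        then show ?thesis using assms(2) by (simp add: primary_def mod_eq_dvd_iff)
      qed
      ultimately have "(int q * nrm \<beta>) mod 3 = 1" by (simp add: nrm)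
      moreover have "int q mod 3 = 1" using q_mod_3 by presburger
      ultimately show ?thesis using mod_mult_left_eq[of "int q" 3 "nrm \<beta>"] by simp
    qed
    have pos: "nrm \<beta> > 0"
      using primary_nrm_pos[OF assms(2)] q_gt_1 unfolding nrm by (simp add: zero_less_mult_iff)
    define j where "j = nrm \<beta> div 3"
    have j: "nrm \<beta> = 3 * j + 1" "j \<ge> 0" using b pos unfolding j_def by presburger+
    \<comment> \<open>On norms congruent to 1 modulo 3 the quantity (N - 1) / 3 is additive modulo
      3; this matches the additivity of the indices.\<close>
    have "nrm \<alpha> = 3 * (3 * int k * j + int k + j) + 1"
    proof -
      have "int q = 3 * int k + 1" using q_eq by linarith
      then show ?thesis unfolding nrm j(1) by (simp only:) (simp add: algebra_simps)
    qed
    then have "nat ((nrm \<alpha> - 1) div 3) = nat (3 * int k * j + int k + j)" by (simp add: mult_ac)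
    also have "\<dots> = k + nat j + 3 * (k * nat j)"
      using j(2) by (simp add: nat_add_distrib nat_mult_distrib)
    finally have "[k + nat j = nat ((nrm \<alpha> - 1) div 3)] (mod 3)"
      by (simp add: cong_def)
    moreover have "[idx v + f v = k + nat j] (mod 3)"
      using 1 2 j by (intro cong_add) auto
    ultimately show "[idx v + f v = nat ((nrm \<alpha> - 1) div 3)] (mod 3)"
      by (rule cong_trans[rotated])
  next
    fix l n :: nat assume l: "prime l" "\<not> int l dvd nrm \<alpha>" "l = 3 * n + 1"
    have lq: "l \<noteq> q" "\<not> int l dvd nrm \<beta>"
      using l(2) unfolding nrm by auto
    then have "\<not> q dvd l"
      using primes_dvd_imp_eq[OF prime_q l(1)] by auto
    then have lq3: "\<not> int q dvd int l" by simp
    have "(of_int (nrm \<alpha>) * \<alpha>) ^ n = (of_nat q * jac) ^ n * (of_int (nrm \<beta>) * \<beta>) ^ n"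
      unfolding power_mult_distrib[symmetric] nrm by (subst assms(3)) (simp add: mult_ac)
    also have "dcong (of_nat l) \<dots> (cnj (chi (int l)) * om ^ (2 * f (int l)))"
      using jac_law_1[OF l(1) lq(1) l(3)] \<beta>.law_1[OF l(1) lq(2) l(3)]
      by (intro idcong_mult) (auto simp: dcong_iff)
    also have "cnj (chi (int l)) = om ^ (2 * idx (int l))"
      using lq3 by (simp add: chi_def cnj_om flip: power_mult)
    finally show "dcong (of_nat l) ((of_int (nrm \<alpha>) * \<alpha>) ^ n) (om ^ (2 * (idx (int l) + f (int l))))"
      by (simp add: power_add algebra_simps)
  next
    fix l n :: nat assume l: "prime l" "\<not> int l dvd nrm \<alpha>" "l = 3 * n + 2"
    have lq: "l \<noteq> q" "\<not> int l dvd nrm \<beta>"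
      using l(2) unfolding nrm by auto
    then have "\<not> q dvd l"
      using primes_dvd_imp_eq[OF prime_q l(1)] by auto
    then have lq3: "\<not> int q dvd int l" by simp
    have "(of_int (nrm \<alpha>) * \<alpha>) ^ n * \<alpha> =
        ((of_nat q * jac) ^ n * jac) * ((of_int (nrm \<beta>) * \<beta>) ^ n * \<beta>)"
    proof -
      have "(of_int (nrm \<alpha>) * \<alpha>) ^ n = (of_nat q * jac) ^ n * (of_int (nrm \<beta>) * \<beta>) ^ n"
        unfolding power_mult_distrib[symmetric] nrm by (subst assms(3)) (simp add: mult_ac)
      then show ?thesis by (simp add: assms(3) mult_ac)
    qed
    also have "dcong (of_nat l) \<dots> (chi (int l) * om ^ f (int l))"
      using jac_law_2[OF l(1) lq(1) l(3)] \<beta>.law_2[OF l(1) lq(2) l(3)]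
      by (intro idcong_mult) (auto simp: dcong_iff)
    also have "chi (int l) = om ^ idx (int l)"
      using lq3 by (simp add: chi_def)
    finally show "dcong (of_nat l) ((of_int (nrm \<alpha>) * \<alpha>) ^ n * \<alpha>) (om ^ (idx (int l) + f (int l)))"
      by (simp add: power_add)
  qed
qed

text \<open>For a prime \<open>q\<close> dividing the norm, \<alpha> and the Jacobi sum attached to
  the root \<open>w\<close> of \<alpha> lie in the same prime above \<open>q\<close>. So
  \<open>\<alpha> * cnj jac\<close> is divisible by q = \<open>jac * cnj jac\<close>, that is,
  \<open>jac\<close> divides \<alpha>, and the quotient is primary of smaller norm.\<close>

theorem cubic_index_exists:
  assumes "primary \<alpha>"
  shows "\<exists>f. cubic_index \<alpha> f"
  using assms
proof (induction "nat (nrm \<alpha>)" arbitrary: \<alpha> rule: less_induct)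
  case less
  note \<alpha> = \<open>primary \<alpha>\<close>
  show ?case
  proof (cases "nrm \<alpha> = 1")
    case True
    then show ?thesis
      using cubic_index_unit nrm_one_cases[of \<alpha>] \<alpha> by (auto simp: primary_def)
  next
    case False
    then have "nat (nrm \<alpha>) \<noteq> 1" using primary_nrm_pos[OF \<alpha>] by simp
    then obtain q where q: "prime q" "q dvd nat (nrm \<alpha>)"
      by (meson prime_factor_nat)
    then have qn: "int q dvd nrm \<alpha>" using primary_nrm_pos[OF \<alpha>] by (metis int_dvd_int_iff int_nat_eq order_less_imp_le)
    have qe: "\<not> int q dvd eim \<alpha>"
      using dvd_nrm_not_dvd_eim[of \<alpha> "int q"] \<alpha> q qn by (simp add: primary_def)
    then have cop: "coprime (eim \<alpha>) (int q)"
      using prime_imp_coprime[of "int q" "eim \<alpha>"] q by (simp add: coprime_commute)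
    obtain w where w: "int q dvd ere \<alpha> + eim \<alpha> * w"
      by (rule root_exists[OF cop])
    have "cubic_residues q w"
    proof
      show "q \<noteq> 3" using primary_nrm_not_3_dvd[OF \<alpha>] qn by auto
      show "int q dvd w\<^sup>2 + w + 1" by (rule root_quadratic[OF w qn cop])
    qed fact
    then interpret cubic_residues q w .
    let ?u = "ere jac" and ?v = "eim jac" and ?a = "ere \<alpha>" and ?b = "eim \<alpha>"
    obtain c where c: "?a + ?b * w = int q * c" using w by blast
    obtain d where d: "?u + ?v * w = int q * d" using jac_root by blast
    obtain e where e: "w\<^sup>2 + w + 1 = int q * e" using root by blast
    have a: "?a = int q * c - ?b * w" and u: "?u = int q * d - ?v * w"
      using c d by simp_all
    have "?b * ?u - ?a * ?v = int q * (?b * d - c * ?v)"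
      unfolding a u by (simp add: algebra_simps)
    then have "int q dvd ?b * ?u - ?a * ?v" by (rule dvdI)
    then have 1: "int q dvd eim (\<alpha> * cnj jac)"
      by (simp add: algebra_simps)
    \<comment> \<open>The last two products are 0 by the choice of \<open>c\<close> and
      \<open>d\<close>; with them the equation is a polynomial identity.\<close>
    have "?a * ?u - ?a * ?v + ?b * ?v =
        int q * (c * ?u - ?b * w * d - c * ?v) + ?b * ?v * (w\<^sup>2 + w + 1)
        + (?a + ?b * w - int q * c) * (?u - ?v) - ?b * w * (?u + ?v * w - int q * d)"
      by (simp add: algebra_simps power2_eq_square)
    also have "\<dots> = int q * (c * ?u - ?b * w * d - c * ?v + ?b * ?v * e)"
      unfolding c d e by (simp add: algebra_simps)
    finally have "int q dvd ?a * ?u - ?a * ?v + ?b * ?v" by (rule dvdI)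
    then have 2: "int q dvd ere (\<alpha> * cnj jac)"
      by (simp add: algebra_simps)
    have "of_int (int q) dvd \<alpha> * cnj jac"
      unfolding of_int_dvd_eis using 1 2 by blast
    then obtain \<beta> where \<beta>: "\<alpha> * cnj jac = of_int (int q) * \<beta>" by blast
    have "of_int (int q) * \<alpha> = of_int (int q) * (jac * \<beta>)"
      using \<beta> mult_cnj[of jac] by (metis jac_norm mult.assoc mult.commute)
    moreover have "of_int (int q) \<noteq> (0 :: eis)"
      using q_gt_1 by (auto dest: arg_cong[of _ _ ere])
    ultimately have \<alpha>\<beta>: "\<alpha> = jac * \<beta>" by simp
    have "nrm \<alpha> = int q * nrm \<beta>"
      by (simp add: \<alpha>\<beta> nrm_mult jac_norm)
    moreover have "nrm \<beta> > 0" using calculation primary_nrm_pos[OF \<alpha>] q_gt_1 by (simp add: zero_less_mult_iff)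
    ultimately have less': "nat (nrm \<beta>) < nat (nrm \<alpha>)"
      using q_gt_1 by simp
    have "primary \<beta>"
      unfolding primary_def
    proof
      have eim: "?b = ?u * eim \<beta> + ?v * (ere \<beta> - eim \<beta>)"
        by (simp add: \<alpha>\<beta> algebra_simps)
      have "3 dvd ?b - ?v * (ere \<beta> - eim \<beta>)"
        using jac_primary \<alpha> by (simp add: primary_def)
      then have 3: "3 dvd ?u * eim \<beta>" using eim by simp
      have "\<not> 3 dvd ?u"
      proof
        assume "3 dvd ?u"
        then have "3 dvd nrm jac" using jac_primary by (simp add: nrm_def power2_eq_square)
        then have "int q mod 3 = 0" by (simp add: jac_norm)
        then show False using q_mod_3 by presburger
      qed
      then show "3 dvd eim \<beta>" using 3 by (simp add: prime_dvd_mult_iff)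
      show "coprime (ere \<beta>) (eim \<beta>)"
      proof (rule coprimeI)
        fix r assume r: "r dvd ere \<beta>" "r dvd eim \<beta>"
        then have "r dvd ?a" "r dvd ?b" by (simp_all add: \<alpha>\<beta>)
        then show "is_unit r" using \<alpha> coprime_common_divisor unfolding primary_def by blast
      qed
    qed
    then obtain f where "cubic_index \<beta> f"
      using less.hyps[OF less'] by blast
    then show ?thesis
      using cubic_index_mult[OF \<open>cubic_residues q w\<close> \<alpha> \<alpha>\<beta> _ w] by blast
  qed
qed

section \<open>Reciprocity for rational moduli\<close>

text \<open>The exponent of the symbol of \<open>om\<close> modulo the rational integer
  \<open>a\<close>: it is (N - 1) / 3 for the norm N = a^2.\<close>

definition sq_index :: "int \<Rightarrow> int" where
  "sq_index a = (a\<^sup>2 - 1) div 3"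

lemma sq_index_eq: "\<not> 3 dvd a \<Longrightarrow> 3 * sq_index a = a\<^sup>2 - 1" for a :: int
proof -
  assume "\<not> 3 dvd a"
  then have "a mod 3 = 1 \<or> a mod 3 = 2" by presburger
  then have "a\<^sup>2 mod 3 = 1"
    using mod_mult_eq[of a 3 a] by (auto simp: power2_eq_square)
  then have "3 dvd a\<^sup>2 - 1" using mod_eq_dvd_iff[of "a\<^sup>2" 3 1] by simp
  then show ?thesis by (simp add: sq_index_def)
qed

lemma sq_index_mult:
  assumes "\<not> 3 dvd a" "\<not> 3 dvd b"
  shows "[sq_index (a * b) = sq_index a + sq_index b] (mod 3)"
proof -
  have ab: "\<not> 3 dvd a * b"
    using assms by (simp add: prime_dvd_mult_iff)
  have a: "a\<^sup>2 = 3 * sq_index a + 1" and b: "b\<^sup>2 = 3 * sq_index b + 1"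
    using assms by (simp_all add: sq_index_eq)
  have "3 * sq_index (a * b) = a\<^sup>2 * b\<^sup>2 - 1"
    using sq_index_eq[OF ab] by (simp add: power_mult_distrib)
  also have "\<dots> = 3 * (sq_index a + sq_index b + 3 * (sq_index a * sq_index b))"
    unfolding a b by (simp add: algebra_simps)
  finally have "sq_index (a * b) - (sq_index a + sq_index b) = 3 * (sq_index a * sq_index b)" by simp
  then show ?thesis unfolding cong_iff_dvd_diff by simp
qed

lemma sq_index_minus [simp]: "sq_index (- a) = sq_index a"
  by (simp add: sq_index_def)

lemma dcong_cnj: "dcong (of_int l) x y \<Longrightarrow> dcong (of_int l) (cnj x) (cnj y)"
  unfolding dcong_iff by (metis cnj_hom(4,5,6) dvd_def)

lemma dcong_cancel:
  fixes x y :: eis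
  assumes "dcong (of_int l) (of_int c * x) (of_int c * y)" "coprime c l"
  shows "dcong (of_int l) x y"
proof -
  have "l dvd c * ere (x - y) \<and> l dvd c * eim (x - y)"
    using assms(1) unfolding dcong_iff of_int_dvd_eis by (simp add: algebra_simps)
  then show ?thesis
    using assms(2) unfolding dcong_iff of_int_dvd_eis
    by (simp only: coprime_dvd_mult_right_iff coprime_commute)
qed

text \<open>Both laws of \<open>cubic_index\<close> concern powers of
  \<open>cube_norm \<alpha>\<close>. The map is multiplicative, fixes the powers of
  \<open>om\<close>, and sends rational integers and \<open>rt\<close> to cubes, which makes the
  latter drop out of Euler's criterion.\<close>

definition cube_norm :: "eis \<Rightarrow> eis" where
  "cube_norm z = z * cnj z * z"

lemma cube_norm_mult: "cube_norm (x * y) = cube_norm x * cube_norm y"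
  by (simp add: cube_norm_def mult_ac)

lemma cube_norm_of_int: "cube_norm (of_int r) = of_int r ^ 3"
  by (simp add: cube_norm_def power3_eq_cube)

lemma cube_norm_om: "cube_norm (om ^ j) = om ^ j"
  by (simp add: cube_norm_def cnj_om flip: power_mult power_add)
     (intro om_power_cong, simp add: cong_def, presburger)

lemma cube_norm_power: "cube_norm (z ^ e) = cube_norm z ^ e"
  by (simp add: cube_norm_def power_mult_distrib)

lemma cube_norm_rt: "cube_norm rt = cnj rt ^ 3"
  by (auto intro!: eis_eqI simp: cube_norm_def power3_eq_cube)

lemma cube_norm_nrm: "cube_norm z = of_int (nrm z) * z"
  by (simp add: cube_norm_def mult_cnj)

lemma dcong_cube_norm:
  assumes "dcong (of_int l) x y"
  shows "dcong (of_int l) (cube_norm x) (cube_norm y)"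
  unfolding cube_norm_def by (intro idcong_mult dcong_cnj assms)

lemma fermat_eis_int:
  assumes "prime l" "\<not> int l dvd r"
  shows "dcong (of_int (int l)) (of_int r ^ (l - 1) :: eis) 1"
proof -
  have "[r * r ^ (l - 1) = r * 1] (mod int l)"
    using fermat_int[OF assms(1), of r] assms(1)
    by (simp flip: power_Suc add: prime_gt_0_nat)
  moreover have "coprime r (int l)"
    using assms prime_imp_coprime[of "int l" r] by (simp add: coprime_commute)
  ultimately have "[r ^ (l - 1) = 1] (mod int l)"
    using cong_mult_lcancel by blast
  then have "int l dvd r ^ (l - 1) - 1" by (simp add: cong_iff_dvd_diff)
  then have "of_int (int l) dvd (of_int (r ^ (l - 1) - 1) :: eis)"
    by (simp only: of_int_dvd_eis eis_of_int) simp
  then show ?thesis by (simp add: dcong_iff)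
qed

lemma coprime_3_prime: "prime l \<Longrightarrow> l \<noteq> 3 \<Longrightarrow> coprime 3 (int l)"
proof -
  assume "prime l" "l \<noteq> 3"
  then have "coprime l 3" by (intro primes_coprime) auto
  then have "coprime (int l) (int 3)" by (simp only: coprime_int_iff)
  then show ?thesis by (simp add: coprime_commute)
qed

text \<open>Frobenius gives z^l = z for z = \<open>cnj rt\<close>. One factor z is removed by
  multiplying with \<open>cnj z\<close>, since z \<open>cnj z\<close> = 3 is invertible modulo
  \<open>l\<close>.\<close>

lemma rt_power_1:
  assumes "prime l" "l = 3 * n + 1"
  shows "dcong (of_int (int l)) (cnj rt ^ (3 * n)) 1"
proof -
  let ?z = "cnj rt"
  have "om ^ l = om"
    using om_power_cong[of l 1] assms(2) by (simp add: cong_def)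
  then have "of_int (ere ?z) + of_int (eim ?z) * om ^ l = ?z"
    by (simp only: eis_expand[symmetric])
  then have F: "dcong (of_int (int l)) (?z ^ l) ?z"
    using eis_frobenius[OF assms(1), of ?z] by simp
  have Z: "cnj ?z * ?z = of_int 3"
    using mult_cnj[of rt] by simp
  have "cnj ?z * ?z ^ l = (cnj ?z * ?z) * ?z ^ (3 * n)"
    unfolding assms(2) by (simp only: power_add power_one_right mult_ac)
  then have "cnj ?z * ?z ^ l = of_int 3 * ?z ^ (3 * n)"
    unfolding Z .
  moreover have "cnj ?z * ?z = of_int 3 * 1"
    using Z by simp
  ultimately have "dcong (of_int (int l)) (of_int 3 * ?z ^ (3 * n)) (of_int 3 * 1)"
    using idcong_mult_left[OF F, of "cnj ?z"] by (simp only:)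
  moreover have "coprime 3 (int l)"
    using assms(2) by (intro coprime_3_prime[OF assms(1)]) presburger
  ultimately show ?thesis by (rule dcong_cancel)
qed

lemma rt_power_2:
  assumes "prime l" "l = 3 * n + 2"
  shows "dcong (of_int (int l)) (cnj rt ^ (3 * n) * rt) 1"
proof -
  let ?z = "cnj rt"
  have "om ^ l = cnj om"
    using om_power_cong[of l 2] assms(2) by (simp add: cong_def cnj_om mod_Suc)
  moreover have "of_int (ere ?z) + of_int (eim ?z) * cnj om = rt"
    by (intro eis_eqI) auto
  ultimately have F: "dcong (of_int (int l)) (?z ^ l) rt"
    using eis_frobenius[OF assms(1), of ?z] by simp
  have "?z * ?z = - of_int 3"
    by (simp add: cnj_rt rt_square)
  moreover have "?z ^ l = ?z ^ (3 * n) * (?z * ?z)"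
    unfolding assms(2) power_add power2_eq_square ..
  ultimately have "(- rt) * ?z ^ l = of_int 3 * (?z ^ (3 * n) * rt)"
    by simp
  moreover have "(- rt) * rt = of_int 3 * 1"
    using rt_square by simp
  ultimately have "dcong (of_int (int l)) (of_int 3 * (?z ^ (3 * n) * rt)) (of_int 3 * 1)"
    using idcong_mult_left[OF F, of "- rt"] by (simp only:)
  moreover have "coprime 3 (int l)"
    using assms(2) by (intro coprime_3_prime[OF assms(1)]) presburger
  ultimately show ?thesis by (rule dcong_cancel)
qed

text \<open>Rational integers and powers of \<open>rt\<close> have trivial cubic symbol at
  \<open>l\<close>: the former by Fermat, the latter by Frobenius.\<close>

lemma cube_norm_power_1:
  assumes "prime l" "l = 3 * n + 1" "\<not> int l dvd r"
  shows "dcong (of_int (int l)) (cube_norm (of_int r * rt ^ e) ^ n) 1"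
proof -
  have "cube_norm (of_int r * rt ^ e) ^ n = of_int r ^ (l - 1) * (cnj rt ^ (3 * n)) ^ e"
    using assms(2) by (simp add: cube_norm_mult cube_norm_of_int cube_norm_power cube_norm_rt 
        power_mult_distrib mult_ac flip: power_mult)
  also have "dcong (of_int (int l)) \<dots> (1 * 1 ^ e)"
    by (intro idcong_mult idcong_power fermat_eis_int rt_power_1 assms)
  finally show ?thesis by simp
qed

lemma cube_norm_power_2:
  assumes "prime l" "l = 3 * n + 2" "\<not> int l dvd r"
  shows "dcong (of_int (int l)) (cube_norm (of_int r * rt ^ e) ^ n * (of_int r * rt ^ e)) 1"
proof -
  have "cube_norm (of_int r * rt ^ e) ^ n * (of_int r * rt ^ e) =
      (of_int r ^ (3 * n) * of_int r) * ((cnj rt ^ (3 * n)) ^ e * rt ^ e)"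
    by (simp add: cube_norm_mult cube_norm_of_int cube_norm_power cube_norm_rt 
        power_mult_distrib mult_ac flip: power_mult)
  also have "\<dots> = of_int r ^ (l - 1) * (cnj rt ^ (3 * n) * rt) ^ e"
    using assms(2) by (simp add: power_mult_distrib mult_ac)
  also have "dcong (of_int (int l)) \<dots> (1 * 1 ^ e)"
    by (intro idcong_mult idcong_power fermat_eis_int rt_power_2 assms)
  finally show ?thesis by simp
qed

lemma prime_mod_3_cases:
  assumes "prime (l::nat)" "l \<noteq> 3"
  obtains n where "l = 3 * n + 1" | n where "l = 3 * n + 2"
proof -
  have "\<not> 3 dvd l" using assms primes_dvd_imp_eq[of 3 l] by auto
  then have "l mod 3 = 1 \<or> l mod 3 = 2" by presburger
  then have "l = 3 * (l div 3) + 1 \<or> l = 3 * (l div 3) + 2" by presburger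
  then show ?thesis using that by blast
qed

lemma cong_int_nat: "[a = b] (mod 3) \<Longrightarrow> [int a = int b] (mod 3)"
  by (metis cong_int_iff of_nat_numeral)

locale primary_index = cubic_index +
  assumes primary: "primary \<alpha>"
begin

text \<open>Up to a factor prime to \<open>l\<close>, \<alpha> \<open>om ^ j\<close> is a number of
  trivial symbol. The symbol of \<alpha> at \<open>l\<close>, which the laws identify with that of
  \<open>l\<close> modulo \<alpha>, is therefore inverse to the symbol of
  \<open>om ^ j\<close>.\<close>

lemma reciprocity_prime:
  assumes "prime l" "l \<noteq> 3" "\<not> int l dvd nrm \<alpha>" "\<not> int l dvd r" "\<not> int l dvd r'"
    and "of_int (int l) dvd of_int r' * \<alpha> * om ^ j - of_int r * rt ^ e"
  shows "[int (f (int l)) + int j * sq_index (int l) = 0] (mod 3)"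
proof -
  let ?L = "of_int (int l) :: eis"
  have l1: "\<bar>int l\<bar> > 1" using assms(1) prime_gt_1_nat[of l] by simp
  have D: "dcong ?L (of_int r' * \<alpha> * om ^ j) (of_int r * rt ^ e)"
    using assms(6) by (simp add: dcong_iff)
  have C: "dcong ?L (cube_norm (of_int r') * cube_norm \<alpha> * om ^ j) (cube_norm (of_int r * rt ^ e))"
    using dcong_cube_norm[OF D] by (simp only: cube_norm_mult cube_norm_om)
  from assms(1,2) show ?thesis
  proof (cases rule: prime_mod_3_cases)
    case (1 n)
    have one: "dcong ?L (cube_norm (of_int r') ^ n) 1"
      using cube_norm_power_1[OF assms(1) 1 assms(5), of 0] by simp
    have "dcong ?L (1 * om ^ (2 * f (int l)) * om ^ (j * n)) (cube_norm (of_int r') ^ n * cube_norm \<alpha> ^ n * om ^ (j * n))"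
      using law_1[OF assms(1,3) 1] one 
      by (intro idcong_mult idcong_refl) (auto simp: cube_norm_nrm intro: idcong_sym)
    also have "\<dots> = (cube_norm (of_int r') * cube_norm \<alpha> * om ^ j) ^ n"
      by (simp add: power_mult_distrib power_mult)
    also have "dcong ?L \<dots> (cube_norm (of_int r * rt ^ e) ^ n)"
      by (intro idcong_power C)
    also have "dcong ?L \<dots> 1"
      by (rule cube_norm_power_1[OF assms(1) 1 assms(4)])
    finally have "?L dvd om ^ (2 * f (int l) + j * n) - om ^ 0"
      by (simp add: dcong_iff power_add)
    then have "[2 * f (int l) + j * n = 0] (mod 3)"
      using om_power_dvd[OF l1] by blast
    then have d3: "3 dvd 2 * int (f (int l)) + int j * int n"
      using cong_int_nat[of "2 * f (int l) + j * n" 0] by (simp add: cong_0_iff)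
    \<comment> \<open>This is 2 n modulo 3, so doubling the relation 2 f + j n = 0 gives the
      claim.\<close>
    have "sq_index (int l) = 3 * int n * int n + 2 * int n"
      using sq_index_eq[of "int l"] 1 
      by (simp add: sq_index_def algebra_simps power2_eq_square)
    note hl = this
    from d3 have "3 dvd 2 * (2 * int (f (int l)) + int j * int n) +
        3 * (int j * int n * int n - int (f (int l)))"
      by (rule dvd_add[OF dvd_mult dvd_triv_left])
    moreover have "2 * (2 * int (f (int l)) + int j * int n) + 3 * (int j * int n * int n - int (f (int l)))
        = int (f (int l)) + int j * sq_index (int l)"
      unfolding hl by (simp add: algebra_simps)
    ultimately show ?thesis by (simp only: cong_0_iff)
  next
    case (2 n)
    have one: "dcong ?L (cube_norm (of_int r') ^ n * of_int r') 1"
      using cube_norm_power_2[OF assms(1) 2 assms(5), of 0] by simp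
    have "dcong ?L (1 * om ^ f (int l) * om ^ (j * n + j))
        ((cube_norm (of_int r') ^ n * of_int r') * (cube_norm \<alpha> ^ n * \<alpha>) * om ^ (j * n + j))"
      using law_2[OF assms(1,3) 2] one 
      by (intro idcong_mult idcong_refl) (auto simp: cube_norm_nrm intro: idcong_sym)
    also have "\<dots> = (cube_norm (of_int r') * cube_norm \<alpha> * om ^ j) ^ n * (of_int r' * \<alpha> * om ^ j)"
      by (simp add: power_mult_distrib power_mult power_add mult_ac)
    also have "dcong ?L \<dots> (cube_norm (of_int r * rt ^ e) ^ n * (of_int r * rt ^ e))"
      by (intro idcong_mult idcong_power C D)
    also have "dcong ?L \<dots> 1"
      by (rule cube_norm_power_2[OF assms(1) 2 assms(4)])
    finally have "?L dvd om ^ (f (int l) + (j * n + j)) - om ^ 0"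
      by (simp add: dcong_iff power_add)
    then have "[f (int l) + (j * n + j) = 0] (mod 3)"
      using om_power_dvd[OF l1] by blast
    then have d3: "3 dvd int (f (int l)) + (int j * int n + int j)"
      using cong_int_nat[of "f (int l) + (j * n + j)" 0] by (simp add: cong_0_iff)
    have hl: "sq_index (int l) = 3 * int n * int n + 4 * int n + 1"
      using 2 by (simp add: sq_index_def algebra_simps power2_eq_square)
    from d3 have "3 dvd (int (f (int l)) + (int j * int n + int j)) +
        3 * (int j * int n * int n + int j * int n)"
      by (rule dvd_add[OF _ dvd_triv_left])
    moreover have "(int (f (int l)) + (int j * int n + int j)) +
        3 * (int j * int n * int n + int j * int n) = int (f (int l)) + int j * sq_index (int l)"
      unfolding hl by (simp add: algebra_simps)
    ultimately show ?thesis by (simp only: cong_0_iff)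
  qed
qed

lemma mult_int:
  assumes "coprime s (nrm \<alpha>)" "coprime t (nrm \<alpha>)"
  shows "[int (f (s * t)) = int (f s) + int (f t)] (mod 3)"
  using cong_int_nat[OF mult[OF assms]] by simp

lemma f_1: "[int (f 1) = 0] (mod 3)"
  using mult_int[of 1 1] by (simp add: cong_iff_dvd_diff)

lemma f_neg_1: "[int (f (- 1)) = 0] (mod 3)"
proof -
  have "[int (f 1) = int (f (- 1)) + int (f (- 1))] (mod 3)"
    using mult_int[of "- 1" "- 1"] by simp
  then show ?thesis using f_1 unfolding cong_def by presburger
qed

text \<open>Both terms are additive over the prime factors of \<open>a\<close>. The numbers
  \<open>r\<close>, \<open>r'\<close> and \<open>e\<close> may change with the prime, whereas
  \<open>j\<close> has to be common to all of them.\<close>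

lemma reciprocity:
  assumes "a \<noteq> 0" and "\<And>l. prime l \<Longrightarrow> int l dvd a \<Longrightarrow> l \<noteq> 3 \<and> \<not> int l dvd nrm \<alpha> \<and>
      (\<exists>r r' e. \<not> int l dvd r \<and> \<not> int l dvd r' \<and>
        of_int (int l) dvd of_int r' * \<alpha> * om ^ j - of_int r * rt ^ e)"
  shows "[int (f a) + int j * sq_index a = 0] (mod 3)"
  using assms
proof (induction "nat \<bar>a\<bar>" arbitrary: a rule: less_induct)
  case less
  show ?case
  proof (cases "\<bar>a\<bar> = 1")
    case True
    then have "a = 1 \<or> a = - 1" by linarith
    then show ?thesis using f_1 f_neg_1 by (auto simp: sq_index_def)
  next
    case False
    then obtain l where l: "prime l" "l dvd nat \<bar>a\<bar>"
      using prime_factor_nat[of "nat \<bar>a\<bar>"] False by (metis nat_eq_iff2 of_nat_1 abs_ge_zero nat_0_le)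
    then have la: "int l dvd a" by (simp only: int_dvd_int_iff[symmetric] nat_0_le abs_ge_zero dvd_abs_iff)
    then obtain b where b: "a = int l * b" by blast
    have l1: "l > 1" using l(1) by (rule prime_gt_1_nat)
    note L = less.prems(2)[OF l(1) la]
    have b0: "b \<noteq> 0" using less.prems(1) b by auto
    then have "nat \<bar>b\<bar> < nat \<bar>a\<bar>" using b l1 by (simp add: abs_mult nat_mult_distrib)
    moreover have P: "prime q \<Longrightarrow> int q dvd b \<Longrightarrow> int q dvd a" for q using b by simp
    ultimately have IH: "[int (f b) + int j * sq_index b = 0] (mod 3)"
      using less.hyps b0 less.prems(2) by blast
    have R: "[int (f (int l)) + int j * sq_index (int l) = 0] (mod 3)"
      using L reciprocity_prime[OF l(1)] by blast
    have "coprime (int l) (nrm \<alpha>)"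
      using L l(1) prime_imp_coprime[of "int l"] by simp
    moreover have "coprime b (nrm \<alpha>)"
    proof (rule ccontr)
      assume "\<not> coprime b (nrm \<alpha>)"
      then have "gcd b (nrm \<alpha>) \<noteq> 1" by (simp add: coprime_iff_gcd_eq_1)
      then have "nat (gcd b (nrm \<alpha>)) \<noteq> 1" by (metis gcd_ge_0_int nat_0_le of_nat_1)
      then obtain q where q: "prime q" "q dvd nat (gcd b (nrm \<alpha>))"
        by (meson prime_factor_nat)
      then have "int q dvd gcd b (nrm \<alpha>)" by (simp only: int_dvd_int_iff[symmetric] nat_0_le gcd_ge_0_int)
      then have "int q dvd b" "int q dvd nrm \<alpha>" by auto
      then show False using less.prems(2) P q(1) by blast
    qed
    ultimately have M: "[int (f a) = int (f (int l)) + int (f b)] (mod 3)"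
      unfolding b by (rule mult_int)
    have "\<not> 3 dvd int l"
    proof
      assume "3 dvd int l"
      then have "3 dvd l" by presburger
      then show False using L l(1) primes_dvd_imp_eq[of 3 l] by auto
    qed
    moreover have "\<not> 3 dvd b"
      using less.prems(2)[of 3] P[of 3] by auto
    ultimately have "[sq_index a = sq_index (int l) + sq_index b] (mod 3)"
      unfolding b by (rule sq_index_mult)
    then have "[int (f a) + int j * sq_index a = (int (f (int l)) + int (f b)) + int j * (sq_index (int l) + sq_index b)] (mod 3)"
      using M by (intro cong_add cong_mult cong_refl)
    also have "(int (f (int l)) + int (f b)) + int j * (sq_index (int l) + sq_index b) =
        (int (f (int l)) + int j * sq_index (int l)) + (int (f b) + int j * sq_index b)"
      by (simp add: algebra_simps)
    also have "[\<dots> = 0 + 0] (mod 3)" by (rule cong_add[OF R IH])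
    finally show ?thesis by simp
  qed
qed

end

section \<open>Prime divisors, the symbol of 3, and splitting off a power of \<omega>\<close>

lemma coprime_int_primeI:
  fixes a b :: int
  assumes "\<And>l. prime (l::nat) \<Longrightarrow> int l dvd a \<Longrightarrow> int l dvd b \<Longrightarrow> False"
  shows "coprime a b"
proof (rule ccontr)
  assume "\<not> coprime a b"
  then have "gcd a b \<noteq> 1" by (simp add: coprime_iff_gcd_eq_1)
  then have "nat (gcd a b) \<noteq> 1" by (metis gcd_ge_0_int nat_0_le of_nat_1)
  then obtain q where q: "prime q" "q dvd nat (gcd a b)"
    by (meson prime_factor_nat)
  then have "int q dvd gcd a b" by (simp only: int_dvd_int_iff[symmetric] nat_0_le gcd_ge_0_int)
  then show False using assms[OF q(1)] by simp
qed

lemma prime_int_not_dvd: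
  assumes "prime (l::nat)" "coprime a b" "int l dvd a"
  shows "\<not> int l dvd b"
  using coprime_common_divisor[OF assms(2), of "int l"] assms by auto

lemma prime_int_dvd_mult:
  assumes "prime (l::nat)"
  shows "int l dvd a * b \<longleftrightarrow> int l dvd a \<or> int l dvd b"
  using assms by (simp add: prime_dvd_mult_iff)

lemma prime_int_dvd_power:
  assumes "prime (l::nat)" "k > 0"
  shows "int l dvd a ^ k \<longleftrightarrow> int l dvd a"
  using assms by (simp add: prime_dvd_power_iff)

lemma prime_eq_3: "prime (l::nat) \<Longrightarrow> int l dvd 3 \<Longrightarrow> l = 3"
  using primes_dvd_imp_eq[of l 3] int_dvd_int_iff[of l 3] by simp

lemma prime_eq_2: "prime (l::nat) \<Longrightarrow> int l dvd 2 \<Longrightarrow> l = 2"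
  using primes_dvd_imp_eq[of l 2] int_dvd_int_iff[of l 2] by simp

lemma cong_3E:
  fixes a b :: int
  assumes "[a = b] (mod 3)"
  obtains k where "a - b = 3 * k"
  using assms by (auto simp: cong_iff_dvd_diff)

lemma of_int_dvd_of_intI: "a dvd b \<Longrightarrow> (of_int a :: 'a::comm_ring_1) dvd of_int b"
  by (elim dvdE) simp

context primary_index
begin

lemma prime_dvd_nrm_ne_3: "prime l \<Longrightarrow> int l dvd nrm \<alpha> \<Longrightarrow> l \<noteq> 3"
  using primary_nrm_not_3_dvd[OF primary] by auto

text \<open>
  For \<open>\<alpha> = a + b \<omega>\<close> and an integer \<open>w \<equiv> \<omega> (mod \<alpha>)\<close> we have \<open>(1 - w)\<^sup>2 \<equiv> - 3 w\<close> and
  \<open>(a + b) w \<equiv> - a (1 - w)\<close>, while the symbols of \<open>a\<close> and \<open>a + b\<close> are known by reciprocity.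
\<close>

lemma supplementary: "[int (f 3) = ere \<alpha> * (eim \<alpha> div 3)] (mod 3)"
proof -
  let ?a = "ere \<alpha>" and ?b = "eim \<alpha>" and ?N = "nrm \<alpha>"
  have cab: "coprime ?a ?b" and b3: "3 dvd ?b"
    using primary by (simp_all add: primary_def)
  have cbN: "coprime ?b ?N"
    using cab by (rule coprime_eim_nrm)
  obtain w where w: "?N dvd ?a + ?b * w"
    by (rule root_exists[OF cbN])
  have quad: "?N dvd w\<^sup>2 + w + 1"
    by (rule root_quadratic[OF w dvd_refl cbN])
  have a3: "\<not> 3 dvd ?a"
    using primary by (rule primary_not_3_dvd)
  have ab3: "\<not> 3 dvd ?a + ?b"
    using a3 b3 by (simp add: dvd_add_left_iff)
  have dvd_w: "\<not> int l dvd w" if "prime l" "int l dvd ?N" for l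
  proof
    assume "int l dvd w"
    then have "int l dvd w\<^sup>2 + w" by (simp add: power2_eq_square)
    moreover have "int l dvd w\<^sup>2 + w + 1" using that(2) quad by (rule dvd_trans)
    ultimately have "int l dvd 1" using dvd_add_right_iff by blast
    then show False using that(1) by auto
  qed
  have cop_w: "coprime w ?N"
    using dvd_w by (blast intro: coprime_int_primeI)
  have cop_3: "coprime 3 ?N"
    using prime_eq_3 prime_dvd_nrm_ne_3 by (blast intro: coprime_int_primeI)
  have sq: "[(1 - w) * (1 - w) = - 1 * (3 * w)] (mod ?N)"
  proof -
    have "(1 - w) * (1 - w) - (- 1 * (3 * w)) = w\<^sup>2 + w + 1"
      by (simp add: algebra_simps power2_eq_square)
    then show ?thesis using quad by (simp only: cong_iff_dvd_diff)
  qed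
  have cop_1w: "coprime (1 - w) ?N"
  proof -
    have "coprime (- 1 * (3 * w)) ?N" using cop_w cop_3 by simp
    then have "coprime ((1 - w) * (1 - w)) ?N" using cong_imp_coprime[OF cong_sym[OF sq]] by simp
    then show ?thesis by simp
  qed
  have nrm_a: "?N = ?a * (?a - ?b) + ?b\<^sup>2" and nrm_ab: "?N = (?a + ?b) * (?a + ?b) - 3 * (?a * ?b)"
    by (simp_all add: nrm_def algebra_simps power2_eq_square)
  have dvd_a: "l \<noteq> 3 \<and> \<not> int l dvd ?b \<and> \<not> int l dvd ?N" if "prime l" "int l dvd ?a" for l
  proof -
    have b: "\<not> int l dvd ?b" using prime_int_not_dvd[OF that(1) cab that(2)] .
    have "\<not> int l dvd ?N"
    proof
      assume "int l dvd ?N"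
      then have "int l dvd ?b\<^sup>2" using that(2) nrm_a by (metis dvd_add_right_iff dvd_mult2)
      then show False using b that(1) by (simp add: prime_int_dvd_power)
    qed
    then show ?thesis using b a3 that(2) by auto
  qed
  have dvd_ab: "l \<noteq> 3 \<and> \<not> int l dvd ?b \<and> \<not> int l dvd ?N" if l: "prime l" "int l dvd ?a + ?b" for l
  proof -
    have b: "\<not> int l dvd ?b"
    proof
      assume "int l dvd ?b"
      then have "int l dvd ?a" using l(2) by (simp add: dvd_add_left_iff)
      then show False using prime_int_not_dvd[OF l(1) cab] \<open>int l dvd ?b\<close> by blast
    qed
    then have a: "\<not> int l dvd ?a" using l(2) dvd_add_right_iff[of "int l" ?a ?b] by blast
    have l3: "l \<noteq> 3" using ab3 l(2) by auto
    have "\<not> int l dvd ?N"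
    proof
      assume "int l dvd ?N"
      moreover have "int l dvd (?a + ?b) * (?a + ?b)" using l(2) by simp
      ultimately have "int l dvd 3 * (?a * ?b)"
        using nrm_ab dvd_diff[of "int l" "(?a + ?b) * (?a + ?b)" ?N] by simp
      then show False using a b prime_eq_3[OF l(1)] l3 by (simp only: prime_int_dvd_mult[OF l(1)]) blast
    qed
    then show ?thesis using b l3 by blast
  qed
  have a0: "?a \<noteq> 0" "?a + ?b \<noteq> 0" using a3 ab3 by auto
  have one: "\<not> int l dvd 1" if "prime l" for l :: nat using that by auto
  \<comment> \<open>Modulo \<open>a\<close> the number \<alpha> is b \<omega>, which
    \<open>om ^ 2\<close> makes rational; hence j = 2.\<close>
  have fa: "[int (f ?a) + int 2 * sq_index ?a = 0] (mod 3)"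
  proof (rule reciprocity[OF a0(1)])
    fix l :: nat assume l: "prime l" "int l dvd ?a"
    have "of_int 1 * \<alpha> * om ^ 2 - of_int ?b * rt ^ 0 = of_int ?a * om ^ 2"
      by (intro eis_eqI) (auto simp: power2_eq_square)
    moreover have "of_int (int l) dvd (of_int ?a * om ^ 2 :: eis)"
      using l(2) by (intro dvd_mult2 of_int_dvd_of_intI)
    ultimately have "of_int (int l) dvd of_int 1 * \<alpha> * om ^ 2 - of_int ?b * rt ^ 0"
      by (simp only:)
    then show "l \<noteq> 3 \<and> \<not> int l dvd ?N \<and> (\<exists>r r' e. \<not> int l dvd r \<and> \<not> int l dvd r' \<and>
        of_int (int l) dvd of_int r' * \<alpha> * om ^ 2 - of_int r * rt ^ e)"
      using dvd_a[OF l] one[OF l(1)] by blast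
  qed
  \<comment> \<open>Modulo a + b the number \<alpha> is b (\<omega> - 1), and multiplication by
    \<omega> turns it into -b \<open>rt\<close>; hence j = 1.\<close>
  have fab: "[int (f (?a + ?b)) + int 1 * sq_index (?a + ?b) = 0] (mod 3)"
  proof (rule reciprocity[OF a0(2)])
    fix l :: nat assume l: "prime l" "int l dvd ?a + ?b"
    have "of_int 1 * \<alpha> * om ^ 1 - of_int (- ?b) * rt ^ 1 = of_int (?a + ?b) * om"
      by (intro eis_eqI) auto
    moreover have "of_int (int l) dvd (of_int (?a + ?b) * om :: eis)"
      using l(2) by (intro dvd_mult2 of_int_dvd_of_intI)
    ultimately have "of_int (int l) dvd of_int 1 * \<alpha> * om ^ 1 - of_int (- ?b) * rt ^ 1"
      by (simp only:)
    moreover have "\<not> int l dvd - ?b" using dvd_ab[OF l] by simp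
    ultimately show "l \<noteq> 3 \<and> \<not> int l dvd ?N \<and> (\<exists>r r' e. \<not> int l dvd r \<and> \<not> int l dvd r' \<and>
        of_int (int l) dvd of_int r' * \<alpha> * om ^ 1 - of_int r * rt ^ e)"
      using dvd_ab[OF l] one[OF l(1)] by blast
  qed
  have cop_a: "coprime ?a ?N" using dvd_a by (blast intro: coprime_int_primeI)
  have cop_ab: "coprime (?a + ?b) ?N" using dvd_ab by (blast intro: coprime_int_primeI)
  have cop_m: "coprime (- 1) ?N" by simp
  have p1: "f ((1 - w) * (1 - w)) = f (- 1 * (3 * w))"
    by (rule periodic[OF sq])
  have s1: "[int (f (1 - w)) + int (f (1 - w)) = int (f (- 1)) + (int (f 3) + int (f w))] (mod 3)"
  proof -
    have e: "[int (f (- 1 * (3 * w))) = int (f (- 1)) + int (f (3 * w))] (mod 3)"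
      using cop_w cop_3 by (intro mult_int cop_m) simp
    show ?thesis
      using cong_trans[OF cong_sym[OF mult_int[OF cop_1w cop_1w, unfolded p1]]
          cong_trans[OF e cong_add[OF cong_refl mult_int[OF cop_3 cop_w]]]] .
  qed
  have "[(?a + ?b) * w = - 1 * (?a * (1 - w))] (mod ?N)"
    using w by (simp add: cong_iff_dvd_diff algebra_simps)
  then have p2: "f ((?a + ?b) * w) = f (- 1 * (?a * (1 - w)))"
    by (rule periodic)
  have s2: "[int (f (?a + ?b)) + int (f w) = int (f (- 1)) + (int (f ?a) + int (f (1 - w)))] (mod 3)"
  proof -
    have e: "[int (f (- 1 * (?a * (1 - w)))) = int (f (- 1)) + int (f (?a * (1 - w)))] (mod 3)"
      using cop_a cop_1w by (intro mult_int cop_m) simp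
    show ?thesis
      using cong_trans[OF cong_sym[OF mult_int[OF cop_ab cop_w, unfolded p2]]
          cong_trans[OF e cong_add[OF cong_refl mult_int[OF cop_a cop_1w]]]] .
  qed
  have "int (nat ((?N - 1) div 3)) = (?N - 1) div 3"
    using primary_nrm_pos[OF primary] by simp
  then have fw: "[int (f w) = (?N - 1) div 3] (mod 3)"
    using cong_int_nat[OF omega[OF w]] by simp
  obtain B where B: "?b = 3 * B" using b3 by blast
  have ha: "?a\<^sup>2 = 3 * sq_index ?a + 1" using sq_index_eq[OF a3] by simp
  have "3 * sq_index (?a + ?b) = ?a\<^sup>2 + 2 * (?a * ?b) + ?b\<^sup>2 - 1"
    using sq_index_eq[OF ab3] by (simp add: algebra_simps power2_eq_square)
  then have hab: "sq_index (?a + ?b) = sq_index ?a + 2 * (?a * B) + 3 * B\<^sup>2"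
    unfolding ha B by (simp add: algebra_simps power2_eq_square)
  have "?N - 1 = 3 * (sq_index ?a - ?a * B + 3 * B\<^sup>2)"
    unfolding nrm_def ha B by (simp add: algebra_simps power2_eq_square)
  then have N: "(?N - 1) div 3 = sq_index ?a - ?a * B + 3 * B\<^sup>2" by simp
  have "?b div 3 = B" unfolding B by simp
  obtain k1 where 1: "int (f (1 - w)) + int (f (1 - w)) - (int (f (- 1)) + (int (f 3) + int (f w))) = 3 * k1"
    using s1 by (rule cong_3E)
  obtain k2 where 2: "int (f (?a + ?b)) + int (f w) - (int (f (- 1)) + (int (f ?a) + int (f (1 - w)))) = 3 * k2"
    using s2 by (rule cong_3E)
  obtain k3 where 3: "int (f w) - (sq_index ?a - ?a * B + 3 * B\<^sup>2) = 3 * k3"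
    using fw unfolding N by (rule cong_3E)
  obtain k4 where 4: "int (f ?a) + int 2 * sq_index ?a - 0 = 3 * k4"
    using fa by (rule cong_3E)
  obtain k5 where 5: "int (f (?a + ?b)) + int 1 * (sq_index ?a + 2 * (?a * B) + 3 * B\<^sup>2) - 0 = 3 * k5"
    using fab unfolding hab by (rule cong_3E)
  obtain k6 where 6: "int (f (- 1)) - 0 = 3 * k6"
    using f_neg_1 by (rule cong_3E)
  \<comment> \<open>The indices of 1 - w, w, a, a + b and -1 are eliminated from the six
    congruences; the multiple of 3 collects their quotients.\<close>
  have "int (f 3) - ?a * B =
      3 * (sq_index ?a - 2 * (?a * B) - B\<^sup>2 + 2 * k5 + k3 - 3 * k6 - 2 * k4 - 2 * k2 - k1)"
  proof -
    have m: "int (f (- 1)) = 3 * k6" and FA: "int (f ?a) = 3 * k4 - 2 * sq_index ?a"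
      and W: "int (f w) = sq_index ?a - ?a * B + 3 * B\<^sup>2 + 3 * k3"
      and FAB: "int (f (?a + ?b)) = 3 * k5 - sq_index ?a - 2 * (?a * B) - 3 * B\<^sup>2"
      and X: "int (f (1 - w)) = int (f (?a + ?b)) + int (f w) - int (f (- 1)) - int (f ?a) - 3 * k2"
      and F3: "int (f 3) = 2 * int (f (1 - w)) - int (f (- 1)) - int (f w) - 3 * k1"
      using 1 2 3 4 5 6 by simp_all
    show ?thesis unfolding F3 X FAB W FA m by (simp add: algebra_simps)
  qed
  then show ?thesis
    unfolding \<open>?b div 3 = B\<close> cong_iff_dvd_diff by (rule dvdI)
qed

lemma nrm_odd: "\<not> 2 dvd nrm \<alpha>"
proof -
  have "odd (ere \<alpha>) \<or> odd (eim \<alpha>)"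
    using primary coprime_common_divisor[of "ere \<alpha>" "eim \<alpha>" 2] unfolding primary_def by fastforce
  then show ?thesis by (auto simp: nrm_def)
qed

end

text \<open>The congruence \<open>\<omega> \<equiv> 1 - \<surd>-3 (mod 3)\<close> determines the power of \<open>\<omega>\<close> to be split off.\<close>

lemma primary_decomposition:
  fixes A M :: int
  assumes "\<not> 3 dvd A"
  obtains c j \<alpha> where
    "of_int A + of_int M * rt = of_int c * om ^ j * \<alpha>" "primary \<alpha>" "[int j = - (A * M)] (mod 3)"
    "\<And>f. cubic_index \<alpha> f \<Longrightarrow> 3 dvd M \<Longrightarrow> [int (f 3) = - A * (M div 3)] (mod 3)"
    "\<And>f. cubic_index \<alpha> f \<Longrightarrow> \<not> 3 dvd M \<Longrightarrow> [int (f 3) = int j * (sq_index A - sq_index M)] (mod 3)"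
proof -
  define z0 where "z0 = of_int A + of_int M * rt"
  \<comment> \<open>Since \<open>rt\<close> squares to -3, \<open>om ^ j\<close> is 1 - j
    \<open>rt\<close> modulo 3, while A + M \<open>rt\<close> is A (1 + A M \<open>rt\<close>)
    because A^2 = 1 modulo 3. Comparing the two dictates \<open>j\<close>.\<close>
  define j where "j = nat (- (A * M) mod 3)"
  have j: "int j = - (A * M) mod 3" unfolding j_def by simp
  then have j3: "j < 3" using pos_mod_bound[of 3 "- (A * M)"] by linarith
  define z where "z = z0 * om ^ (2 * j)"
  have z0z: "z0 = om ^ j * z"
  proof -
    have "om ^ j * om ^ (2 * j) = 1"
    proof -
      have "om ^ j * om ^ (2 * j) = om ^ (j + 2 * j)" by (simp only: power_add)
      also have "\<dots> = 1" by (rule om_power_eq_1) (simp add: cong_def)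
      finally show ?thesis .
    qed
    then show ?thesis unfolding z_def by (simp add: mult_ac)
  qed
  have comps: "(j = 0 \<and> ere z = A + M \<and> eim z = 2 * M) \<or> (j = 1 \<and> ere z = M - A \<and> eim z = - (A + M)) \<or>
      (j = 2 \<and> ere z = - 2 * M \<and> eim z = A - M)"
  proof -
    have "om ^ 4 = om" using om_power_cong[of 4 1] by (simp add: cong_def)
    moreover have "j = 0 \<or> j = 1 \<or> j = 2" using j3 by linarith
    ultimately show ?thesis by (auto simp: z_def z0_def power2_eq_square)
  qed
  have "A mod 3 = 1 \<or> A mod 3 = 2" "M mod 3 = 0 \<or> M mod 3 = 1 \<or> M mod 3 = 2"
    using assms by presburger+
  then have AM: "(j = 0 \<and> M mod 3 = 0) \<or> (j = 1 \<and> (A + M) mod 3 = 0 \<and> M mod 3 \<noteq> 0) \<or> 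
      (j = 2 \<and> (A - M) mod 3 = 0 \<and> M mod 3 \<noteq> 0)"
  proof -
    have jj: "j = nat ((- ((A mod 3) * (M mod 3))) mod 3)"
      unfolding j_def by (metis mod_minus_eq mod_mult_eq)
    show ?thesis
      using \<open>A mod 3 = 1 \<or> A mod 3 = 2\<close> \<open>M mod 3 = 0 \<or> M mod 3 = 1 \<or> M mod 3 = 2\<close>
    proof (elim disjE)
    qed (simp_all add: jj, presburger+)
  qed
  have eim3: "3 dvd eim z" using comps AM by auto presburger
  have ere3: "\<not> 3 dvd ere z" using comps AM assms by (auto; presburger)
  define c where "c = gcd (ere z) (eim z)"
  have c0: "c \<noteq> 0" using ere3 unfolding c_def by auto
  have c3: "\<not> 3 dvd c" using ere3 unfolding c_def by auto
  define \<alpha> where "\<alpha> = Eis (ere z div c) (eim z div c)"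
  have z: "ere z = c * ere \<alpha>" "eim z = c * eim \<alpha>"
    unfolding \<alpha>_def c_def by simp_all
  have prim: "primary \<alpha>"
    unfolding primary_def
  proof
    show "3 dvd eim \<alpha>" using eim3 c3 z by (simp add: prime_dvd_mult_iff)
    show "coprime (ere \<alpha>) (eim \<alpha>)" using c0 unfolding \<alpha>_def c_def by (auto intro: div_gcd_coprime)
  qed
  have "c mod 3 = 1 \<or> c mod 3 = 2" using c3 by presburger
  \<comment> \<open>Removing the content \<open>c\<close> divides the product in \<open>f3\<close>
    by c^2, which changes nothing modulo 3.\<close>
  then have cc: "[c * c = 1] (mod 3)" using mod_mult_eq[of c 3 c] by (auto simp: cong_def)
  have f3: "[int (f 3) = ere z * (eim z div 3)] (mod 3)" if "cubic_index \<alpha> f" for f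
  proof -
    interpret primary_index \<alpha> f
      using that prim by (simp add: primary_index_def primary_index_axioms_def)
    obtain B where B: "eim \<alpha> = 3 * B" using prim by (auto simp: primary_def)
    have "[int (f 3) = 1 * (ere \<alpha> * B)] (mod 3)" using supplementary B by simp
    also have "[1 * (ere \<alpha> * B) = c * c * (ere \<alpha> * B)] (mod 3)"
      using cc by (intro cong_mult cong_refl) (rule cong_sym)
    also have "c * c * (ere \<alpha> * B) = ere z * (eim z div 3)"
      by (simp add: z B)
    finally show ?thesis .
  qed
  show ?thesis
  proof (rule that)
    show "of_int A + of_int M * rt = of_int c * om ^ j * \<alpha>"
    proof -
      have "z = of_int c * \<alpha>" by (intro eis_eqI) (simp_all add: z)
      then show ?thesis using z0z unfolding z0_def by (simp add: mult_ac)
    qed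
    show "[int j = - (A * M)] (mod 3)" using j by (simp add: cong_def)
  next
    fix f assume f: "cubic_index \<alpha> f" "3 dvd M"
    then have "j = 0" using AM by auto
    then have zz: "ere z = A + M" "eim z = 2 * M" using comps by auto
    obtain K where K: "M = 3 * K" using f(2) by blast
    have "ere z * (eim z div 3) - (- A * (M div 3)) = 3 * (A * K + 2 * (K * K))"
      unfolding zz by (simp add: K algebra_simps)
    then have "[ere z * (eim z div 3) = - A * (M div 3)] (mod 3)"
      unfolding cong_iff_dvd_diff by (metis dvd_triv_left)
    then show "[int (f 3) = - A * (M div 3)] (mod 3)"
      using f3[OF f(1)] cong_trans by blast
  next
    fix f assume f: "cubic_index \<alpha> f" "\<not> 3 dvd M"
    have hh: "A\<^sup>2 = 3 * sq_index A + 1" "M\<^sup>2 = 3 * sq_index M + 1"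
      using sq_index_eq assms f(2) by simp_all
    have "[ere z * (eim z div 3) = int j * (sq_index A - sq_index M)] (mod 3)"
    proof (cases "j = 1")
      case True
      then have zz: "ere z = M - A" "eim z = - (A + M)" using comps by auto
      obtain K where K: "A + M = 3 * K" using True AM by auto
      have "3 * (sq_index A - sq_index M) = (A - M) * (A + M)" 
        using hh by (simp add: algebra_simps power2_eq_square)
      then have "sq_index A - sq_index M = (A - M) * K" unfolding K by simp
      moreover have "eim z div 3 = - K" using K zz by simp
      then have "ere z * (eim z div 3) = (M - A) * (- K)" using zz(1) by (simp only:)
      ultimately have "ere z * (eim z div 3) = int j * (sq_index A - sq_index M)"
        using True by (simp add: algebra_simps)
      then show ?thesis by simp
    next
      case False
      then have j2: "j = 2" using f(2) AM by auto
      then have zz: "ere z = - 2 * M" "eim z = A - M" using comps by auto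
      obtain K where K: "A - M = 3 * K" using j2 AM by auto
      have "3 * (sq_index A - sq_index M) = (A - M) * (A + M)" 
        using hh by (simp add: algebra_simps power2_eq_square)
      then have "sq_index A - sq_index M = K * (3 * K + 2 * M)" using K by (simp add: algebra_simps)
      moreover have "eim z div 3 = K" using K zz by simp
      then have "ere z * (eim z div 3) = - 2 * M * K" using zz(1) by (simp only:)
      ultimately have "ere z * (eim z div 3) - int j * (sq_index A - sq_index M) = 3 * (- 2 * (K * K) - 2 * (K * M))"
        using j2 by (simp add: algebra_simps)
      then show ?thesis unfolding cong_iff_dvd_diff by (metis dvd_triv_left)
    qed
    then show "[int (f 3) = int j * (sq_index A - sq_index M)] (mod 3)"
      using f3[OF f(1)] cong_trans by blast
  qed (rule prim)
qed

section \<open>The Lucas sequence modulo a prime of the form \<open>x\<^sup>2 + 3 d y\<^sup>2\<close>\<close>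

text \<open>The coefficient of \<open>rt\<close> in \<omega>^i - \<omega>^(-i), the numerator of
  Binet's formula; at the same time the representative of \<open>i\<close> modulo 3 in which the
  result is read off.\<close>

definition sgn3 :: "nat \<Rightarrow> int" where
  "sgn3 i = (if i mod 3 = 0 then 0 else if i mod 3 = 1 then 1 else - 1)"

lemma sgn3_cong: "[sgn3 i = int i] (mod 3)"
proof -
  have "[int i = int (i mod 3)] (mod 3)"
    by (simp add: cong_def zmod_int)
  moreover have "[sgn3 i = int (i mod 3)] (mod 3)"
    by (cases i rule: nat_mod3_cases) (simp_all add: sgn3_def cong_def)
  ultimately show ?thesis by (meson cong_sym cong_trans)
qed

lemma om_minus_cnj: "om ^ i - cnj (om ^ i) = of_int (sgn3 i) * rt"
  by (subst (1 2) om_power_mod[symmetric], cases i rule: nat_mod3_cases)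
     (auto intro!: eis_eqI simp: sgn3_def power2_eq_square)

locale norm_equation =
  fixes d m n x y :: int and p :: nat
  assumes d_gt_1: "d > 1" and squarefree_d: "squarefree d"
    and pell: "m\<^sup>2 - d * n\<^sup>2 = 4"
    and prime_p: "prime p" and p_n: "\<not> int p dvd n"
    and p_eq: "int p = x\<^sup>2 + 3 * d * y\<^sup>2"
    and y3: "\<not> 3 dvd y" and xy: "[x = y] (mod 3)"
begin

lemma x3: "\<not> 3 dvd x"
  using xy y3 cong_dvd_iff by blast

lemma p_mod_3: "p mod 3 = 1"
proof -
  have "int p - 1 = 3 * (sq_index x + d * y\<^sup>2)"
    using sq_index_eq[OF x3] p_eq by (simp add: algebra_simps)
  then have "int p mod 3 = 1" by presburger
  then show ?thesis by presburger
qed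

definition k where "k = (p - 1) div 3"

lemma p_k: "p = 3 * k + 1"
  using p_mod_3 unfolding k_def by presburger

lemma p_odd: "odd p"
proof
  assume "even p"
  then have "p = 2" using prime_p primes_dvd_imp_eq[of 2 p] by simp
  then show False using p_mod_3 by simp
qed

lemma p_ne_3: "p \<noteq> 3"
  using p_mod_3 by auto

lemma p_dny: "coprime (d * n * y) (int p)"
  using coprime_denominator[OF d_gt_1 prime_p p_n p_eq y3] .

lemma p_not_dvd: "\<not> int p dvd d" "\<not> int p dvd y" "\<not> int p dvd 2" "\<not> int p dvd 3" "\<not> int p dvd x"
proof -
  have "\<not> int p dvd d * n * y"
    using coprime_common_divisor[OF p_dny, of "int p"] prime_p by auto
  then show d: "\<not> int p dvd d" and y: "\<not> int p dvd y" by auto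
  show "\<not> int p dvd 2" using prime_eq_2[OF prime_p] p_odd by auto
  show t: "\<not> int p dvd 3" using prime_eq_3[OF prime_p] p_ne_3 by auto
  show "\<not> int p dvd x"
  proof
    assume "int p dvd x"
    then have "int p dvd int p - x * x" by simp
    then have "int p dvd 3 * d * (y * y)" using p_eq by (simp add: power2_eq_square)
    then show False using d y t by (simp only: prime_int_dvd_mult[OF prime_p]) blast
  qed
qed

lemma coprime_xy: "coprime x y"
proof (rule coprime_int_primeI)
  fix l :: nat assume l: "prime l" "int l dvd x" "int l dvd y"
  then have "int l dvd x\<^sup>2 + 3 * d * y\<^sup>2" by (simp add: power2_eq_square)
  then have "l dvd p" unfolding p_eq[symmetric] by simp
  then have "l = p" using primes_dvd_imp_eq l(1) prime_p by blast
  then show False using l(3) p_not_dvd(2) by simp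
qed

end

text \<open>A prime dividing both n and y would kill both summands of the numerator, so their common
  factor \<open>g\<close> is taken out. If 3 divides n', the rational summand is a multiple of 3 and
  cannot serve as \<open>A\<close>; extracting one factor \<open>rt\<close> (e = 1) exchanges the
  summands, as \<open>rt\<close> (A + M \<open>rt\<close>) = A \<open>rt\<close> - 3 M. The exponent
  of 3 in n' is \<phi>.\<close>

locale decomposed = norm_equation d m n x y p + primary_index \<alpha> f
  for d m n x y :: int and p :: nat and \<alpha> :: eis and f :: "int \<Rightarrow> nat" +
  fixes g n' y' A M c n3 :: int and e j \<phi> :: nat
  assumes n_eq: "n = g * n'" and y_eq: "y = g * y'" and coprime_ny: "coprime n' y'"
    and split: "e = 0 \<and> A = n' * x \<and> M = m * y' \<or> e = 1 \<and> A = m * y' \<and> 3 * M = - (n' * x)"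
    and decomp: "of_int A + of_int M * rt = of_int c * om ^ j * \<alpha>"
    and n3_eq: "n' = 3 ^ \<phi> * n3" and n3: "\<not> 3 dvd n3"
begin

lemma y'3: "\<not> 3 dvd y'"
  using y3 y_eq by auto

lemma n'_not_0: "n' \<noteq> 0"
  using p_n n_eq by auto

lemma y'_not_0: "y' \<noteq> 0"
  using y'3 by auto

lemma coprime_xy': "coprime x y'"
  using coprime_xy y_eq by simp

lemma split_eis: "of_int (n' * x) + of_int (m * y') * rt = rt ^ e * (of_int A + of_int M * rt)"
  using split
proof
  assume s: "e = 1 \<and> A = m * y' \<and> 3 * M = - (n' * x)"
  then show ?thesis by (intro eis_eqI) auto
qed simp

lemma eis_factorization:
  "of_int (n * x) + of_int (m * y) * rt = of_int (g * c) * rt ^ e * om ^ j * \<alpha>"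
proof -
  have "of_int (n * x) + of_int (m * y) * rt = of_int g * (of_int (n' * x) + of_int (m * y') * rt)"
    by (simp add: n_eq y_eq algebra_simps)
  then show ?thesis unfolding split_eis decomp by (simp add: mult_ac)
qed

lemma nrm_power: "nrm (z ^ i) = nrm z ^ i"
  by (induction i) (simp_all add: nrm_mult)

lemma nrm_rt_form: "nrm (of_int a + of_int b * rt) = a\<^sup>2 + 3 * b\<^sup>2"
  by (simp add: nrm_def algebra_simps power2_eq_square)

lemma nrm_AM: "A\<^sup>2 + 3 * M\<^sup>2 = c\<^sup>2 * nrm \<alpha>"
  using arg_cong[OF decomp, of nrm] by (simp add: nrm_rt_form nrm_mult nrm_power)

lemma nrm_eq: "n'\<^sup>2 * int p + 12 * y'\<^sup>2 = 3 ^ e * c\<^sup>2 * nrm \<alpha>"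
proof -
  have "m\<^sup>2 = d * n\<^sup>2 + 4" using pell by simp
  then have "n'\<^sup>2 * int p + 12 * y'\<^sup>2 = (n' * x)\<^sup>2 + 3 * (m * y')\<^sup>2"
    unfolding p_eq power_mult_distrib by (simp add: n_eq y_eq algebra_simps power2_eq_square)
  also have "\<dots> = 3 ^ e * (A\<^sup>2 + 3 * M\<^sup>2)"
    using arg_cong[OF split_eis, of nrm] unfolding nrm_rt_form nrm_mult nrm_power by simp
  finally show ?thesis unfolding nrm_AM by (simp add: mult_ac)
qed

lemma prime_dvd_nrm:
  assumes l: "prime l" "int l dvd nrm \<alpha>"
  shows "l \<noteq> 2" "l \<noteq> 3" "l \<noteq> p" "\<not> int l dvd n'" "\<not> int l dvd y'"
proof -
  show l2: "l \<noteq> 2" using nrm_odd l(2) by auto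
  show l3: "l \<noteq> 3" using prime_dvd_nrm_ne_3[OF l] .
  have D: "int l dvd n'\<^sup>2 * int p + 12 * y'\<^sup>2"
    using l(2) unfolding nrm_eq by simp
  have 12: "int l dvd 12 * y'\<^sup>2 \<longleftrightarrow> int l dvd y'"
  proof -
    have "(12::int) * y'\<^sup>2 = 2 * 2 * 3 * (y' * y')" by (simp add: power2_eq_square)
    then show ?thesis using l2 l3 prime_eq_2[OF l(1)] prime_eq_3[OF l(1)]
      by (metis prime_int_dvd_mult[OF l(1)])
  qed
  have y'p: "\<not> int p dvd y'" using p_not_dvd(2) y_eq by auto
  show y': "\<not> int l dvd y'"
  proof
    assume a: "int l dvd y'"
    then have "int l dvd n'\<^sup>2 * int p" using D 12 by (simp add: dvd_add_left_iff)
    moreover have "\<not> int l dvd n'"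
      using prime_int_not_dvd[OF l(1) _ a] coprime_ny by (simp add: coprime_commute)
    ultimately have "int l dvd int p"
      using l(1) by (simp add: prime_int_dvd_mult prime_int_dvd_power)
    then have "l = p" using primes_dvd_imp_eq l(1) prime_p by simp
    then show False using a y'p by simp
  qed
  show "\<not> int l dvd n'"
  proof
    assume "int l dvd n'"
    then have "int l dvd n'\<^sup>2 * int p" by (simp add: power2_eq_square)
    then have "int l dvd 12 * y'\<^sup>2" using D by (simp add: dvd_add_right_iff)
    then show False using 12 y' by simp
  qed
  show "l \<noteq> p"
  proof
    assume "l = p"
    then have "int l dvd n'\<^sup>2 * int p" by simp
    then have "int l dvd 12 * y'\<^sup>2" using D by (simp add: dvd_add_right_iff)
    then show False using 12 y' by simp
  qed
qed

lemma c_dvd: "c dvd A + M" "c dvd 2 * M"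
proof -
  have "of_int c dvd of_int A + of_int M * rt"
    unfolding decomp by (simp add: mult.assoc)
  then show "c dvd A + M" "c dvd 2 * M" unfolding of_int_dvd_eis by (auto simp: mult.commute)
qed

text \<open>The hypothesis of \<open>reciprocity\<close> at the single prime \<open>l\<close>, for
  the exponent \<open>j\<close> of the decomposition.\<close>

definition good :: "nat \<Rightarrow> bool" where
  "good l \<longleftrightarrow> (\<exists>r r' e. \<not> int l dvd r \<and> \<not> int l dvd r' \<and>
     of_int (int l) dvd of_int r' * \<alpha> * om ^ j - of_int r * rt ^ e)"

text \<open>One summand of A + M \<open>rt\<close> vanishes modulo \<open>l\<close>, and the other
  provides \<open>r\<close> and the power of \<open>rt\<close>. The multiplier is \<open>c\<close>:
  a prime \<open>l\<close> dividing it would divide both A and M.\<close>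

lemma good_odd:
  assumes l: "prime l" "l \<noteq> 2" and one: "(int l dvd A) \<noteq> (int l dvd M)"
  shows "good l"
proof -
  have c: "\<not> int l dvd c"
  proof
    assume "int l dvd c"
    then have 1: "int l dvd A + M" and 2: "int l dvd 2 * M"
      using c_dvd dvd_trans by blast+
    then have "int l dvd M" using prime_eq_2[OF l(1)] l by (simp only: prime_int_dvd_mult) blast
    then have "int l dvd A" using 1 by (simp add: dvd_add_left_iff)
    then show False using one \<open>int l dvd M\<close> by simp
  qed
  show ?thesis
  proof (cases "int l dvd A")
    case True
    have "of_int c * \<alpha> * om ^ j - of_int M * rt ^ 1 = of_int A"
      using decomp by (simp add: mult_ac algebra_simps)
    moreover have "of_int (int l) dvd (of_int A :: eis)" using True by (rule of_int_dvd_of_intI)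
    ultimately have "of_int (int l) dvd of_int c * \<alpha> * om ^ j - of_int M * rt ^ 1" by (simp only:)
    then show ?thesis using c one True unfolding good_def by blast
  next
    case False
    have "of_int c * \<alpha> * om ^ j - of_int A * rt ^ 0 = of_int M * rt"
      using decomp by (simp add: mult_ac algebra_simps)
    moreover have "of_int (int l) dvd (of_int M * rt :: eis)"
      using one False by (intro dvd_mult2 of_int_dvd_of_intI) blast
    ultimately have "of_int (int l) dvd of_int c * \<alpha> * om ^ j - of_int A * rt ^ 0" by (simp only:)
    then show ?thesis using c False unfolding good_def by blast
  qed
qed

text \<open>An unordered pair of truth values, because \<open>split\<close> may exchange the two
  summands; \<open>good_odd\<close> only asks that the values differ.\<close>

lemma dvd_A_M:
  assumes "prime l" "l \<noteq> 3"
  shows "{int l dvd A, int l dvd M} = {int l dvd n' * x, int l dvd m * y'}"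
proof -
  have "int l dvd M \<longleftrightarrow> int l dvd 3 * M"
    using assms prime_eq_3[OF assms(1)] by (auto simp: prime_int_dvd_mult)
  then show ?thesis using split by auto
qed

lemma good_y':
  assumes l: "prime l" "l \<noteq> 2" "int l dvd y'"
  shows "good l"
proof -
  have l3: "l \<noteq> 3" using y'3 l(3) by auto
  have "\<not> int l dvd n'" "\<not> int l dvd x"
    using prime_int_not_dvd[OF l(1) _ l(3)] coprime_ny coprime_xy' by (simp_all add: coprime_commute)
  then have "\<not> int l dvd n' * x" using l(1) by (simp add: prime_int_dvd_mult)
  then have "(int l dvd A) \<noteq> (int l dvd M)"
    using dvd_A_M[OF l(1) l3] l(3) by auto
  then show ?thesis using good_odd l by blast
qed

lemma good_n':
  assumes l: "prime l" "l \<noteq> 2" "l \<noteq> 3" "int l dvd n'"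
  shows "good l"
proof -
  have "\<not> int l dvd y'"
    using prime_int_not_dvd[OF l(1) coprime_ny l(4)] .
  moreover have "\<not> int l dvd m"
  proof
    assume "int l dvd m"
    then have "int l dvd m\<^sup>2 - d * n\<^sup>2" using l(4) by (simp add: n_eq power2_eq_square)
    then have "int l dvd 2 * 2" unfolding pell by simp
    then have "int l dvd 2" using l(1) by (simp only: prime_int_dvd_mult) blast
    then show False using prime_eq_2 l by blast
  qed
  ultimately have "\<not> int l dvd m * y'" using l(1) by (simp add: prime_int_dvd_mult)
  then have "(int l dvd A) \<noteq> (int l dvd M)"
    using dvd_A_M[OF l(1,3)] l(4) by auto
  then show ?thesis using good_odd l by blast
qed

text \<open>\<open>rt\<close> = 1 + 2 \<omega> is 1 modulo 2, so an odd coefficient sum means that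
  the whole number is 1 modulo 2.\<close>

lemma good_2_aux:
  assumes "of_int a + of_int b * rt = of_int r * om ^ j * \<alpha>" "odd (a + b)"
  shows "good 2"
proof -
  have "of_int r dvd of_int a + of_int b * rt"
    unfolding assms(1) by (simp add: mult.assoc)
  then have "r dvd a + b" unfolding of_int_dvd_eis by simp
  then have r: "odd r" using assms(2) dvd_trans by blast
  have eq: "of_int r * \<alpha> * om ^ j - of_int 1 * rt ^ 0 = of_int a + of_int b * rt - 1"
    using assms(1) by (simp add: mult_ac)
  have "of_int (int 2) dvd of_int a + of_int b * rt - (1 :: eis)"
    unfolding of_int_dvd_eis using assms(2) by simp
  then have "of_int (int 2) dvd of_int r * \<alpha> * om ^ j - of_int 1 * rt ^ 0"
    unfolding eq .
  moreover have "\<not> int 2 dvd r" "\<not> int 2 dvd 1" using r by simp_all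
  ultimately show ?thesis unfolding good_def by blast
qed

lemma odd_xdy: "odd (x + d * y)"
proof -
  have "odd (x\<^sup>2 + 3 * d * y\<^sup>2)" using p_odd p_eq by (metis even_of_nat_iff)
  then show ?thesis by simp
qed

text \<open>For odd n' the coefficients A and M have opposite parity. If 4 divides n', both are
  even, and they have opposite parity once halved.\<close>

lemma good_2:
  assumes "odd n' \<or> 4 dvd n'"
  shows "good 2"
proof (cases "odd n'")
  case True
  have "odd (x + m * y')"
  proof (cases "odd m")
    case odd: True
    have "d * n\<^sup>2 = m\<^sup>2 - 4" using pell by simp
    moreover have "odd (m\<^sup>2 - 4)" using odd by simp
    ultimately have "odd (d * n\<^sup>2)" by simp
    then have "odd d" "odd g" by (simp_all add: n_eq)
    then show ?thesis using odd_xdy odd by (simp add: y_eq)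
  next
    case False
    then have "4 dvd m\<^sup>2" by (auto simp: power2_eq_square elim!: evenE)
    then have "4 dvd m\<^sup>2 - 4" by simp
    moreover have "d * n\<^sup>2 = m\<^sup>2 - 4" using pell by simp
    ultimately have 4: "4 dvd d * n\<^sup>2" by simp
    \<comment> \<open>Here d must be squarefree: 4 divides d n^2, and an odd n would give 4 |
      d.\<close>
    have "even n"
    proof (rule ccontr)
      assume "odd n"
      then have "coprime 2 n" by simp
      then have "coprime (2\<^sup>2) (n\<^sup>2)"
        by (simp only: coprime_power_left_iff coprime_power_right_iff) simp
      moreover have "2\<^sup>2 dvd d * n\<^sup>2" using 4 by simp
      ultimately have "2\<^sup>2 dvd d" using coprime_dvd_mult_left_iff by blast
      then have "is_unit (2::int)" using squarefree_d unfolding squarefree_def by blast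
      then show False by simp
    qed
    then have "even y" using True by (simp add: n_eq y_eq)
    then show ?thesis using odd_xdy False by simp
  qed
  have "odd (A + M)"
  proof -
    from split show ?thesis
    proof
      assume s: "e = 1 \<and> A = m * y' \<and> 3 * M = - (n' * x)"
      then have "even (3 * M) \<longleftrightarrow> even (- (n' * x))" by (simp only:)
      then have "even M \<longleftrightarrow> even x" using True by simp
      then show ?thesis using s \<open>odd (x + m * y')\<close> by simp
    qed (use True \<open>odd (x + m * y')\<close> in simp)
  qed
  then show ?thesis using good_2_aux[OF decomp] by blast
next
  case False
  then obtain u where u: "n' = 4 * u" using assms by auto
  have y': "odd y'"
    using coprime_ny False coprime_common_divisor[of n' y' 2] by auto
  have "m\<^sup>2 = 4 * (1 + 4 * (d * (g * u)\<^sup>2))"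
    using pell by (simp add: n_eq u power2_eq_square algebra_simps)
  moreover from this have "even (m\<^sup>2)" by simp
  then have "even m" by simp
  then obtain v where v: "m = 2 * v" by blast
  ultimately have "v\<^sup>2 = 1 + 4 * (d * (g * u)\<^sup>2)" by (simp add: power_mult_distrib)
  then have "odd (v\<^sup>2)" by simp
  then have vodd: "odd v" by simp
  obtain a b where ab: "A = 2 * a" "M = 2 * b" "odd (a + b)"
    using split
  proof
    assume s: "e = 0 \<and> A = n' * x \<and> M = m * y'"
    show thesis
      by (rule that[of "2 * u * x" "v * y'"]) (use s u v vodd y' in auto)
  next
    assume s: "e = 1 \<and> A = m * y' \<and> 3 * M = - (n' * x)"
    then have "3 * M = 4 * (- (u * x))" using u by simp
    then have "4 dvd 3 * M" by simp
    then have "4 dvd M" by presburger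
    then obtain t where "M = 4 * t" by blast
    then show thesis
      by (intro that[of "v * y'" "2 * t"]) (use s v vodd y' in auto)
  qed
  have "c\<^sup>2 * nrm \<alpha> = 4 * (a\<^sup>2 + 3 * b\<^sup>2)"
    using nrm_AM ab by (simp add: power_mult_distrib)
  then have "even (c\<^sup>2 * nrm \<alpha>)" by simp
  then have "even c" using nrm_odd by simp
  then obtain r where r: "c = 2 * r" by blast
  have "of_int 2 * (of_int a + of_int b * rt) = of_int 2 * (of_int r * om ^ j * \<alpha>)"
    using decomp by (simp add: ab r algebra_simps)
  moreover have "of_int 2 \<noteq> (0 :: eis)" by (auto dest: arg_cong[of _ _ ere])
  ultimately have "of_int a + of_int b * rt = of_int r * om ^ j * \<alpha>"
    using mult_left_cancel by blast
  then show ?thesis using good_2_aux ab(3) by blast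
qed

lemma good_reciprocity:
  assumes "a \<noteq> 0" "\<not> 3 dvd a" "coprime a (nrm \<alpha>)"
    and "\<And>l. prime l \<Longrightarrow> int l dvd a \<Longrightarrow> good l"
  shows "[int (f a) + int j * sq_index a = 0] (mod 3)"
proof (rule reciprocity[OF assms(1)])
  fix l :: nat assume l: "prime l" "int l dvd a"
  have "l \<noteq> 3" using assms(2) l(2) by auto
  moreover have "\<not> int l dvd nrm \<alpha>" using prime_int_not_dvd[OF l(1) assms(3) l(2)] .
  ultimately show "l \<noteq> 3 \<and> \<not> int l dvd nrm \<alpha> \<and>
      (\<exists>r r' e. \<not> int l dvd r \<and> \<not> int l dvd r' \<and>
        of_int (int l) dvd of_int r' * \<alpha> * om ^ j - of_int r * rt ^ e)"
    using assms(4)[OF l] unfolding good_def by blast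
qed

lemma coprime_nrm: "coprime n' (nrm \<alpha>)" "coprime y' (nrm \<alpha>)" "coprime (int p) (nrm \<alpha>)"
    "coprime 2 (nrm \<alpha>)" "coprime 3 (nrm \<alpha>)" "coprime n3 (nrm \<alpha>)"
proof -
  show n': "coprime n' (nrm \<alpha>)"
    by (rule coprime_int_primeI) (use prime_dvd_nrm(4) in blast)
  show "coprime y' (nrm \<alpha>)"
    by (rule coprime_int_primeI) (use prime_dvd_nrm(5) in blast)
  show "coprime 2 (nrm \<alpha>)"
    by (rule coprime_int_primeI) (use prime_dvd_nrm(1) prime_eq_2 in blast)
  show "coprime 3 (nrm \<alpha>)"
    by (rule coprime_int_primeI) (use prime_dvd_nrm(2) prime_eq_3 in blast)
  show "coprime (int p) (nrm \<alpha>)"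
  proof (rule coprime_int_primeI)
    fix l :: nat assume l: "prime l" "int l dvd int p" "int l dvd nrm \<alpha>"
    then have "l = p" using primes_dvd_imp_eq prime_p by simp
    then show False using prime_dvd_nrm(3)[OF l(1,3)] by simp
  qed
  show "coprime n3 (nrm \<alpha>)" using n' unfolding n3_eq by simp
qed

text \<open>
  Reciprocity may fail to apply at 2 only if \<open>n'\<close> is twice an odd number; then the exponent of 2
  in \<open>Q\<close> is 3, and 2 contributes nothing.
\<close>

definition Q where "Q = 4 * y'\<^sup>2 * n3"

lemma Q_reciprocity: "[int (f Q) + int j * sq_index Q = 0] (mod 3)"
proof -
  have y2: "\<not> 3 dvd y'\<^sup>2" using y'3 by (simp add: power2_eq_square prime_dvd_mult_iff)
  have n3_0: "n3 \<noteq> 0" using n'_not_0 n3_eq by auto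
  have good_odd: "good l" if l: "prime l" "l \<noteq> 2" "int l dvd y'\<^sup>2 * n3" for l
  proof (cases "int l dvd y'")
    case False
    then have ln: "int l dvd n3" using l(1,3) by (simp add: prime_int_dvd_mult prime_int_dvd_power)
    then have "l \<noteq> 3" using n3 by auto
    then show ?thesis using good_n' l ln n3_eq by simp
  qed (use good_y' l in blast)
  show ?thesis
  proof (cases "odd n' \<or> 4 dvd n'")
    case True
    show ?thesis
    proof (rule good_reciprocity)
      show "Q \<noteq> 0" using y'_not_0 n3_0 by (simp add: Q_def)
      show "\<not> 3 dvd Q" using y2 n3 by (simp add: Q_def prime_dvd_mult_iff)
      have "coprime (2 * 2) (nrm \<alpha>)" using coprime_nrm(4) by (simp only: coprime_mult_left_iff)
      then show "coprime Q (nrm \<alpha>)" using coprime_nrm unfolding Q_def by simp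
      fix l :: nat assume l: "prime l" "int l dvd Q"
      show "good l"
      proof (cases "l = 2")
        case l2: True
        then show ?thesis using good_2[OF True] by simp
      next
        case False
        have "Q = 2 * 2 * (y'\<^sup>2 * n3)" by (simp add: Q_def)
        then have "int l dvd y'\<^sup>2 * n3"
          using l False prime_eq_2[OF l(1)] by (metis prime_int_dvd_mult[OF l(1)])
        then show ?thesis using good_odd l(1) False by blast
      qed
    qed
  next
    case False
    then have "even n3" unfolding n3_eq by simp
    then obtain r where r: "n3 = 2 * r" by blast
    have "odd r"
    proof
      assume "even r"
      then have "4 dvd n'" unfolding n3_eq r by auto
      then show False using False by simp
    qed
    have "odd y'"
      using coprime_ny False coprime_common_divisor[of n' y' 2] by auto
    let ?a = "y'\<^sup>2 * r"
    have a3: "\<not> 3 dvd ?a" using y2 n3 r by (simp add: prime_dvd_mult_iff)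
    have ca: "coprime ?a (nrm \<alpha>)" using coprime_nrm(2,6) r by simp
    have A: "[int (f ?a) + int j * sq_index ?a = 0] (mod 3)"
    proof (rule good_reciprocity)
      show "?a \<noteq> 0" using y'_not_0 n3_0 r by simp
      fix l :: nat assume l: "prime l" "int l dvd ?a"
      have "l \<noteq> 2" using l(2) \<open>odd r\<close> \<open>odd y'\<close> by auto
      then show "good l" using good_odd l r by (simp add: mult.left_commute)
    qed fact+
    have Q: "Q = 2 * (2 * (2 * ?a))" unfolding Q_def unfolding r by simp
    have c2a: "coprime (2 * ?a) (nrm \<alpha>)" "coprime (2 * (2 * ?a)) (nrm \<alpha>)"
      using ca coprime_nrm(4) by (simp_all only: coprime_mult_left_iff)
    have f1: "[int (f Q) = int (f 2) + int (f (2 * (2 * ?a)))] (mod 3)"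
      unfolding Q by (intro mult_int coprime_nrm c2a)
    have f2: "[int (f (2 * (2 * ?a))) = int (f 2) + int (f (2 * ?a))] (mod 3)"
      by (intro mult_int coprime_nrm c2a)
    have f3: "[int (f (2 * ?a)) = int (f 2) + int (f ?a)] (mod 3)"
      by (intro mult_int coprime_nrm ca)
    have "[int (f Q) = int (f 2) + (int (f 2) + (int (f 2) + int (f ?a)))] (mod 3)"
      by (rule cong_trans[OF f1 cong_add[OF cong_refl cong_trans[OF f2 cong_add[OF cong_refl f3]]]])
    then have F: "[int (f Q) = int (f ?a)] (mod 3)"
      by (simp add: cong_def)
    have "[sq_index (8 * ?a) = sq_index 8 + sq_index ?a] (mod 3)"
      using a3 by (intro sq_index_mult) simp_all
    moreover have "sq_index 8 = 21" by (simp add: sq_index_def)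
    moreover have "Q = 8 * ?a" using Q by linarith
    ultimately have "[sq_index Q = 21 + sq_index ?a] (mod 3)" by simp
    moreover have "[21 + sq_index ?a = sq_index ?a] (mod 3)" by (simp add: cong_iff_dvd_diff)
    ultimately have "[sq_index Q = sq_index ?a] (mod 3)" by (rule cong_trans)
    then have "[int (f Q) + int j * sq_index Q = int (f ?a) + int j * sq_index ?a] (mod 3)"
      using F by (intro cong_add cong_mult cong_refl)
    then show ?thesis using A cong_trans by blast
  qed
qed

lemma f_power: "coprime s (nrm \<alpha>) \<Longrightarrow> [int (f (s ^ i)) = int i * int (f s)] (mod 3)"
proof (induction i)
  case 0
  then show ?case using f_1 by simp
next
  case (Suc i)
  have "[int (f (s * s ^ i)) = int (f s) + int (f (s ^ i))] (mod 3)"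
    using Suc.prems by (intro mult_int) simp_all
  also have "[int (f s) + int (f (s ^ i)) = int (f s) + int i * int (f s)] (mod 3)"
    using Suc by (intro cong_add cong_refl) blast
  finally show ?case by (simp add: algebra_simps)
qed

text \<open>Modulo \<open>nrm \<alpha>\<close>, n'^2 p is -12 y'^2. Multiplication by
  \<open>n3\<close> completes n3^2 to a cube and leaves -3 Q on the right, so up to cubes p is 3^(1
  - 2 \<phi>) Q, and -2 \<phi> is \<phi> modulo 3.\<close>

theorem index_p: "[int (f (int p)) = (1 + int \<phi>) * int (f 3) - int j * sq_index Q] (mod 3)"
proof -
  have cQ: "coprime Q (nrm \<alpha>)"
  proof -
    have "coprime (2 * 2) (nrm \<alpha>)" using coprime_nrm(4) by (simp only: coprime_mult_left_iff)
    then show ?thesis using coprime_nrm unfolding Q_def by simp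
  qed
  have "nrm \<alpha> dvd (n'\<^sup>2 * int p + 12 * y'\<^sup>2) * n3"
    unfolding nrm_eq by simp
  moreover have "(3 ^ (2 * \<phi>) * n3 ^ 3) * int p - (- 1) * (3 * Q) = (n'\<^sup>2 * int p + 12 * y'\<^sup>2) * n3"
    by (simp add: Q_def n3_eq algebra_simps power2_eq_square power3_eq_cube power_mult power_add flip: power_mult_distrib)
  ultimately have "[(3 ^ (2 * \<phi>) * n3 ^ 3) * int p = (- 1) * (3 * Q)] (mod nrm \<alpha>)"
    by (simp only: cong_iff_dvd_diff)
  then have P: "f ((3 ^ (2 * \<phi>) * n3 ^ 3) * int p) = f ((- 1) * (3 * Q))"
    by (rule periodic)
  have "[int (f ((3 ^ (2 * \<phi>) * n3 ^ 3) * int p)) =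
      (int (2 * \<phi>) * int (f 3) + int 3 * int (f n3)) + int (f (int p))] (mod 3)"
    using coprime_nrm
    by (intro cong_trans[OF mult_int] cong_add cong_trans[OF mult_int] f_power cong_refl) simp_all
  moreover have "[int (f ((- 1) * (3 * Q))) = 0 + (int (f 3) + int (f Q))] (mod 3)"
    using coprime_nrm cQ
    by (intro cong_trans[OF mult_int] cong_add mult_int f_neg_1) simp_all
  ultimately have "[(int (2 * \<phi>) * int (f 3) + int 3 * int (f n3)) + int (f (int p)) =
      0 + (int (f 3) + int (f Q))] (mod 3)"
    unfolding P using cong_sym cong_trans by blast
  then obtain k1 where k1: "(int (2 * \<phi>) * int (f 3) + int 3 * int (f n3)) + int (f (int p)) -
      (0 + (int (f 3) + int (f Q))) = 3 * k1"
    by (rule cong_3E)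
  obtain k2 where k2: "int (f Q) + int j * sq_index Q - 0 = 3 * k2"
    using Q_reciprocity by (rule cong_3E)
  have "int (f (int p)) - ((1 + int \<phi>) * int (f 3) - int j * sq_index Q) =
      3 * (k1 + k2 - int (f n3) - int \<phi> * int (f 3))"
    using k1 k2 by (simp add: algebra_simps)
  then show ?thesis unfolding cong_iff_dvd_diff by (rule dvdI)
qed

end

section \<open>Binet's formula modulo p\<close>

lemma idcong_diff: "idcong a b x y \<Longrightarrow> idcong a b x' y' \<Longrightarrow> idcong a b (x - x') (y - y')"
  using idcong_add[of a b x y "- 1 * x'" "- 1 * y'"] idcong_mult_left[of a b x' y' "- 1"] by simp

text \<open>Binet's formula with the denominator E - E' multiplied out, so that no inverse is
  required in the ring.\<close>

lemma lucas_U_dcong: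
  assumes "dcong a (of_int b) (E + E')" "dcong a 1 (E * E')"
  shows "dcong a (of_int (lucas_U b 1 t) * (E - E')) (E ^ t - E' ^ t)"
proof (induction t rule: induct_nat_012)
  case (ge2 t)
  have "of_int (lucas_U b 1 (Suc (Suc t))) * (E - E') =
      of_int b * (of_int (lucas_U b 1 (Suc t)) * (E - E')) - 1 * (of_int (lucas_U b 1 t) * (E - E'))"
    by (simp add: algebra_simps)
  also have "dcong a \<dots> ((E + E') * (E ^ Suc t - E' ^ Suc t) - (E * E') * (E ^ t - E' ^ t))"
    by (intro idcong_diff idcong_mult assms ge2)
  also have "\<dots> = E ^ Suc (Suc t) - E' ^ Suc (Suc t)"
    by (simp add: algebra_simps)
  finally show ?case .
qed simp_all

lemma dcong_of_int: "[a = b] (mod l) \<Longrightarrow> dcong (of_int l) (of_int a) (of_int b)"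
  unfolding dcong_iff cong_iff_dvd_diff by (metis of_int_diff of_int_dvd_of_intI)

context decomposed
begin

lemma cube_norm_unit:
  assumes "\<not> int p dvd r"
  shows "dcong (of_int (int p)) (cube_norm (of_int r * rt ^ i) ^ k) 1"
  using cube_norm_power_1[OF prime_p p_k assms] .

lemma p_not_dvd_gc: "\<not> int p dvd g * c"
proof -
  have "\<not> int p dvd c"
  proof
    assume "int p dvd c"
    then have "int p dvd 3 ^ e * c\<^sup>2 * nrm \<alpha>" by (simp add: power2_eq_square)
    then have "int p dvd n'\<^sup>2 * int p + 12 * y'\<^sup>2" unfolding nrm_eq .
    then have "int p dvd 12 * y'\<^sup>2" by (simp add: dvd_add_right_iff)
    moreover have "(12::int) * y'\<^sup>2 = 2 * 2 * 3 * (y' * y')" by (simp add: power2_eq_square)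
    ultimately have "int p dvd 2 \<or> int p dvd 3 \<or> int p dvd y'"
      by (metis prime_int_dvd_mult[OF prime_p])
    then show False using p_not_dvd y_eq by auto
  qed
  then show ?thesis using p_n n_eq by (simp add: prime_int_dvd_mult[OF prime_p])
qed

lemma coprime_p: "\<not> int p dvd a \<Longrightarrow> coprime a (int p)"
  using prime_imp_coprime[of "int p" a] prime_p by (simp add: coprime_commute)

text \<open>As E has norm 1 modulo p, it equals its own \<open>cube_norm\<close>, which puts E^k
  into the form of Euler's criterion. The factors 2 y \<open>rt\<close> and g c
  \<open>rt ^ e\<close> have trivial symbol at p, so only \<open>om ^ j\<close> and \<alpha>
  remain.\<close>

lemma power_om_p:
  assumes "dcong (of_int (int p)) (of_int (2 * y) * rt * E) (of_int (n * x) + of_int (m * y) * rt)"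
    and "dcong (of_int (int p)) (E * cnj E) 1"
  shows "dcong (of_int (int p)) (E ^ k) (om ^ (j * k + 2 * f (int p)))"
proof -
  let ?P = "of_int (int p) :: eis"
  have y2: "\<not> int p dvd 2 * y"
    using p_not_dvd by (simp add: prime_int_dvd_mult[OF prime_p])
  have pN: "\<not> int p dvd nrm \<alpha>"
    using prime_dvd_nrm(3)[OF prime_p] by blast
  have one: "dcong ?P 1 (cube_norm (of_int r * rt ^ i) ^ k)" if "\<not> int p dvd r" for r i
    using cube_norm_unit[OF that] by (rule idcong_sym)
  have E: "dcong ?P E (cube_norm E)"
    using idcong_mult[OF idcong_sym[OF assms(2)] idcong_refl, of E] by (simp add: cube_norm_def)
  have "E ^ k = 1 * E ^ k" by simp
  also have "dcong ?P \<dots> (cube_norm (of_int (2 * y) * rt ^ 1) ^ k * cube_norm E ^ k)"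
    by (intro idcong_mult idcong_power E one y2)
  also have "\<dots> = cube_norm (of_int (2 * y) * rt * E) ^ k"
    by (simp only: cube_norm_mult power_mult_distrib power_one_right)
  also have "dcong ?P \<dots> (cube_norm (of_int (n * x) + of_int (m * y) * rt) ^ k)"
    by (intro idcong_power dcong_cube_norm assms)
  also have "\<dots> = cube_norm (of_int (g * c) * rt ^ e) ^ k * (om ^ (j * k) * cube_norm \<alpha> ^ k)"
    unfolding eis_factorization
    by (simp only: cube_norm_mult cube_norm_om power_mult_distrib power_mult mult.assoc)
  also have "dcong ?P \<dots> (1 * (om ^ (j * k) * om ^ (2 * f (int p))))"
    using law_1[OF prime_p pN p_k]
    by (intro idcong_mult idcong_refl cube_norm_unit p_not_dvd_gc) (simp add: cube_norm_nrm)
  finally show ?thesis by (simp add: power_add)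
qed

theorem lucas_U_cong:
  "[lucas_U m 1 k = sgn3 (j * k + 2 * f (int p)) * frac_mod (int p) x (d * n * y)] (mod int p)"
proof -
  let ?P = "of_int (int p) :: eis" and ?U = "lucas_U m 1 k" and ?i = "j * k + 2 * f (int p)"
  obtain H where H: "[2 * H = 1] (mod int p)"
    using cong_solve_coprime_int[OF coprime_p[OF p_not_dvd(3)]] by blast
  have y3p: "\<not> int p dvd 3 * y"
    using p_not_dvd by (simp add: prime_int_dvd_mult[OF prime_p])
  then obtain t where t: "[3 * y * t = 1] (mod int p)"
    using cong_solve_coprime_int[OF coprime_p] by blast
  \<comment> \<open>\<rho> is -x / (3 y) modulo p; because \<open>rt\<close> squares to -3, \<rho>
    \<open>rt\<close> is x / (y \<open>rt\<close>), the square root of d. Likewise \<open>H\<close>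
    is 1/2.\<close>
  define \<rho> where "\<rho> = - x * t"
  have "[- x * (3 * y * t) = - x * 1] (mod int p)"
    using t by (rule cong_scalar_left)
  then have \<rho>: "[3 * y * \<rho> = - x] (mod int p)"
    by (simp add: \<rho>_def mult_ac)
  define E where "E = of_int H * (of_int m + of_int (n * \<rho>) * rt)"
  have H': "[2 * H * z = z] (mod int p)" for z
    using cong_scalar_right[OF H, of z] by simp
  have sum: "dcong ?P (of_int m) (E + cnj E)"
  proof -
    have "E + cnj E = of_int (2 * H * m)"
      by (intro eis_eqI) (simp_all add: E_def algebra_simps)
    then show ?thesis using dcong_of_int[OF cong_sym[OF H']] by (simp only:)
  qed
  have diff: "dcong ?P (E - cnj E) (of_int (n * \<rho>) * rt)"
  proof -
    have "E - cnj E = of_int (2 * H * (n * \<rho>)) * rt"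
      by (intro eis_eqI) (simp_all add: E_def algebra_simps)
    then show ?thesis using idcong_mult[OF dcong_of_int[OF H'] idcong_refl] by (simp only:)
  qed
  have base: "dcong ?P (of_int (2 * y) * rt * E) (of_int (n * x) + of_int (m * y) * rt)"
  proof -
    have "of_int (2 * y) * rt * E = of_int (2 * H * (n * - (3 * y * \<rho>))) + of_int (2 * H * (m * y)) * rt"
      by (intro eis_eqI) (simp_all add: E_def algebra_simps)
    also have "dcong ?P \<dots> (of_int (n * x) + of_int (m * y) * rt)"
    proof (intro idcong_add idcong_mult idcong_refl dcong_of_int H')
      have "[n * - (3 * y * \<rho>) = n * - (- x)] (mod int p)"
        using \<rho> by (intro cong_scalar_left) (simp only: cong_minus_minus_iff)
      then show "[2 * H * (n * - (3 * y * \<rho>)) = n * x] (mod int p)"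
        using H'[of "n * - (3 * y * \<rho>)"] cong_trans by fastforce
    qed
    finally show ?thesis .
  qed
  have x2: "[x\<^sup>2 = - (3 * d * y\<^sup>2)] (mod int p)"
    unfolding p_eq by (simp add: cong_iff_dvd_diff)
  have norm: "dcong ?P 1 (E * cnj E)"
  proof -
    have "[(2 * y)\<^sup>2 * 3 * nrm E = (2 * y)\<^sup>2 * 3 * 1] (mod int p)"
    proof -
      have N: "nrm (of_int (2 * y) * rt * E) = (2 * y)\<^sup>2 * 3 * nrm E"
        by (simp only: nrm_mult nrm_simps)
      have D: "dcong ?P (of_int (nrm (of_int (2 * y) * rt * E))) (of_int (nrm (of_int (n * x) + of_int (m * y) * rt)))"
        unfolding mult_cnj[symmetric] by (intro idcong_mult dcong_cnj base)
      have "int p dvd nrm (of_int (2 * y) * rt * E) - nrm (of_int (n * x) + of_int (m * y) * rt)"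
        using D unfolding dcong_iff of_int_dvd_eis by simp
      moreover have "nrm (of_int (n * x) + of_int (m * y) * rt) = n\<^sup>2 * int p + (2 * y)\<^sup>2 * 3"
      proof -
        have m2: "m\<^sup>2 = d * n\<^sup>2 + 4" using pell by simp
        have "nrm (of_int (n * x) + of_int (m * y) * rt) = n\<^sup>2 * x\<^sup>2 + 3 * m\<^sup>2 * y\<^sup>2"
          by (simp only: nrm_rt_form power_mult_distrib mult.assoc)
        then show ?thesis unfolding m2 p_eq by (simp add: algebra_simps power2_eq_square)
      qed
      ultimately have "int p dvd (2 * y)\<^sup>2 * 3 * nrm E - (n\<^sup>2 * int p + (2 * y)\<^sup>2 * 3)"
        unfolding N by (simp only:)
      then have "int p dvd ((2 * y)\<^sup>2 * 3 * nrm E - (n\<^sup>2 * int p + (2 * y)\<^sup>2 * 3)) + n\<^sup>2 * int p"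
        by (intro dvd_add) simp_all
      then show ?thesis by (simp add: cong_iff_dvd_diff algebra_simps)
    qed
    moreover have "\<not> int p dvd (2 * y)\<^sup>2 * 3"
      unfolding power2_eq_square prime_int_dvd_mult[OF prime_p] using p_not_dvd by blast
    then have "coprime ((2 * y)\<^sup>2 * 3) (int p)" by (rule coprime_p)
    ultimately have "[nrm E = 1] (mod int p)" using cong_mult_lcancel by blast
    from dcong_of_int[OF cong_sym[OF this]] show ?thesis by (simp add: mult_cnj)
  qed
  have pow: "dcong ?P (E ^ k) (om ^ ?i)"
    by (rule power_om_p[OF base idcong_sym[OF norm]])
  have "dcong ?P (of_int ?U * (of_int (n * \<rho>) * rt)) (of_int ?U * (E - cnj E))"
    by (intro idcong_mult_left idcong_sym[OF diff])
  also have "dcong ?P \<dots> (E ^ k - cnj E ^ k)"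
    by (rule lucas_U_dcong[OF sum norm])
  also have "dcong ?P \<dots> (om ^ ?i - cnj (om ^ ?i))"
    using pow dcong_cnj[OF pow] by (intro idcong_diff) simp_all
  also have "\<dots> = of_int (sgn3 ?i) * rt" by (rule om_minus_cnj)
  finally have "int p dvd ?U * (n * \<rho>) - sgn3 ?i"
    unfolding dcong_iff of_int_dvd_eis by simp
  then have "[?U * (n * \<rho>) = sgn3 ?i] (mod int p)"
    by (simp add: cong_iff_dvd_diff)
  \<comment> \<open>The factor 3 y x removes \<rho> through 3 y \<rho> = -x; then x^2 = -3 d y^2
    brings in d, and 3 y cancels.\<close>
  then have 1: "[?U * (n * \<rho>) * (3 * y * x) = sgn3 ?i * (3 * y * x)] (mod int p)"
    by (rule cong_scalar_right)
  have "[?U * n * x * (3 * y * \<rho>) = ?U * n * x * - x] (mod int p)"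
    using \<rho> by (rule cong_scalar_left)
  then have 2: "[?U * (n * \<rho>) * (3 * y * x) = - (?U * n) * x\<^sup>2] (mod int p)"
    by (simp add: power2_eq_square mult_ac)
  have 3: "[- (?U * n) * x\<^sup>2 = - (?U * n) * - (3 * d * y\<^sup>2)] (mod int p)"
    using x2 by (rule cong_scalar_left)
  have "[(3 * y) * (?U * (d * n * y)) = (3 * y) * (sgn3 ?i * x)] (mod int p)"
    using cong_trans[OF cong_sym[OF 3] cong_trans[OF cong_sym[OF 2] 1]]
    by (simp add: power2_eq_square mult_ac)
  then have 4: "[?U * (d * n * y) = sgn3 ?i * x] (mod int p)"
    using cong_mult_lcancel coprime_p[OF y3p] by blast
  let ?v = "modular_inverse (int p) (d * n * y)"
  have inv: "[d * n * y * ?v = 1] (mod int p)"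
    using p_dny by (intro cong_modular_inverse1)
  have "[?U = ?U * (d * n * y * ?v)] (mod int p)"
    using cong_scalar_left[OF cong_sym[OF inv], of ?U] by simp
  also have "?U * (d * n * y * ?v) = ?U * (d * n * y) * ?v" by (simp add: mult.assoc)
  also have "[\<dots> = sgn3 ?i * x * ?v] (mod int p)"
    using 4 by (rule cong_scalar_right)
  finally show ?thesis by (simp add: frac_mod_def mult.assoc)
qed

lemma sgn3_index:
  "[sgn3 (j * k + 2 * f (int p)) = int j * (int k + sq_index Q) - (1 + int \<phi>) * int (f 3)] (mod 3)"
proof -
  obtain k1 where k1: "int (f (int p)) - ((1 + int \<phi>) * int (f 3) - int j * sq_index Q) = 3 * k1"
    using index_p by (rule cong_3E)
  have "[sgn3 (j * k + 2 * f (int p)) = int j * int k + 2 * int (f (int p))] (mod 3)"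
    using sgn3_cong[of "j * k + 2 * f (int p)"] by simp
  moreover have "int j * int k + 2 * int (f (int p)) -
      (int j * (int k + sq_index Q) - (1 + int \<phi>) * int (f 3)) = 3 * (int (f (int p)) - k1)"
    using k1 by (simp add: algebra_simps)
  then have "[int j * int k + 2 * int (f (int p)) =
      int j * (int k + sq_index Q) - (1 + int \<phi>) * int (f 3)] (mod 3)"
    unfolding cong_iff_dvd_diff by (rule dvdI)
  ultimately show ?thesis by (rule cong_trans)
qed

end

section \<open>Evaluation of the sign modulo 3\<close>

lemma square_cong_1: "\<not> 3 dvd a \<Longrightarrow> [a * a = 1] (mod 3)" for a :: int
  using sq_index_eq[of a] by (simp add: cong_iff_dvd_diff power2_eq_square) (metis dvd_triv_left)

lemma Legendre_3:
  assumes "L \<in> {- 1, 0, 1}" "[L = z] (mod 3)"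
  shows "Legendre z 3 = L"
proof -
  have Q: "QuadRes 3 z \<longleftrightarrow> z mod 3 \<noteq> 2"
  proof
    assume "QuadRes 3 z"
    then obtain a where "[a\<^sup>2 = z] (mod 3)" unfolding QuadRes_def by blast
    moreover have "a\<^sup>2 mod 3 \<noteq> 2"
    proof -
      have "a mod 3 = 0 \<or> a mod 3 = 1 \<or> a mod 3 = 2" by presburger
      then show ?thesis using mod_mult_eq[of a 3 a] by (auto simp: power2_eq_square)
    qed
    ultimately show "z mod 3 \<noteq> 2" by (simp add: cong_def)
  next
    assume "z mod 3 \<noteq> 2"
    then have "z mod 3 = 0 \<or> z mod 3 = 1" by presburger
    then have "[0\<^sup>2 = z] (mod 3) \<or> [1\<^sup>2 = z] (mod 3)" by (auto simp: cong_def)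
    then show "QuadRes 3 z" unfolding QuadRes_def by blast
  qed
  have z: "z mod 3 = L mod 3" using assms(2) by (simp add: cong_def)
  from assms(1) consider "L = - 1" | "L = 0" | "L = 1" by blast
  then show ?thesis
    by cases (use z Q in \<open>auto simp: Legendre_def cong_def\<close>)
qed

lemma sgn3_range: "sgn3 i \<in> {- 1, 0, 1}"
  by (simp add: sgn3_def)

context norm_equation
begin

lemma k_eq: "int k = sq_index x + d * y\<^sup>2"
proof -
  have "3 * int k = int p - 1" using p_k by linarith
  also have "\<dots> = 3 * (sq_index x + d * y\<^sup>2)"
    using sq_index_eq[OF x3] p_eq by (simp add: algebra_simps)
  finally show ?thesis by simp
qed

lemma n_not_0: "n \<noteq> 0"
  using p_n by auto

text \<open>The normalization x = y modulo 3 enters here: it fixes the sign of x / y and lets x y'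
  be traded for g, which recombines with n' to n.\<close>

lemma xy_quotient:
  assumes "y = g * y'"
  shows "[x * y' = g] (mod 3)"
proof -
  have "\<not> 3 dvd y'" using y3 assms by auto
  then have "[g * (y' * y') = g * 1] (mod 3)"
    by (intro cong_scalar_left square_cong_1)
  then have "[y * y' = g] (mod 3)"
    by (simp add: assms mult.assoc)
  moreover have "[x * y' = y * y'] (mod 3)"
    using xy by (rule cong_scalar_right)
  ultimately show ?thesis using cong_trans by blast
qed

lemma sq_index_Q:
  assumes "\<not> 3 dvd a" "\<not> 3 dvd b"
  shows "[sq_index (4 * a\<^sup>2 * b) = 5 + (sq_index a + sq_index a) + sq_index b] (mod 3)"
proof -
  have "\<not> 3 dvd a * a" "\<not> 3 dvd 4 * (a * a)" using assms by (simp_all add: prime_dvd_mult_iff)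
  then have "[sq_index (4 * (a * a) * b) = sq_index 4 + sq_index (a * a) + sq_index b] (mod 3)"
    using assms by (intro cong_trans[OF sq_index_mult] cong_add sq_index_mult cong_refl) simp_all
  also have "[sq_index 4 + sq_index (a * a) + sq_index b = 5 + (sq_index a + sq_index a) + sq_index b] (mod 3)"
    using assms by (intro cong_add sq_index_mult cong_refl) (simp_all add: sq_index_def)
  finally show ?thesis by (simp add: power2_eq_square)
qed

text \<open>If 3 | m, then j = 0 and only the symbol of 3 is left. Otherwise m^2 - 4 = d n^2 forces
  3 | d, so k is \<open>sq_index x\<close> modulo 3, and the indices of x, y' and n' cancel.\<close>

lemma lucas_U_not_3_dvd_n:
  assumes "\<not> 3 dvd n"
  obtains i where "[lucas_U m 1 k = sgn3 i * frac_mod (int p) x (d * n * y)] (mod int p)"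
    and "3 dvd m \<Longrightarrow> [sgn3 i = (m div 3) * n] (mod 3)"
    and "\<not> 3 dvd m \<Longrightarrow> [sgn3 i = - (m * n) * (2 + sq_index m)] (mod 3)"
proof -
  define g where "g = gcd n y"
  obtain n' y' where ny: "n = g * n'" "y = g * y'" "coprime n' y'"
    using gcd_coprime_exists[of n y] n_not_0 unfolding g_def by (auto simp: mult.commute)
  have n'3: "\<not> 3 dvd n'" and y'3: "\<not> 3 dvd y'"
    using assms y3 ny by auto
  define A M where "A = n' * x" and "M = m * y'"
  have A3: "\<not> 3 dvd A" using n'3 x3 by (simp add: A_def prime_dvd_mult_iff)
  obtain c j \<alpha> where dec: "of_int A + of_int M * rt = of_int c * om ^ j * \<alpha>" "primary \<alpha>"
      "[int j = - (A * M)] (mod 3)"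
      "\<And>f. cubic_index \<alpha> f \<Longrightarrow> 3 dvd M \<Longrightarrow> [int (f 3) = - A * (M div 3)] (mod 3)"
      "\<And>f. cubic_index \<alpha> f \<Longrightarrow> \<not> 3 dvd M \<Longrightarrow> [int (f 3) = int j * (sq_index A - sq_index M)] (mod 3)"
    using primary_decomposition[OF A3] by blast
  obtain f where f: "cubic_index \<alpha> f" using cubic_index_exists[OF dec(2)] by blast
  interpret decomposed d m n x y p \<alpha> f g n' y' A M c n' 0 j 0
  proof (intro decomposed.intro primary_index.intro)
    show "primary_index_axioms \<alpha>" by unfold_locales (rule dec)
    show "decomposed_axioms m n x y \<alpha> g n' y' A M c n' 0 j 0"
      by unfold_locales (use ny dec(1) n'3 in \<open>auto simp: A_def M_def\<close>)
  qed (rule norm_equation_axioms f)+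
  note xy' = xy_quotient[OF ny(2)]
  let ?i = "j * k + 2 * f (int p)"
  have S: "[sgn3 ?i = int j * (int k + sq_index Q) - int (f 3)] (mod 3)"
    using sgn3_index by simp
  show thesis
  proof (rule that[OF lucas_U_cong])
    assume m3: "3 dvd m"
    then obtain \<mu> where \<mu>: "m = 3 * \<mu>" by blast
    have M3: "3 dvd M" "M div 3 = \<mu> * y'" by (simp_all add: M_def \<mu>)
    have "[- (A * M) = 0] (mod 3)" using M3(1) by (simp add: cong_0_iff)
    then have j0: "[int j = 0] (mod 3)" using dec(3) cong_trans by blast
    have "[int j * (int k + sq_index Q) - int (f 3) = 0 * (int k + sq_index Q) - (- A * (M div 3))] (mod 3)"
      by (intro cong_diff cong_mult cong_refl j0 dec(4)[OF f M3(1)])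
    also have "0 * (int k + sq_index Q) - (- A * (M div 3)) = \<mu> * n' * (x * y')"
      by (simp add: A_def M3(2))
    also have "[\<mu> * n' * (x * y') = \<mu> * n' * g] (mod 3)"
      using xy' by (rule cong_scalar_left)
    also have "\<mu> * n' * g = (m div 3) * n" using \<mu> by (simp add: ny(1))
    finally show "[sgn3 ?i = (m div 3) * n] (mod 3)" using S cong_trans by blast
  next
    assume m3: "\<not> 3 dvd m"
    have M3: "\<not> 3 dvd M" using m3 y'3 by (simp add: M_def prime_dvd_mult_iff)
    have d3: "3 dvd d"
    proof -
      have "d * n\<^sup>2 = 3 * (sq_index m - 1)"
        using pell sq_index_eq[OF m3] by simp
      then have "3 dvd d * n\<^sup>2" by simp
      then show ?thesis using assms by (simp add: prime_dvd_mult_iff prime_dvd_power_iff)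
    qed
    have "[int k = sq_index x] (mod 3)"
      using d3 unfolding k_eq by (simp add: cong_iff_dvd_diff)
    then have "[int k + sq_index Q - sq_index A + sq_index M =
        sq_index x + (5 + (sq_index y' + sq_index y') + sq_index n') - (sq_index n' + sq_index x) + (sq_index m + sq_index y')] (mod 3)"
      unfolding Q_def A_def M_def
      by (intro cong_add cong_diff sq_index_Q sq_index_mult n'3 y'3 x3 m3)
    also have "sq_index x + (5 + (sq_index y' + sq_index y') + sq_index n') - (sq_index n' + sq_index x) + (sq_index m + sq_index y') = (2 + sq_index m) + 3 * (1 + sq_index y')"
      by simp
    also have "[(2 + sq_index m) + 3 * (1 + sq_index y') = 2 + sq_index m] (mod 3)"
      by (simp only: cong_iff_dvd_diff add_diff_cancel_left' dvd_triv_left)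
    finally have I: "[int k + sq_index Q - sq_index A + sq_index M = 2 + sq_index m] (mod 3)" .
    have "[int j = - (m * n') * (x * y')] (mod 3)"
      using dec(3) by (simp add: A_def M_def mult_ac)
    also have "[- (m * n') * (x * y') = - (m * n') * g] (mod 3)"
      using xy' by (rule cong_scalar_left)
    also have "- (m * n') * g = - (m * n)" by (simp add: ny(1))
    finally have J: "[int j = - (m * n)] (mod 3)" .
    have "[int j * (int k + sq_index Q) - int (f 3) = int j * (int k + sq_index Q) - int j * (sq_index A - sq_index M)] (mod 3)"
      by (intro cong_diff cong_refl dec(5)[OF f M3])
    also have "int j * (int k + sq_index Q) - int j * (sq_index A - sq_index M) = int j * (int k + sq_index Q - sq_index A + sq_index M)"
      by (simp add: algebra_simps)
    also have "[\<dots> = - (m * n) * (2 + sq_index m)] (mod 3)"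
      by (intro cong_mult I J)
    finally show "[sgn3 ?i = - (m * n) * (2 + sq_index m)] (mod 3)" using S cong_trans by blast
  qed
qed

text \<open>A factor \<open>rt\<close> is extracted, and the exponent of 3 in n' is \<phi> + 1. For
  \<phi> = 0 the coefficient 2 + \<phi> of the symbol of 3 acts as -1 and the indices combine to d;
  for larger \<phi> both sides vanish modulo 3.\<close>

lemma lucas_U_3_dvd_n:
  assumes n_nu: "n = 3 * \<nu>" and m: "m = 2 + 9 * t"
  obtains i where "[lucas_U m 1 k = sgn3 i * frac_mod (int p) x (d * n * y)] (mod int p)"
    and "[sgn3 i = - (\<nu> * t)] (mod 3)"
proof -
  define g where "g = gcd n y"
  obtain n' y' where ny: "n = g * n'" "y = g * y'" "coprime n' y'"
    using gcd_coprime_exists[of n y] n_not_0 unfolding g_def by (auto simp: mult.commute)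
  have g3: "\<not> 3 dvd g" and y'3: "\<not> 3 dvd y'"
    using y3 ny by auto
  have m3: "\<not> 3 dvd m" using m by presburger
  have "3 dvd g * n'" using n_nu ny(1) by simp
  then have n'3: "3 dvd n'" using g3 by (simp add: prime_dvd_mult_iff)
  have "n' \<noteq> 0" using n_not_0 ny(1) by auto
  moreover have "\<not> is_unit (3::int)" by simp
  ultimately obtain r where r: "n' = 3 ^ multiplicity 3 n' * r" "\<not> 3 dvd r"
    by (metis multiplicity_decompose')
  have "multiplicity 3 n' \<noteq> 0"
    using r n'3 by (metis mult_1 power_0)
  then obtain \<phi> where "multiplicity 3 n' = Suc \<phi>"
    using not0_implies_Suc by blast
  then have r\<phi>: "n' = 3 ^ Suc \<phi> * r" using r(1) by simp
  define \<nu>' where "\<nu>' = 3 ^ \<phi> * r"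
  have n': "n' = 3 * \<nu>'" by (simp add: r\<phi> \<nu>'_def)
  have \<nu>: "\<nu> = g * \<nu>'" using n_nu ny(1) n' by simp
  define A M where "A = m * y'" and "M = - \<nu>' * x"
  have A3: "\<not> 3 dvd A" using m3 y'3 by (simp add: A_def prime_dvd_mult_iff)
  obtain c j \<alpha> where dec: "of_int A + of_int M * rt = of_int c * om ^ j * \<alpha>" "primary \<alpha>"
      "[int j = - (A * M)] (mod 3)"
      "\<And>f. cubic_index \<alpha> f \<Longrightarrow> 3 dvd M \<Longrightarrow> [int (f 3) = - A * (M div 3)] (mod 3)"
      "\<And>f. cubic_index \<alpha> f \<Longrightarrow> \<not> 3 dvd M \<Longrightarrow> [int (f 3) = int j * (sq_index A - sq_index M)] (mod 3)"
    using primary_decomposition[OF A3] by blast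
  obtain f where f: "cubic_index \<alpha> f" using cubic_index_exists[OF dec(2)] by blast
  interpret decomposed d m n x y p \<alpha> f g n' y' A M c r 1 j "Suc \<phi>"
  proof (intro decomposed.intro primary_index.intro)
    show "primary_index_axioms \<alpha>" by unfold_locales (rule dec)
    show "decomposed_axioms m n x y \<alpha> g n' y' A M c r 1 j (Suc \<phi>)"
      by unfold_locales (use ny dec(1) r(2) r\<phi> n' in \<open>auto simp: A_def M_def\<close>)
  qed (rule norm_equation_axioms f)+
  note xy' = xy_quotient[OF ny(2)]
  let ?i = "j * k + 2 * f (int p)"
  have S: "[sgn3 ?i = int j * (int k + sq_index Q) - (2 + int \<phi>) * int (f 3)] (mod 3)"
    using sgn3_index by (simp add: add_ac)
  have "[sgn3 ?i = - (\<nu> * t)] (mod 3)"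
  proof (cases "\<phi> = 0")
    case True
    then have \<nu>'r: "\<nu>' = r" by (simp add: \<nu>'_def)
    have M3: "\<not> 3 dvd M" using r(2) x3 by (simp add: M_def \<nu>'r prime_dvd_mult_iff)
    have y1: "[y * y = 1] (mod 3)" using y3 by (rule square_cong_1)
    have hm: "sq_index m = 1 + 3 * (4 * t + 9 * t\<^sup>2)"
      using sq_index_eq[OF m3] by (simp add: m algebra_simps power2_eq_square)
    then have hm1: "[sq_index m = 1] (mod 3)" by (simp add: cong_iff_dvd_diff)
    have "sq_index M = sq_index (r * x)" by (simp add: M_def \<nu>'r)
    then have "[int k + sq_index Q + sq_index A - sq_index M =
        (sq_index x + d * y\<^sup>2) + (5 + (sq_index y' + sq_index y') + sq_index r) + (1 + sq_index y') - (sq_index r + sq_index x)] (mod 3)"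
      unfolding Q_def A_def k_eq
      using cong_trans[OF sq_index_mult[OF m3 y'3] cong_add[OF hm1 cong_refl]] sq_index_mult[OF r(2) x3]
      by (intro cong_add cong_diff sq_index_Q cong_refl y'3 r(2)) simp_all
    also have "(sq_index x + d * y\<^sup>2) + (5 + (sq_index y' + sq_index y') + sq_index r) + (1 + sq_index y') - (sq_index r + sq_index x)
        = d * (y * y) + 3 * (2 + sq_index y')"
      by (simp add: power2_eq_square)
    also have "[d * (y * y) + 3 * (2 + sq_index y') = d * 1 + 0] (mod 3)"
      by (intro cong_add cong_scalar_left y1) (simp add: cong_0_iff)
    finally have I: "[int k + sq_index Q + sq_index A - sq_index M = d] (mod 3)" by simp
    have "[int j = m * r * (x * y')] (mod 3)"
      using dec(3) by (simp add: A_def M_def \<nu>'r mult_ac)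
    also have "[m * r * (x * y') = (- 1) * r * g] (mod 3)"
      using xy' by (intro cong_mult cong_refl) (simp add: m cong_iff_dvd_diff)
    also have "(- 1) * r * g = - \<nu>" by (simp add: \<nu> \<nu>'r)
    finally have J: "[int j = - \<nu>] (mod 3)" .
    \<comment> \<open>This is m^2 - 4 = d n^2 divided by 9, reduced modulo 3.\<close>
    have td: "[t = d] (mod 3)"
    proof -
      have "9 * (t * (9 * t + 4)) = 9 * (d * (\<nu> * \<nu>))"
      proof -
        have "9 * (t * (9 * t + 4)) = (2 + 9 * t)\<^sup>2 - 4"
          by (simp add: algebra_simps power2_eq_square)
        moreover have "d * (3 * \<nu>)\<^sup>2 = 9 * (d * (\<nu> * \<nu>))"
          by (simp add: power2_eq_square)
        moreover have "(2 + 9 * t)\<^sup>2 - d * (3 * \<nu>)\<^sup>2 = 4"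
          using pell m n_nu by (simp only:)
        ultimately show ?thesis by linarith
      qed
      then have t: "t * (9 * t + 4) = d * (\<nu> * \<nu>)" by simp
      have "\<not> 3 dvd \<nu>" using g3 r(2) by (simp add: \<nu> \<nu>'r prime_dvd_mult_iff)
      then have "[d * (\<nu> * \<nu>) = d * 1] (mod 3)" by (intro cong_scalar_left square_cong_1)
      moreover have "t * (9 * t + 4) - t = 3 * (3 * t\<^sup>2 + t)"
        by (simp add: algebra_simps power2_eq_square)
      then have "[t * (9 * t + 4) = t] (mod 3)"
        unfolding cong_iff_dvd_diff by (rule dvdI)
      ultimately show ?thesis unfolding t by (metis cong_sym cong_trans mult_1_right)
    qed
    have "[int j * (int k + sq_index Q) - (2 + int \<phi>) * int (f 3) =
        int j * (int k + sq_index Q) - (- 1) * (int j * (sq_index A - sq_index M))] (mod 3)"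
      using dec(5)[OF f M3] True by (intro cong_diff cong_mult cong_refl) (simp_all add: cong_iff_dvd_diff)
    also have "int j * (int k + sq_index Q) - (- 1) * (int j * (sq_index A - sq_index M)) = int j * (int k + sq_index Q + sq_index A - sq_index M)"
      by (simp add: algebra_simps)
    also have "[int j * (int k + sq_index Q + sq_index A - sq_index M) = - \<nu> * t] (mod 3)"
      by (intro cong_mult J cong_trans[OF I cong_sym[OF td]])
    finally have "[sgn3 ?i = - \<nu> * t] (mod 3)"
      by (rule cong_trans[OF S])
    then show ?thesis by simp
  next
    case False
    then obtain \<psi> where \<psi>: "\<phi> = Suc \<psi>" using not0_implies_Suc by blast
    have M: "M = 3 * (- (3 ^ \<psi> * r) * x)" by (simp add: M_def \<nu>'_def \<psi>)
    then have M3: "3 dvd M" "M div 3 = - (3 ^ \<psi> * r) * x" by simp_all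
    have "[- (A * M) = 0] (mod 3)" using M3(1) by (simp add: cong_0_iff)
    then have j0: "[int j = 0] (mod 3)" using dec(3) cong_trans by blast
    \<comment> \<open>If 3 divides n' exactly twice, the coefficient 2 + \<phi> is 3; if more often,
      \<open>M div 3\<close> is still a multiple of 3.\<close>
    have z: "[(2 + int \<phi>) * (- A * (M div 3)) = 0] (mod 3)"
    proof (cases \<psi>)
      case 0
      then show ?thesis by (simp add: \<psi> cong_0_iff)
    next
      case (Suc \<psi>')
      then show ?thesis unfolding M3(2) by (simp add: cong_0_iff)
    qed
    have "[int j * (int k + sq_index Q) - (2 + int \<phi>) * int (f 3) = 0 * (int k + sq_index Q) - 0] (mod 3)"
      using z by (intro cong_diff cong_mult j0 cong_refl cong_trans[OF cong_mult[OF cong_refl dec(4)[OF f M3(1)]]])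
    moreover have "3 dvd \<nu> * t" by (simp add: \<nu> \<nu>'_def \<psi>)
    then have "[0 * (int k + sq_index Q) - 0 = - (\<nu> * t)] (mod 3)" by (simp add: cong_iff_dvd_diff)
    ultimately show ?thesis using S cong_trans by blast
  qed
  with lucas_U_cong show thesis by (rule that)
qed

text \<open>Otherwise 9 would divide m^2 - 4 = d n^2 and hence the squarefree d. This makes the
  cases modulo 27 vacuous when 3 does not divide n.\<close>

lemma not_cong_2_mod_9:
  assumes "\<not> 3 dvd n"
  shows "\<not> [m = 2] (mod 9)"
proof
  assume "[m = 2] (mod 9)"
  then obtain t where "m - 2 = 9 * t" by (auto simp: cong_iff_dvd_diff)
  then have m: "m = 2 + 9 * t" by simp
  have "d * n\<^sup>2 = 3\<^sup>2 * (t * (9 * t + 4))"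
    using pell by (simp add: m algebra_simps power2_eq_square)
  then have "3\<^sup>2 dvd d * n\<^sup>2" by simp
  moreover have "coprime (3\<^sup>2) (n\<^sup>2)"
  proof -
    have "coprime 3 n" using assms prime_imp_coprime[of "3::int" n] by simp
    then show ?thesis by (simp only: coprime_power_left_iff coprime_power_right_iff) simp
  qed
  ultimately have "3\<^sup>2 dvd d" using coprime_dvd_mult_left_iff by blast
  then have "is_unit (3::int)" using squarefree_d unfolding squarefree_def by blast
  then show False by simp
qed

text \<open>The choice of the sign of m gives 3 | m - 2. Then 3 does not divide (m + 2) / 1 = m - 2
  + 4, so the factor 9 of d n^2 = (m - 2)(m + 2) must divide m - 2.\<close>

lemma cong_2_mod_9:
  assumes "3 dvd n" "multiplicity 3 (m - 2) \<ge> multiplicity 3 n"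
  obtains t where "m = 2 + 9 * t"
proof -
  have m2: "m - 2 \<noteq> 0"
    using pell d_gt_1 n_not_0 by auto
  have "multiplicity 3 n \<ge> 1"
    using assms(1) n_not_0 multiplicity_geI[of n "3::int" 1] by simp
  then have "3 ^ 1 dvd m - 2"
    using assms(2) by (intro multiplicity_dvd') simp
  then obtain s where s: "m - 2 = 3 * s" by auto
  obtain \<nu> where \<nu>: "n = 3 * \<nu>" using assms(1) by blast
  have m: "m = 2 + 3 * s" using s by simp
  have "3 * (s * (3 * s + 4)) = 9 * (d * \<nu>\<^sup>2)"
    using pell by (simp add: m \<nu> algebra_simps power2_eq_square)
  then have "s * (3 * s + 4) = 3 * (d * \<nu>\<^sup>2)" by simp
  then have "3 dvd s * (3 * s + 4)" by simp
  moreover have "\<not> 3 dvd 3 * s + 4" by presburger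
  ultimately have "3 dvd s" by (simp add: prime_dvd_mult_iff)
  then obtain t where "s = 3 * t" by blast
  then show ?thesis using that[of t] m by simp
qed

end

theorem corollary8p4:
  fixes d m n x y :: int and p :: nat
  assumes "d > 1" and "squarefree d"
    and "m \<noteq> 0" and "n \<noteq> 0"
    and "m^2 - d * n^2 = 4"
    and "multiplicity 3 (m - 2) \<ge> multiplicity 3 n"
    and "prime p" and "\<not> int p dvd n"
    and "int p = x^2 + 3 * d * y^2"
    and "\<not> 3 dvd y" and "[x = y] (mod 3)"
  shows
    "([m = 2] (mod 27) \<longrightarrow>
        [lucas_U m 1 ((p - 1) div 3) = 0] (mod int p)) \<and>
     ([m = 5] (mod 9) \<or> [m = 8] (mod 9) \<longrightarrow>
        [lucas_U m 1 ((p - 1) div 3) =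
           Legendre ((m - 2) * n div 3) 3 * frac_mod (int p) x (d * n * y)] (mod int p)) \<and>
     ([m = 11] (mod 27) \<or> [m = 20] (mod 27) \<longrightarrow>
        [lucas_U m 1 ((p - 1) div 3) =
           - Legendre ((m - 2) * n div 27) 3 * frac_mod (int p) x (d * n * y)] (mod int p)) \<and>
     ([m = 0] (mod 3) \<longrightarrow>
        [lucas_U m 1 ((p - 1) div 3) =
           Legendre (m * n div 3) 3 * frac_mod (int p) x (d * n * y)] (mod int p)) \<and>
     ([m = 1] (mod 3) \<longrightarrow>
        [lucas_U m 1 ((p - 1) div 3) =
           Legendre ((m + 2) * n div 3) 3 * frac_mod (int p) x (d * n * y)] (mod int p))"
proof -
  interpret norm_equation d m n x y p
    using assms by unfold_locales
  let ?F = "frac_mod (int p) x (d * n * y)"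
  show ?thesis
  proof (cases "3 dvd n")
    case False
    obtain i where U: "[lucas_U m 1 ((p - 1) div 3) = sgn3 i * ?F] (mod int p)"
      and m0: "3 dvd m \<Longrightarrow> [sgn3 i = (m div 3) * n] (mod 3)"
      and m12: "\<not> 3 dvd m \<Longrightarrow> [sgn3 i = - (m * n) * (2 + sq_index m)] (mod 3)"
      using lucas_U_not_3_dvd_n[OF False] unfolding k_def by metis
    have legendre: "[lucas_U m 1 ((p - 1) div 3) = Legendre z 3 * ?F] (mod int p)"
      if "[sgn3 i = z] (mod 3)" for z
      using U Legendre_3[OF sgn3_range that] by simp
    have no: "\<not> m mod 9 = 2"
      using not_cong_2_mod_9[OF False] by (simp add: cong_def)
    moreover have "m mod 9 = m mod 27 mod 9" by (simp add: mod_mod_cancel)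
    ultimately have vac: "\<not> [m = 2] (mod 27)" "\<not> [m = 11] (mod 27)" "\<not> [m = 20] (mod 27)"
      by (auto simp: cong_def)
    have "[lucas_U m 1 ((p - 1) div 3) = Legendre ((m - 2) * n div 3) 3 * ?F] (mod int p)"
      if "m mod 3 = 2"
    proof (rule legendre)
      define t where "t = m div 3"
      have m: "m = 2 + 3 * t" using that unfolding t_def by presburger
      have m3: "\<not> 3 dvd m" using that by presburger
      \<comment> \<open>Modulo 3, 2 + \<open>sq_index m\<close> is t and -m is 1, so the sign is t
        n.\<close>
      have hm: "sq_index m = 3 * t\<^sup>2 + 4 * t + 1"
        using sq_index_eq[OF m3] by (simp add: m algebra_simps power2_eq_square)
      have "(m - 2) * n div 3 = t * n" by (simp add: m)
      moreover have "- (m * n) * (2 + sq_index m) - t * n = 3 * (- n * (2 + 6 * t + 6 * t\<^sup>2 + 3 * t ^ 3))"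
        unfolding hm unfolding m by (simp add: algebra_simps power2_eq_square power3_eq_cube)
      ultimately have "[- (m * n) * (2 + sq_index m) = (m - 2) * n div 3] (mod 3)"
        unfolding cong_iff_dvd_diff by (metis dvd_triv_left)
      then show "[sgn3 i = (m - 2) * n div 3] (mod 3)" using m12[OF m3] cong_trans by blast
    qed
    moreover have "m mod 3 = 2" if "[m = 5] (mod 9) \<or> [m = 8] (mod 9)"
    proof -
      have "m mod 3 = m mod 9 mod 3" by (simp add: mod_mod_cancel)
      then show ?thesis using that by (auto simp: cong_def)
    qed
    moreover have "[lucas_U m 1 ((p - 1) div 3) = Legendre (m * n div 3) 3 * ?F] (mod int p)"
      if "[m = 0] (mod 3)"
    proof (rule legendre)
      have m3: "3 dvd m" using that by (simp add: cong_0_iff)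
      then have "m * n div 3 = (m div 3) * n" by (simp add: dvd_div_mult)
      then show "[sgn3 i = m * n div 3] (mod 3)" using m0[OF m3] by simp
    qed
    moreover have "[lucas_U m 1 ((p - 1) div 3) = Legendre ((m + 2) * n div 3) 3 * ?F] (mod int p)"
      if "[m = 1] (mod 3)"
    proof (rule legendre)
      define t where "t = m div 3"
      have m: "m = 1 + 3 * t" using that unfolding t_def cong_def by presburger
      have m3: "\<not> 3 dvd m" using m by presburger
      \<comment> \<open>Modulo 3, 2 + \<open>sq_index m\<close> is 2 (1 + t) and -m is -1, so the
        sign is (1 + t) n.\<close>
      have hm: "sq_index m = 3 * t\<^sup>2 + 2 * t"
        using sq_index_eq[OF m3] by (simp add: m algebra_simps power2_eq_square)
      have "(m + 2) * n = 3 * ((1 + t) * n)" by (simp add: m algebra_simps)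
      then have "(m + 2) * n div 3 = 3 * ((1 + t) * n) div 3" by (rule arg_cong)
      then have "(m + 2) * n div 3 = (1 + t) * n" by simp
      moreover have "- (m * n) * (2 + sq_index m) - (1 + t) * n = 3 * (- n * (1 + 3 * t + 3 * t\<^sup>2 + 3 * t ^ 3))"
        unfolding hm unfolding m by (simp add: algebra_simps power2_eq_square power3_eq_cube)
      ultimately have "[- (m * n) * (2 + sq_index m) = (m + 2) * n div 3] (mod 3)"
        unfolding cong_iff_dvd_diff by (metis dvd_triv_left)
      then show "[sgn3 i = (m + 2) * n div 3] (mod 3)" using m12[OF m3] cong_trans by blast
    qed
    ultimately show ?thesis using vac by blast
  next
    case True
    then obtain \<nu> where \<nu>: "n = 3 * \<nu>" by blast
    obtain t where m: "m = 2 + 9 * t" by (rule cong_2_mod_9[OF True assms(6)])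
    obtain i where U: "[lucas_U m 1 ((p - 1) div 3) = sgn3 i * ?F] (mod int p)"
      and S: "[sgn3 i = - (\<nu> * t)] (mod 3)"
      using lucas_U_3_dvd_n[OF \<nu> m] unfolding k_def by metis
    have vac: "\<not> ([m = 5] (mod 9) \<or> [m = 8] (mod 9))" "\<not> [m = 0] (mod 3)" "\<not> [m = 1] (mod 3)"
    proof -
      have "m mod 9 = 2" by (simp add: m)
      then show "\<not> ([m = 5] (mod 9) \<or> [m = 8] (mod 9))" by (simp add: cong_def)
      moreover have "m mod 3 = m mod 9 mod 3" by (simp add: mod_mod_cancel)
      ultimately show "\<not> [m = 0] (mod 3)" "\<not> [m = 1] (mod 3)"
        using \<open>m mod 9 = 2\<close> by (simp_all add: cong_def)
    qed
    have "[lucas_U m 1 ((p - 1) div 3) = 0] (mod int p)" if "[m = 2] (mod 27)"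
    proof -
      have "9 * 3 dvd 9 * t" using that by (simp add: m cong_iff_dvd_diff)
      then have "3 dvd t" by (simp only: dvd_mult_cancel_left) simp
      then have "[- (\<nu> * t) = 0] (mod 3)" by (simp add: cong_0_iff)
      then have "Legendre 0 3 = sgn3 i"
        using S cong_trans by (intro Legendre_3 sgn3_range) blast
      then have "sgn3 i = 0" by (simp add: Legendre_def)
      then show ?thesis using U by simp
    qed
    moreover have "[lucas_U m 1 ((p - 1) div 3) = - Legendre ((m - 2) * n div 27) 3 * ?F] (mod int p)"
    proof -
      \<comment> \<open>m - 2 = 9 t and n = 3 \<nu> account for the 27; the minus sign of this case
        is the one in \<open>S\<close>.\<close>
      have "(m - 2) * n div 27 = \<nu> * t" by (simp add: m \<nu>)
      moreover have "Legendre (\<nu> * t) 3 = - sgn3 i"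
      proof (rule Legendre_3)
        show "- sgn3 i \<in> {- 1, 0, 1}" using sgn3_range[of i] by auto
        show "[- sgn3 i = \<nu> * t] (mod 3)"
          using S cong_minus_minus_iff[of "sgn3 i" "- (\<nu> * t)" 3] by simp
      qed
      ultimately show ?thesis using U by simp
    qed
    ultimately show ?thesis using vac by blast
  qed
qed

end
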